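(* $\#\mathrm{para}_{\beta}\text{-}\mathrm{L}\subseteq \mathrm{FFPT}$.
   Context: Inputs are pairs $(x,k)$ with $x\in\{0,1\}^*$ and parameter $k\in\mathbb N$; a parameterised function is a function $F:\{0,1\}^*\times\mathbb N\to\mathbb N$. Machines are TMs with random access to the input. A nondeterministic TM is a deterministic TM with an additional read-only choice tape (not counted for space); a nondeterministic step is one in which the choice-tape head moves to a previously unvisited cell; $\#\mathrm{acc}_M(x,k)$ is the number of accepting computation paths of $M$ on $(x,k)$. A $\mathrm{para}\text{-}\mathrm{L}$-machine uses space $O(\log|x|+f(k))$ on input $(x,k)$ for some computable $f$. A nondeterministic machine is $k$-bounded if for some computable $f$ it reads at most $f(k)\cdot\log|x|$ choice-tape bits on every input $(x,k)$; it has read-once access if its choice-tape head moves only one way. $\#\mathrm{para}_{\beta}\text{-}\mathrm{L}$ is the class of parameterised functions $F$ for which there is a $k$-bounded nondeterministic $\mathrm{para}\text{-}\mathrm{L}$-machine $M$ with read-once access to its nondeterministic bits such that $\#\mathrm{acc}_M(x,k)=F(x,k)$ for all $(x,k)$. $\mathrm{FFPT}$ is the class of functions computable by deterministic TMs with output in time $f(k)\cdot p(|x|)$ for a computable $f$ and a polynomial $p$. *)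

theory Defs
  imports Main "HOL-Library.Log_Nat"
begin

record machine =
  nstates :: nat
  nsyms :: nat
  ntapes :: nat
  start :: nat
  acc :: nat
  rej :: nat
  delta :: "nat \<Rightarrow> nat \<Rightarrow> nat list \<Rightarrow> bool \<Rightarrow> nat \<times> nat list \<times> int list \<times> int"

record config =
  state :: nat
  tapes :: "((nat \<Rightarrow> nat) \<times> nat) list"
  chead :: nat

definition wf_machine :: "machine \<Rightarrow> bool" where
  "wf_machine M \<longleftrightarrow>
     1 \<le> ntapes M \<and> 3 \<le> nsyms M \<and>
     start M < nstates M \<and> acc M < nstates M \<and> rej M < nstates M \<and> acc M \<noteq> rej M \<and>
     (\<forall>q a ws b. q < nstates M \<and> a < 4 \<and> length ws = ntapes M \<and> (\<forall>s\<in>set ws. s < nsyms M) \<longrightarrow>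
        (case delta M q a ws b of (q', wr, mv, cm) \<Rightarrow>
           q' < nstates M \<and> length wr = ntapes M \<and> (\<forall>s\<in>set wr. s < nsyms M) \<and>
           length mv = ntapes M \<and> (\<forall>d\<in>set mv. d \<in> {-1, 0, 1}) \<and> cm \<in> {-1, 0, 1}))"

fun bits :: "nat \<Rightarrow> bool list" where
  "bits n = (if n = 0 then [] else odd n # bits (n div 2))"

definition enc_input :: "bool list \<Rightarrow> nat \<Rightarrow> nat list" where
  "enc_input x k = map (\<lambda>b. if b then 2 else 1) x @ [3] @ map (\<lambda>b. if b then 2 else 1) (bits k)"

definition input_sym :: "bool list \<Rightarrow> nat \<Rightarrow> nat \<Rightarrow> nat" where
  "input_sym x k a = (if a < length (enc_input x k) then enc_input x k ! a else 0)"

definition tape_num :: "(nat \<Rightarrow> nat) \<Rightarrow> nat" where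
  "tape_num t = (let L = (if \<exists>i. t i \<notin> {1, 2} then (LEAST i. t i \<notin> {1, 2}) else 0)
                 in \<Sum>i<L. if t i = 2 then 2 ^ i else 0)"

definition move :: "nat \<Rightarrow> int \<Rightarrow> nat" where
  "move h d = nat (int h + d)"

definition halted :: "machine \<Rightarrow> config \<Rightarrow> bool" where
  "halted M cf \<longleftrightarrow> state cf = acc M \<or> state cf = rej M"

definition step :: "machine \<Rightarrow> bool list \<Rightarrow> nat \<Rightarrow> (nat \<Rightarrow> bool) \<Rightarrow> config \<Rightarrow> config" where
  "step M x k c cf =
     (if halted M cf then cf else
      (let a = input_sym x k (tape_num (fst (tapes cf ! 0)));
           ws = map (\<lambda>(t, h). t h) (tapes cf);
           (q', wr, mv, cm) = delta M (state cf) a ws (c (chead cf))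
       in \<lparr> state = q',
            tapes = map (\<lambda>i. case tapes cf ! i of (t, h) \<Rightarrow> (t(h := wr ! i), move h (mv ! i)))
                        [0..<length (tapes cf)],
            chead = move (chead cf) cm \<rparr>))"

definition init_config :: "machine \<Rightarrow> config" where
  "init_config M = \<lparr> state = start M, tapes = replicate (ntapes M) (\<lambda>_. 0, 0), chead = 0 \<rparr>"

definition run :: "machine \<Rightarrow> bool list \<Rightarrow> nat \<Rightarrow> (nat \<Rightarrow> bool) \<Rightarrow> nat \<Rightarrow> config" where
  "run M x k c n = (step M x k c ^^ n) (init_config M)"

definition det_run :: "machine \<Rightarrow> bool list \<Rightarrow> nat \<Rightarrow> nat \<Rightarrow> config" where
  "det_run M x k n = run M x k (\<lambda>_. False) n"

definition out_value :: "config \<Rightarrow> nat" where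
  "out_value cf = tape_num (fst (tapes cf ! 1))"

definition computable :: "(nat \<Rightarrow> nat) \<Rightarrow> bool" where
  "computable f \<longleftrightarrow> (\<exists>M. wf_machine M \<and> 2 \<le> ntapes M \<and>
     (\<forall>n. \<exists>t. halted M (det_run M [] n t) \<and> out_value (det_run M [] n t) = f n))"

definition FFPT :: "(bool list \<Rightarrow> nat \<Rightarrow> nat) set" where
  "FFPT = {F. \<exists>M f a d. wf_machine M \<and> 2 \<le> ntapes M \<and> computable f \<and>
     (\<forall>x k. \<exists>t. t \<le> f k * (a * length x ^ d + a) \<and>
        halted M (det_run M x k t) \<and> out_value (det_run M x k t) = F x k)}"

definition choice_of :: "bool list \<Rightarrow> nat \<Rightarrow> bool" where
  "choice_of w i = (if 0 < i \<and> i \<le> length w then w ! (i - 1) else False)"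

text \<open>Accepting computation paths: a path is identified with the sequence w of bits in the
  choice-tape cells visited by nondeterministic steps (cells 1..|w|).\<close>
definition acc_paths :: "machine \<Rightarrow> bool list \<Rightarrow> nat \<Rightarrow> bool list set" where
  "acc_paths M x k = {w. \<exists>n. state (run M x k (choice_of w) n) = acc M \<and>
       (\<forall>m\<le>n. chead (run M x k (choice_of w) m) \<le> length w) \<and>
       (\<exists>m\<le>n. chead (run M x k (choice_of w) m) = length w)}"

definition num_acc :: "machine \<Rightarrow> bool list \<Rightarrow> nat \<Rightarrow> nat" where
  "num_acc M x k = card (acc_paths M x k)"

definition paraL_machine :: "machine \<Rightarrow> bool" where
  "paraL_machine M \<longleftrightarrow> (\<exists>f C. computable f \<and>
     (\<forall>x k c n i. i < ntapes M \<longrightarrow>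
        snd (tapes (run M x k c n) ! i) \<le> C * (ceillog2 (length x) + f k + 1)))"

definition k_bounded :: "machine \<Rightarrow> bool" where
  "k_bounded M \<longleftrightarrow> (\<exists>f. computable f \<and>
     (\<forall>x k c n. chead (run M x k c n) \<le> f k * ceillog2 (length x)))"

definition read_once :: "machine \<Rightarrow> bool" where
  "read_once M \<longleftrightarrow> (\<forall>x k c n. chead (run M x k c n) \<le> chead (run M x k c (Suc n)))"

definition sharp_para_beta_L :: "(bool list \<Rightarrow> nat \<Rightarrow> nat) set" where
  "sharp_para_beta_L = {F. \<exists>M. wf_machine M \<and> paraL_machine M \<and> k_bounded M \<and> read_once M \<and>
     (\<forall>x k. num_acc M x k = F x k)}"

end

(*
  The machine M is simulated on all of its computation paths at once. A configuration of M without
  the position of the choice head, but with the bit under it, takes one of at most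
  2^O(log |x| + f(k)) = f'(k) |x|^O(1) values. Because the choice head moves only one way, the rest
  of a path depends on this configuration alone, so paths that agree on it can be merged: a table
  stores every configuration seen so far with the number of paths of length t that lead to it, and
  one round advances t by one. An accepting path never repeats a configuration before it accepts,
  since a repetition would either pump the number of choice bits beyond its bound or close a
  deterministic loop. Hence the rounds can stop as soon as t exceeds the number of configurations
  seen, and neither f nor the bound on the number of choice bits has to be computed.

  The machine is obtained from a structured language for Turing machines with stacks, in which
  polynomial-time functions on binary trees are closed under composition, pairing, case distinction
  and folding.
*)
theory Submission
  imports Defs "HOL-Library.Nat_Bijection"
begin

text \<open>The position of the choice head is left out of a configuration so that the number N of
  configurations depends on the space bound alone; the bit under the head has to stay in, since the
  machine may scan the same cell in many steps. Merging makes multiplicities as large as 2^t, so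
  they are kept in binary and added digit by digit; all sizes then remain polynomial in N.
  Configurations that are no longer occupied stay in the table with multiplicity 0: the stopping
  test compares the round counter with everything seen so far, and the machine never has to know N.
  FFPT asks for a computable factor in k, whereas the analysis yields 2^(g f(k)). A machine whose
  output is at least this large is obtained by running the given machine for f and overestimating
  its result through the length of its output tape. Binary trees are the data because a single
  prefix code covers pairs, lists, numbers and configurations, while finite tables such as the
  transition function of M become functions on leaf labels, which a Turing machine evaluates in one
  step.\<close>

declare bits.simps [simp del]

section \<open>Structured programs for Turing machines\<close>

type_synonym tape = "(nat \<Rightarrow> nat) \<times> nat"

datatype prog =
    Act "nat \<Rightarrow> nat list \<Rightarrow> nat \<Rightarrow> nat \<times> int"
  | Seq prog prog (infixr ";;" 60)
  | Cond "nat list \<Rightarrow> bool" prog prog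
  | While "nat list \<Rightarrow> bool" prog

definition scanned :: "tape list \<Rightarrow> nat list" where
  "scanned ts = map (\<lambda>(t, h). t h) ts"

text \<open>The program list is a stack of pending programs and plays the part of the control state.
  Unfolding \<open>;;\<close>, \<open>Cond\<close> or \<open>While\<close> costs one step in which
  no tape changes; only \<open>Act\<close> touches the tapes.\<close>

fun next_prog :: "nat list \<Rightarrow> prog list \<Rightarrow> prog list" where
  "next_prog ws [] = []"
| "next_prog ws (Act g # K) = K"
| "next_prog ws ((p ;; q) # K) = p # q # K"
| "next_prog ws (Cond b p q # K) = (if b ws then p else q) # K"
| "next_prog ws (While b p # K) = (if b ws then p # While b p # K else K)"

fun act_of :: "prog list \<Rightarrow> nat \<Rightarrow> nat list \<Rightarrow> nat \<Rightarrow> nat \<times> int" where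
  "act_of (Act g # K) a ws i = g a ws i"
| "act_of _ a ws i = (ws ! i, 0)"

lemma act_of_eqs [simp]:
  "act_of (Act g # K) a ws = g a ws"
  "act_of ((p ;; q) # K) a ws = (\<lambda>i. (ws ! i, 0))"
  "act_of (Cond b p q # K) a ws = (\<lambda>i. (ws ! i, 0))"
  "act_of (While b p # K) a ws = (\<lambda>i. (ws ! i, 0))"
  by (rule ext, simp)+

definition apply_act :: "(nat \<Rightarrow> nat \<times> int) \<Rightarrow> tape list \<Rightarrow> tape list" where
  "apply_act g ts = map (\<lambda>i. case ts ! i of (t, h) \<Rightarrow> (t(h := fst (g i)), move h (snd (g i)))) [0..<length ts]"

definition pstep :: "(nat \<Rightarrow> nat) \<Rightarrow> prog list \<times> tape list \<Rightarrow> prog list \<times> tape list" where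
  "pstep inp = (\<lambda>(L, ts). (next_prog (scanned ts) L,
     apply_act (act_of L (inp (tape_num (fst (ts ! 0)))) (scanned ts)) ts))"

text \<open>The alphabet size is only fixed once the whole program is known, hence the quantification
  over all sufficiently large sizes \<open>s\<close>.\<close>
fun wf_prog :: "nat \<Rightarrow> prog \<Rightarrow> bool" where
  "wf_prog B (Act g) \<longleftrightarrow> (\<forall>s\<ge>B. \<forall>a<4. \<forall>ws i. length ws = 6 \<and> (\<forall>w\<in>set ws. w < s) \<and> i < 6 \<longrightarrow>
      fst (g a ws i) < s \<and> snd (g a ws i) \<in> {-1, 0, 1})"
| "wf_prog B (p ;; q) \<longleftrightarrow> wf_prog B p \<and> wf_prog B q"
| "wf_prog B (Cond b p q) \<longleftrightarrow> wf_prog B p \<and> wf_prog B q"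
| "wf_prog B (While b p) \<longleftrightarrow> wf_prog B p"

lemma wf_prog_mono: "wf_prog B p \<Longrightarrow> B \<le> B' \<Longrightarrow> wf_prog B' p"
proof (induction p)
  case (Act g)
  show ?case unfolding wf_prog.simps
  proof (intro allI impI)
    fix s a ws i
    assume "B' \<le> s" "a < (4::nat)" "length (ws :: nat list) = 6 \<and> (\<forall>w\<in>set ws. w < s) \<and> i < (6::nat)"
    then show "fst (g a ws i) < s \<and> snd (g a ws i) \<in> {-1, 0, 1}"
      using Act unfolding wf_prog.simps by (meson le_trans)
  qed
qed auto

text \<open>A loop puts itself back under its body instead of creating a new program, so only
  finitely many stacks of pending programs arise. They become the states of the compiled
  machine.\<close>

fun conts :: "prog \<Rightarrow> prog list \<Rightarrow> prog list set" where
  "conts (Act g) K = {Act g # K}"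
| "conts (p ;; q) K = insert ((p ;; q) # K) (conts p (q # K) \<union> conts q K)"
| "conts (Cond b p q) K = insert (Cond b p q # K) (conts p K \<union> conts q K)"
| "conts (While b p) K = insert (While b p # K) (conts p (While b p # K))"

lemma conts_self: "p # K \<in> conts p K"
  by (cases p) auto

lemma finite_conts: "finite (conts p K)"
  by (induction p arbitrary: K) auto

lemma next_prog_conts: "L \<in> conts p K \<Longrightarrow> next_prog ws L \<in> insert K (conts p K)"
proof (induction p arbitrary: K)
  case (Seq p q)
  then show ?case using conts_self[of p "q # K"] conts_self[of q K] by fastforce
next
  case (Cond b p q)
  then show ?case using conts_self[of p K] conts_self[of q K] by auto
next
  case (While b p)
  then show ?case using conts_self[of p "While b p # K"] by fastforce
qed auto

lemma wf_conts: "L \<in> conts p K \<Longrightarrow> wf_prog B p \<Longrightarrow> \<exists>q K'. L = q # K' \<and> wf_prog B q"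
  by (induction p arbitrary: K) auto

lemma act_of_wf:
  assumes "L \<in> insert [] (conts p [])" "wf_prog B p" "B \<le> s" "a < 4"
    "length ws = 6" "\<forall>w\<in>set ws. w < s" "i < 6"
  shows "fst (act_of L a ws i) < s \<and> snd (act_of L a ws i) \<in> {-1, 0, 1}"
proof (cases "L = []")
  case False
  then obtain q K' where L: "L = q # K'" "wf_prog B q"
    using assms wf_conts[of L p "[]" B] by auto
  then show ?thesis using assms by (cases q) (auto simp del: conts.simps)
qed (use assms in auto)

lemma input_sym_less: "input_sym x k a < 4"
proof (cases "a < length (enc_input x k)")
  case True
  then have "enc_input x k ! a \<in> set (enc_input x k)" by simp
  moreover have "w < 4" if "w \<in> set (enc_input x k)" for w
    using that by (auto simp: enc_input_def)
  ultimately show ?thesis using True by (auto simp: input_sym_def)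
qed (simp add: input_sym_def)

text \<open>Program steps and machine steps correspond one to one, so time bounds carry over
  unchanged. The empty stack of pending programs is the accepting state.\<close>

lemma compile_prog:
  assumes wf: "wf_prog B p"
  shows "\<exists>M. wf_machine M \<and> ntapes M = 6 \<and> (\<forall>x k n ts.
     (pstep (input_sym x k) ^^ n) ([p], replicate 6 (\<lambda>_. 0, 0)) = ([], ts) \<longrightarrow>
       halted M (det_run M x k n) \<and> tapes (det_run M x k n) = ts)"
proof -
  define Q where "Q = insert [] (conts p [])"
  have "finite Q" by (simp add: Q_def finite_conts)
  then obtain e where e: "bij_betw e Q {0..<card Q}"
    using ex_bij_betw_finite_nat by blast
  define d where "d = inv_into Q e"
  have de: "d (e L) = L" if "L \<in> Q" for L
    using e that by (simp add: d_def bij_betw_def)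
  have e_less: "e L < card Q" if "L \<in> Q" for L
    using e that by (auto simp: bij_betw_def)
  have dQ: "d q \<in> Q" if "q < card Q" for q
    using e that by (metis atLeast0LessThan bij_betw_def d_def inv_into_into lessThan_iff)
  have nQ: "next_prog ws L \<in> Q" if "L \<in> Q" for L ws
    using that next_prog_conts[of L p "[]" ws] by (auto simp: Q_def)
  \<comment> \<open>\<open>B\<close> accommodates the symbols written by the program; the 3 meets
    the minimum alphabet size in \<open>wf_machine\<close>.\<close>
  define s where "s = B + 3"
  \<comment> \<open>State \<open>card Q\<close> lies one beyond the numbered stacks. It is the
    rejecting state, which must differ from \<open>acc\<close> and is never entered.\<close>
  define M where "M = \<lparr> nstates = Suc (card Q), nsyms = s, ntapes = 6, start = e [p], acc = e [],
     rej = card Q, delta = (\<lambda>q a ws b. if q < card Q then (e (next_prog ws (d q)),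
        map (\<lambda>i. fst (act_of (d q) a ws i)) [0..<6], map (\<lambda>i. snd (act_of (d q) a ws i)) [0..<6], 0)
        else (q, ws, replicate 6 0, 0)) \<rparr>"
  have Q0: "[] \<in> Q" "[p] \<in> Q" by (auto simp: Q_def conts_self)
  have wfM: "wf_machine M"
    unfolding wf_machine_def
  proof (intro conjI allI impI)
    fix q a :: nat and ws :: "nat list" and b
    assume *: "q < nstates M \<and> a < 4 \<and> length ws = ntapes M \<and> (\<forall>s\<in>set ws. s < nsyms M)"
    show "case delta M q a ws b of (q', wr, mv, cm) \<Rightarrow> q' < nstates M \<and> length wr = ntapes M \<and>
      (\<forall>s\<in>set wr. s < nsyms M) \<and> length mv = ntapes M \<and> (\<forall>d\<in>set mv. d \<in> {-1, 0, 1}) \<and> cm \<in> {-1, 0, 1}"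
    proof (cases "q < card Q")
      case True
      have "e (next_prog ws (d q)) < card Q" using dQ e_less nQ True by blast
      moreover have "fst (act_of (d q) a ws i) < s \<and> snd (act_of (d q) a ws i) \<in> {-1,0,1}" if "i < 6" for i
        by (rule act_of_wf[OF dQ[OF True, unfolded Q_def] wf]) (use * that in \<open>auto simp: M_def s_def\<close>)
      ultimately show ?thesis using True by (auto simp: M_def)
    qed (use * in \<open>auto simp: M_def\<close>)
  qed (use e_less[OF Q0(1)] e_less[OF Q0(2)] in \<open>auto simp: M_def s_def\<close>)
  have main: "\<exists>cf. det_run M x k n = cf \<and> state cf = e L \<and> L \<in> Q \<and> tapes cf = ts \<and> length ts = 6"
    if "(pstep (input_sym x k) ^^ n) ([p], replicate 6 (\<lambda>_. 0, 0)) = (L, ts)" for x k n L ts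
    using that
  proof (induction n arbitrary: L ts)
    case 0
    then show ?case by (auto simp: det_run_def run_def init_config_def M_def Q0)
  next
    case (Suc n)
    obtain L0 ts0 where *: "(pstep (input_sym x k) ^^ n) ([p], replicate 6 (\<lambda>_. 0, 0)) = (L0, ts0)"
      by fastforce
    from Suc.IH[OF *] obtain cf where cf: "det_run M x k n = cf" "state cf = e L0" "L0 \<in> Q"
      "tapes cf = ts0" "length ts0 = 6" by blast
    have L: "L = next_prog (scanned ts0) L0"
      and ts: "ts = apply_act (act_of L0 (input_sym x k (tape_num (fst (ts0 ! 0)))) (scanned ts0)) ts0"
      using Suc.prems * by (auto simp: pstep_def)
    have st: "det_run M x k (Suc n) = step M x k (\<lambda>_. False) cf"
      using cf by (simp add: det_run_def run_def)
    have ne: "e L0 \<noteq> card Q" using e_less[OF cf(3)] by simp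
    have len: "length ts = 6" using cf by (simp add: ts apply_act_def)
    show ?case
    proof (cases "L0 = []")
      case True
      have "ts = ts0" unfolding ts True
        by (rule nth_equalityI) (auto simp: apply_act_def scanned_def move_def split: prod.split) 
      moreover have "halted M cf" using True cf(2) by (simp add: halted_def M_def)
      ultimately show ?thesis using True cf L len by (simp add: st step_def)
    next
      case False
      have "e L0 \<noteq> e []" using False cf(3) Q0 de by metis
      then have nh: "\<not> halted M cf" using cf ne by (simp add: halted_def M_def)
      have LQ: "L \<in> Q" using nQ cf(3) L by simp
      let ?a = "input_sym x k (tape_num (fst (ts0 ! 0)))"
      have del: "delta M (e L0) ?a (scanned ts0) b = (e L,
          map (\<lambda>i. fst (act_of L0 ?a (scanned ts0) i)) [0..<6],
          map (\<lambda>i. snd (act_of L0 ?a (scanned ts0) i)) [0..<6], 0)" for b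
        using e_less[OF cf(3)] de[OF cf(3)] by (simp add: M_def L)
      have "map (\<lambda>i. case ts0 ! i of (t, h) \<Rightarrow>
          (t(h := map (\<lambda>i. fst (act_of L0 ?a (scanned ts0) i)) [0..<6] ! i),
           move h (map (\<lambda>i. snd (act_of L0 ?a (scanned ts0) i)) [0..<6] ! i))) [0..<length ts0] = ts"
        using cf(5) by (auto simp: ts apply_act_def split: prod.split)
      then have "step M x k (\<lambda>_. False) cf = \<lparr>state = e L, tapes = ts, chead = chead cf\<rparr>"
        using nh cf(2,4) del unfolding step_def
        by (simp add: Let_def scanned_def move_def)
      then show ?thesis using st LQ len by simp
    qed
  qed
  show ?thesis
  proof (intro exI[of _ M] conjI allI impI wfM)
    show "ntapes M = 6" by (simp add: M_def)
    fix x k n ts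
    assume "(pstep (input_sym x k) ^^ n) ([p], replicate 6 (\<lambda>_. 0, 0)) = ([], ts)"
    from main[OF this] show "halted M (det_run M x k n)" "tapes (det_run M x k n) = ts"
      by (auto simp: halted_def M_def)
  qed
qed

section \<open>Tapes as stacks\<close>

text \<open>Tape 0 (the address) and tape 1 (the output) hold a stack from cell 0 on, bottom first, with
  the head on the first blank cell; their top symbol is not readable. The other tapes leave cell 0
  blank and keep the head on the top symbol, so that a scanned blank means an empty stack.\<close>

definition plain_tape :: "nat list \<Rightarrow> tape \<Rightarrow> bool" where
  "plain_tape s = (\<lambda>(t, h). h = length s \<and> (\<forall>j. t j = (if j < length s then rev s ! j else 0)))"

definition stack_tape :: "nat list \<Rightarrow> tape \<Rightarrow> bool" where
  "stack_tape s = (\<lambda>(t, h). h = length s \<and> t 0 = 0 \<and> (\<forall>j<length s. t (Suc j) = rev s ! j))"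

definition holds :: "nat list list \<Rightarrow> tape list \<Rightarrow> bool" where
  "holds ss ts \<longleftrightarrow> length ss = 6 \<and> length ts = 6 \<and>
     (\<forall>i<6. (if i < 2 then plain_tape else stack_tape) (ss ! i) (ts ! i))"

definition tops :: "nat list list \<Rightarrow> nat list" where
  "tops ss = map (\<lambda>i. if i < 2 \<or> ss ! i = [] then 0 else hd (ss ! i)) [0..<6]"

definition addressed :: "(nat \<Rightarrow> nat) \<Rightarrow> nat list list \<Rightarrow> nat" where
  "addressed inp ss = inp (tape_num (\<lambda>j. if j < length (ss ! 0) then rev (ss ! 0) ! j else 0))"

lemma holds_scanned: "holds ss ts \<Longrightarrow> scanned ts = tops ss"
proof (rule nth_equalityI)
  assume h: "holds ss ts"
  then show "length (scanned ts) = length (tops ss)" by (simp add: holds_def scanned_def tops_def)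
  fix i assume "i < length (scanned ts)"
  then have i: "i < 6" using h by (simp add: holds_def scanned_def)
  obtain t hd' where th: "ts ! i = (t, hd')" by fastforce
  have "(if i < 2 then plain_tape else stack_tape) (ss ! i) (t, hd')"
    using h i th by (auto simp: holds_def)
  then have "t hd' = (if i < 2 \<or> ss ! i = [] then 0 else hd (ss ! i))"
    by (cases "ss ! i" rule: list.exhaust)
      (auto simp: plain_tape_def stack_tape_def nth_append split: if_splits)
  then show "scanned ts ! i = tops ss ! i"
    using h i th by (simp add: holds_def scanned_def tops_def)
qed

lemma holds_addressed: "holds ss ts \<Longrightarrow> inp (tape_num (fst (ts ! 0))) = addressed inp ss"
proof -
  assume "holds ss ts"
  then have "plain_tape (ss ! 0) (ts ! 0)" by (force simp: holds_def)
  then have "fst (ts ! 0) = (\<lambda>j. if j < length (ss ! 0) then rev (ss ! 0) ! j else 0)"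
    by (auto simp: plain_tape_def split: prod.splits)
  then show ?thesis by (simp add: addressed_def)
qed

lemma apply_act_single:
  "i < length ts \<Longrightarrow> apply_act (\<lambda>j. if j = i then (w, d) else (scanned ts ! j, 0)) ts
     = ts[i := ((fst (ts ! i))(snd (ts ! i) := w), move (snd (ts ! i)) d)]"
  by (rule nth_equalityI)
    (auto simp: apply_act_def scanned_def move_def nth_list_update split: prod.split)

lemma apply_act_idle: "apply_act (\<lambda>j. (scanned ts ! j, 0)) ts = ts"
  by (rule nth_equalityI) (auto simp: apply_act_def scanned_def move_def split: prod.split)

text \<open>Stacks do not determine the tapes, because a stack tape may carry garbage above its top;
  hence the quantification over all tapes that hold \<open>ss\<close>. The number \<open>n\<close>
  is only an upper bound on the steps taken.\<close>

definition reaches :: "(nat \<Rightarrow> nat) \<Rightarrow> prog list \<Rightarrow> nat list list \<Rightarrow> nat \<Rightarrow> prog list \<Rightarrow> nat list list \<Rightarrow> bool" where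
  "reaches inp L ss n L' ss' \<longleftrightarrow> (\<forall>ts. holds ss ts \<longrightarrow>
     (\<exists>n'\<le>n. \<exists>ts'. holds ss' ts' \<and> (pstep inp ^^ n') (L, ts) = (L', ts')))"

lemma reaches_refl: "reaches inp L ss n L ss"
  unfolding reaches_def by (metis funpow_0 zero_le)

lemma reaches_trans:
  assumes "reaches inp L ss m L' ss'" "reaches inp L' ss' n L'' ss''" "m + n \<le> l"
  shows "reaches inp L ss l L'' ss''"
  unfolding reaches_def
proof (intro allI impI)
  fix ts assume "holds ss ts"
  then obtain m' ts' where 1: "m' \<le> m" "holds ss' ts'" "(pstep inp ^^ m') (L, ts) = (L', ts')"
    using assms(1) by (auto simp: reaches_def)
  then obtain n' ts'' where 2: "n' \<le> n" "holds ss'' ts''" "(pstep inp ^^ n') (L', ts') = (L'', ts'')"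
    using assms(2) by (auto simp: reaches_def)
  have "(pstep inp ^^ (n' + m')) (L, ts) = (L'', ts'')" using 1 2 by (simp add: funpow_add)
  then show "\<exists>n\<le>l. \<exists>ts'. holds ss'' ts' \<and> (pstep inp ^^ n) (L, ts) = (L'', ts')"
    using 1 2 assms(3) by (intro exI[of _ "n' + m'"]) auto
qed

lemma reaches_mono: "reaches inp L ss m L' ss' \<Longrightarrow> m \<le> n \<Longrightarrow> reaches inp L ss n L' ss'"
  by (rule reaches_trans[OF _ reaches_refl[of _ _ _ 0]]) auto

lemma reaches_step:
  assumes "\<And>ts. holds ss ts \<Longrightarrow> \<exists>ts'. pstep inp (L, ts) = (L', ts') \<and> holds ss' ts'"
    "reaches inp L' ss' n L'' ss''" "Suc n \<le> l"
  shows "reaches inp L ss l L'' ss''"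
proof (rule reaches_trans[OF _ assms(2)])
  show "reaches inp L ss 1 L' ss'"
    unfolding reaches_def
  proof (intro allI impI)
    fix ts assume "holds ss ts"
    then obtain ts' where "pstep inp (L, ts) = (L', ts')" "holds ss' ts'" using assms(1) by blast
    then show "\<exists>n'\<le>1. \<exists>ts'. holds ss' ts' \<and> (pstep inp ^^ n') (L, ts) = (L', ts')"
      by (intro exI[of _ 1]) auto
  qed
qed (use assms(3) in simp)

lemma reaches_seq:
  assumes "reaches inp (p # q # K) ss n L' ss'" "Suc n \<le> l"
  shows "reaches inp ((p ;; q) # K) ss l L' ss'"
  by (rule reaches_step[OF _ assms]) (auto simp: pstep_def apply_act_idle)

lemma reaches_cond:
  assumes "reaches inp ((if b (tops ss) then p else q) # K) ss n L' ss'" "Suc n \<le> l"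
  shows "reaches inp (Cond b p q # K) ss l L' ss'"
  by (rule reaches_step[OF _ assms]) (auto simp: pstep_def apply_act_idle holds_scanned)

lemma reaches_while:
  assumes "reaches inp (if b (tops ss) then p # While b p # K else K) ss n L' ss'" "Suc n \<le> l"
  shows "reaches inp (While b p # K) ss l L' ss'"
  by (rule reaches_step[OF _ assms]) (auto simp: pstep_def apply_act_idle holds_scanned)

section \<open>Pushing and popping on a single tape\<close>

definition act1 :: "nat \<Rightarrow> (nat \<Rightarrow> nat list \<Rightarrow> nat) \<Rightarrow> int \<Rightarrow> prog" where
  "act1 i e d = Act (\<lambda>a ws j. if j = i then (e a ws, d) else (ws ! j, 0))"

lemma pstep_act1:
  "holds ss ts \<Longrightarrow> i < 6 \<Longrightarrow> pstep inp (act1 i e d # K, ts) =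
     (K, ts[i := ((fst (ts ! i))(snd (ts ! i) := e (addressed inp ss) (tops ss)), move (snd (ts ! i)) d)])"
  using holds_scanned[of ss ts] holds_addressed[of ss ts inp]
    apply_act_single[of i ts "e (addressed inp ss) (tops ss)" d]
  by (simp add: act1_def pstep_def holds_def cong del: if_weak_cong)

text \<open>On a stack tape the head rests on the top symbol, so it first moves right and then
  writes. At the second step it scans possible garbage, which is why \<open>e\<close> sees the
  scanned symbols with position \<open>i\<close> masked by 0.\<close>

definition Push :: "nat \<Rightarrow> (nat \<Rightarrow> nat list \<Rightarrow> nat) \<Rightarrow> prog" where
  "Push i e = (if i < 2 then act1 i e 1
     else act1 i (\<lambda>a ws. ws ! i) 1 ;; act1 i (\<lambda>a ws. e a (ws[i := 0])) 0)"

text \<open>A plain tape must be blank beyond its content, since it is read as a number, so the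
  popped cell is erased. On a stack tape stepping back is enough.\<close>

definition Pop :: "nat \<Rightarrow> prog" where
  "Pop i = (if i < 2 then act1 i (\<lambda>a ws. 0) (-1) ;; act1 i (\<lambda>a ws. 0) 0
     else act1 i (\<lambda>a ws. ws ! i) (-1))"

lemma holds_update:
  "holds ss ts \<Longrightarrow> i < 6 \<Longrightarrow> (if i < 2 then plain_tape else stack_tape) s t \<Longrightarrow> holds (ss[i := s]) (ts[i := t])"
proof -
  assume a: "holds ss ts" "i < 6" "(if i < 2 then plain_tape else stack_tape) s t"
  have "(if j < 2 then plain_tape else stack_tape) (ss[i := s] ! j) (ts[i := t] ! j)" if "j < 6" for j
    using a that unfolding holds_def by (cases "j = i") (simp_all del: if_split)
  then show ?thesis using a(1) by (simp add: holds_def)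
qed

lemma reaches_Push:
  assumes "i < 6" "length ss = 6"
    and "reaches inp K (ss[i := e (addressed inp ss) ((tops ss)[i := 0]) # ss ! i]) n L' ss'" "n + 3 \<le> l"
  shows "reaches inp (Push i e # K) ss l L' ss'"
proof -
  let ?w = "e (addressed inp ss) ((tops ss)[i := 0])"
  have "reaches inp (Push i e # K) ss 3 K (ss[i := ?w # ss ! i])"
    unfolding reaches_def
  proof (intro allI impI)
    fix ts assume h: "holds ss ts"
    obtain t hd' where th: "ts ! i = (t, hd')" by fastforce
    have len: "length ts = 6" using h by (simp add: holds_def)
    have r: "(if i < 2 then plain_tape else stack_tape) (ss ! i) (t, hd')"
      using h assms(1) th by (auto simp: holds_def)
    show "\<exists>n'\<le>3. \<exists>ts'. holds (ss[i := ?w # ss ! i]) ts' \<and> (pstep inp ^^ n') (Push i e # K, ts) = (K, ts')"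
    proof (cases "i < 2")
      case True
      then have "tops ss ! i = 0" by (simp add: tops_def)
      then have "(tops ss)[i := 0] = tops ss" by (metis list_update_id)
      then have "pstep inp (Push i e # K, ts) = (K, ts[i := (t(hd' := ?w), Suc hd')])"
        using pstep_act1[OF h assms(1)] th True by (simp add: Push_def move_def nat_add_distrib)
      moreover have "holds (ss[i := ?w # ss ! i]) (ts[i := (t(hd' := ?w), Suc hd')])"
        by (rule holds_update[OF h assms(1)])
          (use r True in \<open>auto simp: plain_tape_def nth_append less_Suc_eq\<close>)
      ultimately show ?thesis by (intro exI[of _ 1]) auto
    next
      case False
      define ts1 where "ts1 = ts[i := (t, Suc hd')]"
      define ts2 where "ts2 = ts[i := (t(Suc hd' := ?w), Suc hd')]"
      have sc: "scanned ts ! i = t hd'" using th len assms(1) by (simp add: scanned_def)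
      have p1: "pstep inp (Push i e # K, ts) =
          (act1 i (\<lambda>a ws. ws ! i) 1 # act1 i (\<lambda>a ws. e a (ws[i := 0])) 0 # K, ts)"
        using False by (simp add: Push_def pstep_def apply_act_idle)
      have p2: "pstep inp (act1 i (\<lambda>a ws. ws ! i) 1 # L, ts) = (L, ts1)" for L
        using pstep_act1[OF h assms(1), of inp "\<lambda>a ws. ws ! i" 1 L] th sc holds_scanned[OF h]
        by (simp add: ts1_def move_def nat_add_distrib)
      have "(scanned ts1)[i := 0] = (scanned ts)[i := 0]"
        by (simp add: ts1_def scanned_def map_update)
      then have sc1: "(scanned ts1)[i := 0] = (tops ss)[i := 0]" using holds_scanned[OF h] by simp
      have a1: "inp (tape_num (fst (ts1 ! 0))) = addressed inp ss"
        using False holds_addressed[OF h, of inp] by (simp add: ts1_def)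
      have p3: "pstep inp (act1 i (\<lambda>a ws. e a (ws[i := 0])) 0 # K, ts1) = (K, ts2)"
        using apply_act_single[of i ts1 ?w 0] sc1 a1 assms(1) len
        by (simp add: act1_def pstep_def move_def ts1_def ts2_def nat_add_distrib cong del: if_weak_cong)
      have "holds (ss[i := ?w # ss ! i]) ts2" unfolding ts2_def
        by (rule holds_update[OF h assms(1)])
          (use r False in \<open>auto simp: stack_tape_def nth_append less_Suc_eq\<close>)
      moreover have "(pstep inp ^^ 3) (Push i e # K, ts) = (K, ts2)"
        using p1 p2 p3 by (simp add: numeral_3_eq_3)
      ultimately show ?thesis by blast
    qed
  qed
  from reaches_trans[OF this assms(3)] assms(4) show ?thesis by simp
qed

lemma reaches_Pop:
  assumes "i < 6" "length ss = 6" "reaches inp K (ss[i := tl (ss ! i)]) n L' ss'" "n + 3 \<le> l"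
  shows "reaches inp (Pop i # K) ss l L' ss'"
proof -
  have "reaches inp (Pop i # K) ss 3 K (ss[i := tl (ss ! i)])"
    unfolding reaches_def
  proof (intro allI impI)
    fix ts assume h: "holds ss ts"
    obtain t hd' where th: "ts ! i = (t, hd')" by fastforce
    have len: "length ts = 6" using h by (simp add: holds_def)
    have r: "(if i < 2 then plain_tape else stack_tape) (ss ! i) (t, hd')"
      using h assms(1) th by (auto simp: holds_def)
    show "\<exists>n'\<le>3. \<exists>ts'. holds (ss[i := tl (ss ! i)]) ts' \<and> (pstep inp ^^ n') (Pop i # K, ts) = (K, ts')"
    proof (cases "i < 2")
      case True
      define ts1 where "ts1 = ts[i := (t, hd' - 1)]"
      define ts2 where "ts2 = ts[i := (t(hd' - 1 := 0), hd' - 1)]"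
      have t0: "t hd' = 0" using r True by (auto simp: plain_tape_def)
      have p1: "pstep inp (Pop i # K, ts) =
          (act1 i (\<lambda>a ws. 0) (-1) # act1 i (\<lambda>a ws. 0) 0 # K, ts)"
        using True by (simp add: Pop_def pstep_def apply_act_idle)
      have "t(hd' := 0) = t" using t0 by auto
      moreover have "move hd' (-1) = hd' - 1" by (simp add: move_def)
      ultimately have p2: "pstep inp (act1 i (\<lambda>a ws. 0) (-1) # L, ts) = (L, ts1)" for L
        using pstep_act1[OF h assms(1), of inp "\<lambda>a ws. 0" "-1" L] th
        by (simp add: ts1_def)
      have p3: "pstep inp (act1 i (\<lambda>a ws. 0) 0 # K, ts1) = (K, ts2)"
        using apply_act_single[of i ts1 0 0] assms(1) len
        by (simp add: act1_def pstep_def move_def ts1_def ts2_def nat_add_distrib cong del: if_weak_cong)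
      have "holds (ss[i := tl (ss ! i)]) ts2" unfolding ts2_def
      proof (rule holds_update[OF h assms(1)])
        show "(if i < 2 then plain_tape else stack_tape) (tl (ss ! i)) (t(hd' - 1 := 0), hd' - 1)"
          using r True by (cases "ss ! i") (auto simp: plain_tape_def nth_append)
      qed
      moreover have "(pstep inp ^^ 3) (Pop i # K, ts) = (K, ts2)"
        using p1 p2 p3 by (simp add: numeral_3_eq_3)
      ultimately show ?thesis by blast
    next
      case False
      have sc: "tops ss ! i = t hd'" using th len assms(1) holds_scanned[OF h] 
        by (metis (no_types, lifting) case_prod_conv nth_map scanned_def)
      have "move hd' (-1) = hd' - 1" by (simp add: move_def)
      then have "pstep inp (Pop i # K, ts) = (K, ts[i := (t, hd' - 1)])"
        using False pstep_act1[OF h assms(1), of inp "\<lambda>a ws. ws ! i" "-1" K] th sc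
        by (simp add: Pop_def)
      moreover have "holds (ss[i := tl (ss ! i)]) (ts[i := (t, hd' - 1)])"
      proof (rule holds_update[OF h assms(1)])
        show "(if i < 2 then plain_tape else stack_tape) (tl (ss ! i)) (t, hd' - 1)"
          using r False by (cases "ss ! i") (auto simp: stack_tape_def nth_append)
      qed
      ultimately show ?thesis by (intro exI[of _ 1]) auto
    qed
  qed
  from reaches_trans[OF this assms(3)] assms(4) show ?thesis by simp
qed

definition bounded_sym :: "nat \<Rightarrow> (nat \<Rightarrow> nat list \<Rightarrow> nat) \<Rightarrow> bool" where
  "bounded_sym B e \<longleftrightarrow> (\<forall>s\<ge>B. \<forall>a<4. \<forall>ws. length ws = 6 \<and> (\<forall>w\<in>set ws. w < s) \<longrightarrow> e a ws < s)"

lemma wf_Push: "bounded_sym B e \<Longrightarrow> 1 \<le> B \<Longrightarrow> wf_prog B (Push i e)"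
proof -
  assume e: "bounded_sym B e" "1 \<le> B"
  have "e a (ws[i := 0]) < s" if "s \<ge> B" "a < 4" "length ws = 6" "\<forall>w\<in>set ws. w < s" for s a ws
  proof -
    have "\<forall>w\<in>set (ws[i := 0]). w < s"
      using that e(2) set_update_subset_insert[of ws i 0] by auto
    then show ?thesis using e(1) that by (simp add: bounded_sym_def)
  qed
  then show ?thesis using e by (auto simp: Push_def act1_def bounded_sym_def)
qed

lemma wf_Pop: "1 \<le> B \<Longrightarrow> wf_prog B (Pop i)"
  by (auto simp: Pop_def act1_def)

section \<open>Stack operations on binary trees\<close>

datatype tree = At nat | Nd tree tree

text \<open>Polish notation. Labels are shifted by 2: the symbol 1 marks an inner node, and 0 stays
  reserved for the blank that signals an empty stack.\<close>

fun enc :: "tree \<Rightarrow> nat list" where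
  "enc (At a) = [a + 2]"
| "enc (Nd u v) = 1 # enc u @ enc v"

definition tsize :: "tree \<Rightarrow> nat" where
  "tsize t = length (enc t)"

lemma tsize_simps [simp]: "tsize (At a) = 1" "tsize (Nd u v) = Suc (tsize u + tsize v)"
  by (simp_all add: tsize_def)

lemma tsize_pos: "0 < tsize t"
  by (cases t) auto

lemma zero_notin_enc [simp]: "0 \<notin> set (enc t)"
  by (induction t) auto

text \<open>Polish notation tells from its own symbols where a tree ends. This makes equality of
  trees decidable by comparing codes symbol by symbol.\<close>

lemma enc_prefix_free: "enc u @ X = enc v @ Y \<Longrightarrow> u = v \<and> X = Y"
proof (induction u arbitrary: v X Y)
  case (At a)
  then show ?case by (cases v) auto
next
  case (Nd u1 u2)
  show ?case
  proof (cases v)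
    case (Nd v1 v2)
    have "enc u1 @ (enc u2 @ X) = enc v1 @ (enc v2 @ Y)" using Nd.prems Nd by simp
    then have "u1 = v1 \<and> enc u2 @ X = enc v2 @ Y" by (rule Nd.IH(1))
    then show ?thesis using Nd.IH(2) Nd by blast
  qed (use Nd.prems in simp)
qed

lemma enc_inject: "enc u = enc v \<longleftrightarrow> u = v"
  using enc_prefix_free[of u "[]" v "[]"] by auto

fun top0 :: "nat list \<Rightarrow> nat" where
  "top0 [] = 0"
| "top0 (a # l) = a"

lemma tops_eval [simp]: "tops [A, O', X, Y, Z, C] = [0, 0, top0 X, top0 Y, top0 Z, top0 C]"
proof -
  have "hd l = top0 l" if "l \<noteq> []" for l using that by (cases l) auto
  then show ?thesis by (auto simp: tops_def upt_rec[of _ 6])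
qed

definition addr :: "nat list \<Rightarrow> nat" where
  "addr s = tape_num (\<lambda>j. if j < length s then s ! j else 0)"

lemma addressed_eval: "addressed inp (A # ss) = inp (addr (rev A))"
  by (simp add: addressed_def addr_def cong del: if_weak_cong)

text \<open>In this and the following rules the remaining step budget is carried in the goal by
  truncated subtraction. Symbolic execution by \<open>intro\<close> then leaves only one inequality
  per step.\<close>

lemma reaches_PushI:
  assumes "i < 6" "length ss = 6" "3 \<le> l"
    and "reaches inp K (ss[i := e (addressed inp ss) ((tops ss)[i := 0]) # ss ! i]) (l - 3) L' ss'"
  shows "reaches inp (Push i e # K) ss l L' ss'"
  by (rule reaches_Push[where e = e and n = "l - 3", OF assms(1,2,4)]) (use assms(3) in simp)

lemma reaches_PopI:
  assumes "i < 6" "length ss = 6" "3 \<le> l" "reaches inp K (ss[i := tl (ss ! i)]) (l - 3) L' ss'"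
  shows "reaches inp (Pop i # K) ss l L' ss'"
  by (rule reaches_Pop[OF assms(1,2,4)]) (use assms(3) in simp)

lemma reaches_seqI:
  "1 \<le> l \<Longrightarrow> reaches inp (p # q # K) ss (l - 1) L' ss' \<Longrightarrow> reaches inp ((p ;; q) # K) ss l L' ss'"
  using reaches_seq[of inp p q K ss "l - 1" L' ss' l] by simp

lemma reaches_condI:
  "1 \<le> l \<Longrightarrow> reaches inp ((if b (tops ss) then p else q) # K) ss (l - 1) L' ss' \<Longrightarrow>
   reaches inp (Cond b p q # K) ss l L' ss'"
  using reaches_cond[of inp b ss p q K "l - 1" L' ss' l] by simp

lemma reaches_whileT:
  "b (tops ss) \<Longrightarrow> 1 \<le> l \<Longrightarrow> reaches inp (p # While b p # K) ss (l - 1) L' ss' \<Longrightarrow>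
   reaches inp (While b p # K) ss l L' ss'"
  using reaches_while[of inp b ss p K "l - 1" L' ss' l] by simp

lemma reaches_whileF:
  "\<not> b (tops ss) \<Longrightarrow> 1 \<le> l \<Longrightarrow> reaches inp K ss (l - 1) L' ss' \<Longrightarrow>
   reaches inp (While b p # K) ss l L' ss'"
  using reaches_while[of inp b ss p K "l - 1" L' ss' l] by simp

lemma reaches_thenI:
  "reaches inp L ss m L' ss' \<Longrightarrow> m \<le> l \<Longrightarrow> reaches inp L' ss' (l - m) L'' ss'' \<Longrightarrow> reaches inp L ss l L'' ss''"
  using reaches_trans[of inp L ss m L' ss' "l - m" L'' ss'' l] by simp

lemmas reaches_intros = reaches_seqI reaches_PushI reaches_PopI reaches_refl

definition clear :: "nat \<Rightarrow> prog" where
  "clear i = While (\<lambda>ws. ws ! i \<noteq> 0) (Pop i)"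

lemma tops_nth: "2 \<le> i \<Longrightarrow> i < 6 \<Longrightarrow> length ss = 6 \<Longrightarrow> tops ss ! i = top0 (ss ! i)"
  by (cases "ss ! i") (auto simp: tops_def)

lemma reaches_clear:
  assumes "2 \<le> i" "i < 6" "length ss = 6" "0 \<notin> set (ss ! i)" "4 * length (ss ! i) + 1 \<le> l"
  shows "reaches inp (clear i # K) ss l K (ss[i := []])"
  using assms
proof (induction "ss ! i" arbitrary: ss l)
  case Nil
  then have "ss[i := []] = ss" by (metis list_update_id)
  then show ?case using Nil unfolding clear_def
    by (intro reaches_whileF) (auto simp: tops_nth reaches_refl)
next
  case (Cons a s)
  have ssi: "ss ! i = a # s" using Cons(2) by simp
  have nz: "tops ss ! i \<noteq> 0" using Cons(3-7) ssi by (auto simp: tops_nth)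
  let ?s = "ss[i := s]"
  have "reaches inp (clear i # K) ?s (l - 4) K (?s[i := []])"
    by (rule Cons(1)) (use Cons(3-7) ssi in auto)
  then show ?case using nz Cons(4,5,7) ssi unfolding clear_def
    by - (rule reaches_whileT; (intro reaches_PopI)?; auto)
qed

text \<open>A transfer reverses the content. The operations below are arranged so that each tree is
  reversed an even number of times, \<open>parse\<close> counting as one reversal.\<close>

definition xfer :: "nat \<Rightarrow> nat \<Rightarrow> prog" where
  "xfer i j = While (\<lambda>ws. ws ! i \<noteq> 0) (Push j (\<lambda>a ws. ws ! i) ;; Pop i)"

lemma reaches_xfer:
  assumes "2 \<le> i" "i < 6" "j < 6" "i \<noteq> j" "length ss = 6" "0 \<notin> set (ss ! i)" "8 * length (ss ! i) + 1 \<le> l"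
  shows "reaches inp (xfer i j # K) ss l K (ss[j := rev (ss ! i) @ ss ! j, i := []])"
  using assms
proof (induction "ss ! i" arbitrary: ss l)
  case Nil
  then have "ss[j := rev (ss ! i) @ ss ! j, i := []] = ss"
    by (metis append_Nil list_update_id rev.simps(1))
  then show ?case using Nil unfolding xfer_def
    by (intro reaches_whileF) (auto simp: tops_nth reaches_refl)
next
  case (Cons a s)
  have ssi: "ss ! i = a # s" using Cons(2) by simp
  have nz: "tops ss ! i = a" "a \<noteq> 0" using Cons(3-9) ssi by (auto simp: tops_nth)
  let ?s = "ss[j := a # ss ! j, i := s]"
  have "reaches inp (xfer i j # K) ?s (l - 8) K (?s[j := rev (?s ! i) @ ?s ! j, i := []])"
    by (rule Cons(1)) (use Cons(3-9) ssi in auto)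
  moreover have "?s[j := rev (?s ! i) @ ?s ! j, i := []] = ss[j := rev (ss ! i) @ ss ! j, i := []]"
    using Cons(3-9) ssi by (simp add: list_update_swap)
  ultimately show ?case using nz Cons(3-9) ssi unfolding xfer_def
    by - (rule reaches_whileT; (intro reaches_seqI reaches_PushI reaches_PopI)?; auto)
qed

text \<open>A prefix code of a tree is read off with a counter (stack 5) of the subtrees still expected.\<close>
definition parse_loop :: prog where
  "parse_loop = While (\<lambda>ws. ws ! 5 \<noteq> 0)
     (Cond (\<lambda>ws. ws ! 2 = 1) (Push 5 (\<lambda>a ws. 1)) (Pop 5) ;; Push 3 (\<lambda>a ws. ws ! 2) ;; Pop 2)"

definition parse :: prog where
  "parse = Push 5 (\<lambda>a ws. 1) ;; parse_loop"

text \<open>An inner node trades one expected subtree for two, a leaf settles one; hence reading a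
  whole tree lowers the counter by exactly one. Each symbol costs 13 steps: one for the loop test,
  two for \<open>;;\<close>, one for \<open>Cond\<close>, and three for each of the three stack
  operations.\<close>

lemma reaches_parse_loop:
  "reaches inp (parse_loop # K) [A, O', enc u @ X, Y, Z, 1 # C] (13 * tsize u) (parse_loop # K)
     [A, O', X, rev (enc u) @ Y, Z, C]"
proof (induction u arbitrary: X Y C)
  case (At a)
  show ?case
    by (subst parse_loop_def, rule reaches_whileT; (intro reaches_seqI reaches_condI)?; simp;
        (intro reaches_intros)?; simp add: parse_loop_def reaches_refl)
next
  case (Nd u v)
  have "reaches inp (parse_loop # K) [A, O', enc (Nd u v) @ X, Y, Z, 1 # C] 13 (parse_loop # K)
     [A, O', enc u @ enc v @ X, 1 # Y, Z, 1 # 1 # C]"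
    by (subst parse_loop_def, rule reaches_whileT; (intro reaches_seqI reaches_condI)?; simp;
        (intro reaches_intros)?; simp add: parse_loop_def reaches_refl)
  from reaches_trans[OF this reaches_trans[OF Nd.IH(1)[of "enc v @ X" "1 # Y" "1 # C"]
      Nd.IH(2)[of X "rev (enc u) @ 1 # Y" C] order_refl], of "13 * tsize (Nd u v)"]
  show ?case by simp
qed

lemma reaches_parse:
  assumes "13 * tsize u + 5 \<le> l"
  shows "reaches inp (parse # K) [A, O', enc u @ X, Y, Z, []] l K [A, O', X, rev (enc u) @ Y, Z, []]"
proof -
  have "reaches inp (parse_loop # K) [A, O', X, rev (enc u) @ Y, Z, []] 1 K [A, O', X, rev (enc u) @ Y, Z, []]"
    unfolding parse_loop_def by (rule reaches_whileF) (auto intro: reaches_refl)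
  from reaches_trans[OF reaches_parse_loop[of inp K A O' u X Y Z "[]"] this order_refl]
  show ?thesis using assms unfolding parse_def
    by (intro reaches_seqI reaches_PushI) (auto elim: reaches_mono)
qed

text \<open>Calling convention: between operations everything except stack 2 is empty, the address
  tape and the output tape included. The arbitrary rest \<open>X\<close> below the operands is a
  frame, which makes operations applicable to the top of a longer list of trees.\<close>

definition computes :: "(nat \<Rightarrow> nat) \<Rightarrow> prog \<Rightarrow> tree list \<Rightarrow> nat \<Rightarrow> tree list \<Rightarrow> bool" where
  "computes inp p us n vs \<longleftrightarrow> (\<forall>K X. reaches inp (p # K)
     [[], [], concat (map enc us) @ X, [], [], []] n K [[], [], concat (map enc vs) @ X, [], [], []])"

lemmas stack_simps = list.map concat.simps append_Nil append_Cons append_assoc append_Nil2 enc.simps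

lemma computes_mono: "computes inp p us m vs \<Longrightarrow> m \<le> n \<Longrightarrow> computes inp p us n vs"
  unfolding computes_def by (blast intro: reaches_mono)

lemma computes_frame: "computes inp p us n vs \<Longrightarrow> computes inp p (us @ ws) n (vs @ ws)"
  unfolding computes_def by simp

lemma computes_seq:
  "computes inp p us m vs \<Longrightarrow> computes inp q vs n ws \<Longrightarrow> m + n + 1 \<le> l \<Longrightarrow> computes inp (p ;; q) us l ws"
  unfolding computes_def by (intro allI, rule reaches_seq, rule reaches_trans) auto


lemma length_enc [simp]: "length (enc t) = tsize t"
  by (simp add: tsize_def)

lemma parseI:
  "13 * tsize u + 5 \<le> l \<Longrightarrow> reaches inp K [A, O', X, rev (enc u) @ Y, Z, []] (l - (13 * tsize u + 5)) L' ss' \<Longrightarrow>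
   reaches inp (parse # K) [A, O', enc u @ X, Y, Z, []] l L' ss'"
  by (rule reaches_thenI[OF reaches_parse[OF order_refl]])

lemma clearI:
  "0 \<notin> set Y \<Longrightarrow> 4 * length Y + 1 \<le> l \<Longrightarrow> reaches inp K [A, O', X, [], Z, C] (l - (4 * length Y + 1)) L' ss' \<Longrightarrow>
   reaches inp (clear 3 # K) [A, O', X, Y, Z, C] l L' ss'"
  "0 \<notin> set Z \<Longrightarrow> 4 * length Z + 1 \<le> l \<Longrightarrow> reaches inp K [A, O', X, Y, [], C] (l - (4 * length Z + 1)) L' ss' \<Longrightarrow>
   reaches inp (clear 4 # K) [A, O', X, Y, Z, C] l L' ss'"
  "0 \<notin> set C \<Longrightarrow> 4 * length C + 1 \<le> l \<Longrightarrow> reaches inp K [A, O', X, Y, Z, []] (l - (4 * length C + 1)) L' ss' \<Longrightarrow>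
   reaches inp (clear 5 # K) [A, O', X, Y, Z, C] l L' ss'"
  by (rule reaches_thenI[OF reaches_clear[OF _ _ _ _ order_refl]]; simp)+

lemma Pop_evalI:
  "3 \<le> l \<Longrightarrow> reaches inp K [A, O', X, Y, Z, C] (l - 3) L' ss' \<Longrightarrow>
   reaches inp (Pop 2 # K) [A, O', a # X, Y, Z, C] l L' ss'"
  "3 \<le> l \<Longrightarrow> reaches inp K [[], O', X, Y, Z, C] (l - 3) L' ss' \<Longrightarrow>
   reaches inp (Pop 0 # K) [[], O', X, Y, Z, C] l L' ss'"
  by (rule reaches_PopI; simp)+

lemma Push_evalI:
  "3 \<le> l \<Longrightarrow> reaches inp K [A, O', e (inp (addr (rev A))) [0, 0, 0, top0 Y, top0 Z, top0 C] # X, Y, Z, C] (l - 3) L' ss' \<Longrightarrow>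
   reaches inp (Push 2 e # K) [A, O', X, Y, Z, C] l L' ss'"
  by (rule reaches_PushI; simp add: addressed_eval)

lemma xferI:
  "0 \<notin> set Y \<Longrightarrow> 8 * length Y + 1 \<le> l \<Longrightarrow> reaches inp K [A, O', rev Y @ X, [], Z, C] (l - (8 * length Y + 1)) L' ss' \<Longrightarrow>
   reaches inp (xfer 3 2 # K) [A, O', X, Y, Z, C] l L' ss'"
  "0 \<notin> set Y \<Longrightarrow> 8 * length Y + 1 \<le> l \<Longrightarrow> reaches inp K [A, O', X, [], rev Y @ Z, C] (l - (8 * length Y + 1)) L' ss' \<Longrightarrow>
   reaches inp (xfer 3 4 # K) [A, O', X, Y, Z, C] l L' ss'"
  "0 \<notin> set Y \<Longrightarrow> 8 * length Y + 1 \<le> l \<Longrightarrow> reaches inp K [A, O', X, [], Z, rev Y @ C] (l - (8 * length Y + 1)) L' ss' \<Longrightarrow>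
   reaches inp (xfer 3 5 # K) [A, O', X, Y, Z, C] l L' ss'"
  "0 \<notin> set Z \<Longrightarrow> 8 * length Z + 1 \<le> l \<Longrightarrow> reaches inp K [A, O', X, rev Z @ Y, [], C] (l - (8 * length Z + 1)) L' ss' \<Longrightarrow>
   reaches inp (xfer 4 3 # K) [A, O', X, Y, Z, C] l L' ss'"
  "0 \<notin> set C \<Longrightarrow> 8 * length C + 1 \<le> l \<Longrightarrow> reaches inp K [A, O', X, rev C @ Y, Z, []] (l - (8 * length C + 1)) L' ss' \<Longrightarrow>
   reaches inp (xfer 5 3 # K) [A, O', X, Y, Z, C] l L' ss'"
  by (rule reaches_thenI[OF reaches_xfer[OF _ _ _ _ _ _ order_refl]]; simp)+

section \<open>Rearranging, splitting and comparing trees\<close>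

definition drop_op :: prog where
  "drop_op = parse ;; clear 3"

lemma computes_drop: "computes inp drop_op [u] (20 * tsize u + 20) []"
  unfolding computes_def drop_op_def
  by (intro allI, simp only: stack_simps) (intro reaches_seqI parseI clearI; simp add: reaches_refl)

definition copy_loop :: prog where
  "copy_loop = While (\<lambda>ws. ws ! 3 \<noteq> 0) (Push 2 (\<lambda>a ws. ws ! 3) ;; Push 4 (\<lambda>a ws. ws ! 3) ;; Pop 3)"

definition dup_op :: prog where
  "dup_op = parse ;; copy_loop ;; xfer 4 3 ;; xfer 3 2"

lemma reaches_copy:
  "0 \<notin> set Y \<Longrightarrow> reaches inp (copy_loop # K) [A, O', X, Y, Z, C] (12 * length Y + 1) K [A, O', rev Y @ X, [], rev Y @ Z, C]"
proof (induction Y arbitrary: X Z)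
  case Nil
  show ?case unfolding copy_loop_def by (rule reaches_whileF) (auto intro: reaches_refl)
next
  case (Cons a Y)
  then show ?case unfolding copy_loop_def
    by - (rule reaches_whileT; (intro reaches_intros)?; simp)
qed

lemma computes_dup: "computes inp dup_op [u] (60 * tsize u + 60) [u, u]"
  unfolding computes_def dup_op_def
  by (intro allI, simp only: stack_simps) (intro reaches_seqI parseI reaches_thenI[OF reaches_copy] xferI; simp add: reaches_refl)

definition split_op :: prog where
  "split_op = parse ;; xfer 3 4 ;; parse ;; xfer 3 5"

lemma splitI:
  "60 * tsize u + 60 * tsize v + 60 \<le> l \<Longrightarrow>
   reaches inp K [A, O', X, [], enc u, enc v] (l - (60 * tsize u + 60 * tsize v + 60)) L' ss' \<Longrightarrow>
   reaches inp (split_op # K) [A, O', enc u @ enc v @ X, [], [], []] l L' ss'"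
proof (rule reaches_thenI[rotated])
  show "reaches inp (split_op # K) [A, O', enc u @ enc v @ X, [], [], []] (60 * tsize u + 60 * tsize v + 60)
     K [A, O', X, [], enc u, enc v]"
    unfolding split_op_def by (intro reaches_seqI parseI xferI; simp add: reaches_refl)
qed

definition swap_op :: prog where
  "swap_op = split_op ;; xfer 4 3 ;; xfer 3 2 ;; xfer 5 3 ;; xfer 3 2"

lemma computes_swap: "computes inp swap_op [u, v] (100 * tsize u + 100 * tsize v + 100) [v, u]"
  unfolding computes_def swap_op_def
  by (intro allI, simp only: stack_simps) (intro reaches_seqI splitI xferI; simp add: reaches_refl)

text \<open>\<open>Pop 0\<close> serves as the idle program: the address stack is empty here, so
  popping it changes nothing.\<close>

definition fst_op :: prog where
  "fst_op = Cond (\<lambda>ws. ws ! 2 = 1) (Pop 2 ;; split_op ;; xfer 4 3 ;; xfer 3 2 ;; clear 5) (Pop 0)"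

fun tfst :: "tree \<Rightarrow> tree" where
  "tfst (Nd u v) = u"
| "tfst (At a) = At a"

fun tsnd :: "tree \<Rightarrow> tree" where
  "tsnd (Nd u v) = v"
| "tsnd (At a) = At a"

lemma computes_fst: "computes inp fst_op [u] (100 * tsize u + 100) [tfst u]"
  unfolding computes_def fst_op_def
  by (cases u; intro allI, simp only: stack_simps tfst.simps tsnd.simps)
    (intro reaches_condI; simp; intro reaches_seqI Pop_evalI splitI xferI clearI; simp add: reaches_refl)+

definition snd_op :: prog where
  "snd_op = Cond (\<lambda>ws. ws ! 2 = 1) (Pop 2 ;; drop_op) (Pop 0)"

lemma computes_snd: "computes inp snd_op [u] (100 * tsize u + 100) [tsnd u]"
  unfolding computes_def snd_op_def drop_op_def
  by (cases u; intro allI, simp only: stack_simps tfst.simps tsnd.simps)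
    (intro reaches_condI; simp; intro reaches_seqI Pop_evalI parseI clearI; simp add: reaches_refl)+

definition compare_loop :: prog where
  "compare_loop = While (\<lambda>ws. ws ! 4 \<noteq> 0 \<and> ws ! 4 = ws ! 5) (Pop 4 ;; Pop 5)"

definition eq_op :: prog where
  "eq_op = split_op ;; compare_loop ;;
     Push 2 (\<lambda>a ws. if ws ! 4 = ws ! 5 then 3 else 2) ;; clear 4 ;; clear 5"

text \<open>The loop stops at the first difference or at the end of a stack. Equal tops at that
  point can only both be 0, that is, both stacks are exhausted together.\<close>

lemma reaches_compare:
  assumes "0 \<notin> set Z" "0 \<notin> set C"
  shows "\<exists>Z' C'. 0 \<notin> set Z' \<and> 0 \<notin> set C' \<and> length Z' \<le> length Z \<and> length C' \<le> length C \<and>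
     (top0 Z' = top0 C' \<longleftrightarrow> Z = C) \<and>
     reaches inp (compare_loop # K)
       [A, O', X, Y, Z, C] (8 * length Z + 1) K [A, O', X, Y, Z', C']"
  using assms
proof (induction Z arbitrary: C)
  case Nil
  have "reaches inp (compare_loop # K)
       [A, O', X, Y, [], C] (8 * length [] + 1) K [A, O', X, Y, [], C]"
    unfolding compare_loop_def by (rule reaches_whileF) (auto intro: reaches_refl)
  then show ?case using Nil by (intro exI[of _ "[]"] exI[of _ C]) (cases C; auto)
next
  case (Cons a Z)
  show ?case
  proof (cases "top0 C = a")
    case True
    then obtain C1 where C: "C = a # C1" using Cons.prems by (cases C) auto
    then obtain Z' C' where *: "0 \<notin> set Z'" "0 \<notin> set C'" "length Z' \<le> length Z" "length C' \<le> length C1"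
     "top0 Z' = top0 C' \<longleftrightarrow> Z = C1"
     "reaches inp (compare_loop # K)
       [A, O', X, Y, Z, C1] (8 * length Z + 1) K [A, O', X, Y, Z', C']"
      using Cons.IH[of C1] Cons.prems by auto
    have "reaches inp (compare_loop # K)
       [A, O', X, Y, a # Z, a # C1] (8 * length (a # Z) + 1) K [A, O', X, Y, Z', C']"
      using *(6) Cons.prems unfolding compare_loop_def by - (rule reaches_whileT; (intro reaches_intros)?; simp)
    then show ?thesis using * C by (intro exI[of _ Z'] exI[of _ C']) auto
  next
    case False
    then have "reaches inp (compare_loop # K)
       [A, O', X, Y, a # Z, C] (8 * length (a # Z) + 1) K [A, O', X, Y, a # Z, C]"
      unfolding compare_loop_def by (intro reaches_whileF) (auto intro: reaches_refl)
    then show ?thesis using False Cons.prems by (intro exI[of _ "a # Z"] exI[of _ C]) auto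
  qed
qed

lemma computes_eq:
  "computes inp eq_op [u, v] (100 * tsize u + 100 * tsize v + 100) [At (if u = v then 1 else 0)]"
  unfolding computes_def
proof (intro allI)
  fix K X
  let ?K = "(Push 2 (\<lambda>a ws. if ws ! 4 = ws ! 5 then 3 else 2) ;; clear 4 ;; clear 5) # K"
  obtain Z C where zc: "0 \<notin> set Z" "0 \<notin> set C" "length Z \<le> tsize u" "length C \<le> tsize v"
     "top0 Z = top0 C \<longleftrightarrow> u = v"
     "reaches inp (compare_loop # ?K)
       [[], [], X, [], enc u, enc v] (8 * tsize u + 1) ?K [[], [], X, [], Z, C]"
    using reaches_compare[of "enc u" "enc v" inp ?K "[]" "[]" X "[]"]
    unfolding length_enc enc_inject by (meson zero_notin_enc)
  show "reaches inp (eq_op # K) [[], [], concat (map enc [u, v]) @ X, [], [], []]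
     (100 * tsize u + 100 * tsize v + 100) K
     [[], [], concat (map enc [At (if u = v then 1 else 0)]) @ X, [], [], []]"
    unfolding eq_op_def using zc(1-5)
    by (simp only: stack_simps) (intro reaches_seqI splitI reaches_thenI[OF zc(6)] Push_evalI clearI; simp add: reaches_refl numeral_2_eq_2 numeral_3_eq_3)
qed

text \<open>The value 0 on inner nodes agrees with truncated subtraction: a label is read off as the
  top symbol minus 2, and the top symbol of an inner node is 1.\<close>

fun label :: "tree \<Rightarrow> nat" where
  "label (At a) = a"
| "label (Nd u v) = 0"

definition is_Nd :: "tree \<Rightarrow> bool" where
  "is_Nd t \<longleftrightarrow> (\<exists>u v. t = Nd u v)"

lemma is_Nd_simps [simp]: "is_Nd (Nd u v)" "\<not> is_Nd (At a)"
  by (auto simp: is_Nd_def)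

lemma top0_enc: "top0 (enc t @ X) = (if is_Nd t then 1 else label t + 2)"
  by (cases t) auto

definition at2_op :: "(nat \<Rightarrow> nat \<Rightarrow> nat) \<Rightarrow> prog" where
  "at2_op g = split_op ;; Push 2 (\<lambda>a ws. g (ws ! 4 - 2) (ws ! 5 - 2) + 2) ;; clear 4 ;; clear 5"

lemma computes_at2:
  "computes inp (at2_op g) [u, v] (100 * tsize u + 100 * tsize v + 100) [At (g (label u) (label v))]"
proof -
  have "top0 (enc t) - 2 = label t" for t using top0_enc[of t "[]"] by (cases t) auto
  then show ?thesis
  unfolding computes_def at2_op_def
  by (intro allI, simp only: stack_simps) (intro reaches_seqI splitI Push_evalI clearI; simp add: reaches_refl)
qed

text \<open>\<open>tape_num\<close> ignores everything from the first symbol outside {1, 2} on.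
  Cutting the list there leaves the address unchanged and puts only the two digits on tape
  0.\<close>

fun addr_syms :: "tree \<Rightarrow> nat list" where
  "addr_syms (Nd (At s) t) = (if s = 1 \<or> s = 2 then s # addr_syms t else [])"
| "addr_syms _ = []"

definition lookup_loop :: prog where
  "lookup_loop = While (\<lambda>ws. ws ! 4 = 1) (Pop 4 ;;
      Cond (\<lambda>ws. ws ! 4 = 3 \<or> ws ! 4 = 4) (Push 0 (\<lambda>a ws. ws ! 4 - 2) ;; Push 5 (\<lambda>a ws. 1) ;; Pop 4) (clear 4))"

text \<open>The top of tape 0 cannot be scanned as a stack top, so its height is kept in unary on
  stack 5 by \<open>lookup_loop\<close>; this tells how many cells to erase after the query.\<close>

definition unaddress :: prog where
  "unaddress = While (\<lambda>ws. ws ! 5 \<noteq> 0) (Pop 0 ;; Pop 5)"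

definition lookup_op :: prog where
  "lookup_op = parse ;; xfer 3 4 ;; lookup_loop ;; clear 4 ;; Push 2 (\<lambda>a ws. a + 2) ;; unaddress"

lemma reaches_unaddress:
  "reaches inp (unaddress # K) [A, O', X, Y, Z, replicate (length A) 1] (8 * length A + 1) K [[], O', X, Y, Z, []]"
proof (induction A)
  case Nil
  show ?case unfolding unaddress_def by (rule reaches_whileF) (auto intro: reaches_refl)
next
  case (Cons a A)
  then show ?case unfolding unaddress_def
    by - (rule reaches_whileT; (intro reaches_intros)?; simp)
qed

lemma reaches_lookup_loop:
  "\<exists>Z. 0 \<notin> set Z \<and> length Z \<le> tsize u \<and>
     reaches inp (lookup_loop # K) [A, O', X, Y, enc u, replicate (length A) 1] (20 * tsize u + 1) K
       [rev (addr_syms u) @ A, O', X, Y, Z, replicate (length (addr_syms u) + length A) 1]"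
proof (induction u arbitrary: A rule: addr_syms.induct)
  case (1 s t)
  show ?case
  proof (cases "s = 1 \<or> s = 2")
    case True
    from 1[OF this, of "s # A"] obtain Z where Z: "0 \<notin> set Z" "length Z \<le> tsize t"
      "reaches inp (lookup_loop # K) [s # A, O', X, Y, enc t, 1 # replicate (length A) 1] (20 * tsize t + 1) K
       [rev (addr_syms t) @ s # A, O', X, Y, Z, replicate (Suc (length (addr_syms t) + length A)) 1]"
      by auto
    have "reaches inp (lookup_loop # K) [A, O', X, Y, enc (Nd (At s) t), replicate (length A) 1] (20 * tsize (Nd (At s) t) + 1) K
       [rev (addr_syms t) @ s # A, O', X, Y, Z, replicate (Suc (length (addr_syms t) + length A)) 1]"
      using True reaches_mono[OF Z(3)] unfolding lookup_loop_def
      by - (rule reaches_whileT; (intro reaches_seqI reaches_PopI reaches_condI)?; simp; intro reaches_intros; simp)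
    then show ?thesis using Z True by (intro exI[of _ Z]) auto
  next
    case False
    have "reaches inp (lookup_loop # K) [A, O', X, Y, enc (Nd (At s) t), replicate (length A) 1] (20 * tsize (Nd (At s) t) + 1) K
       [A, O', X, Y, [], replicate (length A) 1]"
      using False unfolding lookup_loop_def
      by - (rule reaches_whileT; (intro reaches_seqI reaches_PopI reaches_condI)?; simp; (intro clearI)?; simp; rule reaches_whileF; simp add: reaches_refl)
    then show ?thesis using False by (intro exI[of _ "[]"]) auto
  qed
next
  case ("2_2" u v t)
  have "reaches inp (lookup_loop # K) [A, O', X, Y, enc (Nd (Nd u v) t), replicate (length A) 1] (20 * tsize (Nd (Nd u v) t) + 1) K
       [A, O', X, Y, [], replicate (length A) 1]"
    unfolding lookup_loop_def
    by - (rule reaches_whileT; (intro reaches_seqI reaches_PopI reaches_condI)?; simp; (intro clearI)?; simp; rule reaches_whileF; simp add: reaches_refl)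
  then show ?case by (intro exI[of _ "[]"]) auto
next
  case ("2_1" a)
  have "reaches inp (lookup_loop # K) [A, O', X, Y, enc (At a), replicate (length A) 1] (20 * tsize (At a) + 1) K
       [A, O', X, Y, enc (At a), replicate (length A) 1]"
    unfolding lookup_loop_def by (rule reaches_whileF; simp add: reaches_refl)
  then show ?case by (intro exI[of _ "enc (At a)"]) auto
qed

lemma length_addr_syms: "length (addr_syms u) \<le> tsize u"
  by (induction u rule: addr_syms.induct) auto

lemma computes_lookup:
  "computes inp lookup_op [u] (100 * tsize u + 100) [At (inp (addr (addr_syms u)))]"
  unfolding computes_def
proof (intro allI)
  fix K X
  let ?K = "(clear 4 ;; Push 2 (\<lambda>a ws. a + 2) ;; unaddress) # K"
  have "\<exists>Z. 0 \<notin> set Z \<and> length Z \<le> tsize u \<and>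
     reaches inp (lookup_loop # ?K) [[], [], X, [], enc u, []] (20 * tsize u + 1) ?K
       [rev (addr_syms u), [], X, [], Z, replicate (length (rev (addr_syms u))) 1]"
    using reaches_lookup_loop[of u inp ?K "[]" "[]" X "[]"]
    by (simp only: list.size replicate.simps append_Nil2 add_0_right length_rev)
  then obtain Z where z: "0 \<notin> set Z" "length Z \<le> tsize u"
     "reaches inp (lookup_loop # ?K) [[], [], X, [], enc u, []] (20 * tsize u + 1) ?K
       [rev (addr_syms u), [], X, [], Z, replicate (length (rev (addr_syms u))) 1]" by blast
  \<comment> \<open>The same fact with stack 4 in the form in which \<open>parse\<close> and
    \<open>xfer\<close> leave it, so that the rule applies without rewriting.\<close>
  then have z3: "reaches inp (lookup_loop # ?K) [[], [], X, [], rev (rev (enc u) @ []) @ [], []] (20 * tsize u + 1) ?K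
       [rev (addr_syms u), [], X, [], Z, replicate (length (rev (addr_syms u))) 1]" by simp
  show "reaches inp (lookup_op # K) [[], [], concat (map enc [u]) @ X, [], [], []]
     (100 * tsize u + 100) K [[], [], concat (map enc [At (inp (addr (addr_syms u)))]) @ X, [], [], []]"
    unfolding lookup_op_def using z(1,2) length_addr_syms[of u]
    by (simp only: stack_simps) (intro reaches_seqI parseI xferI
      reaches_thenI[OF z3] Push_evalI clearI reaches_thenI[OF reaches_unaddress]; simp add: reaches_refl)
qed

lemma bounded_sym_nth: "i < 6 \<Longrightarrow> bounded_sym B (\<lambda>a ws. ws ! i)"
  by (auto simp: bounded_sym_def)

lemma wf_ops:
  assumes "6 \<le> B"
  shows "wf_prog B drop_op" "wf_prog B dup_op" "wf_prog B swap_op" "wf_prog B fst_op" "wf_prog B snd_op"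
    "wf_prog B eq_op" "wf_prog B lookup_op"
  using assms unfolding drop_op_def dup_op_def swap_op_def split_op_def fst_op_def snd_op_def eq_op_def
    lookup_op_def parse_def parse_loop_def clear_def xfer_def lookup_loop_def unaddress_def copy_loop_def compare_loop_def
  by (auto intro!: wf_Push wf_Pop bounded_sym_nth) (auto simp: bounded_sym_def less_imp_diff_less)

lemma wf_at2:
  assumes "6 \<le> B" "\<And>a b. g a b + 2 < B"
  shows "wf_prog B (at2_op g)"
  using assms unfolding at2_op_def split_op_def parse_def parse_loop_def clear_def xfer_def
  by (auto intro!: wf_Push wf_Pop bounded_sym_nth) (auto simp: bounded_sym_def intro: less_le_trans)

section \<open>Polynomial-time functions on trees\<close>

inductive polyf :: "(nat \<Rightarrow> nat) \<Rightarrow> bool" where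
  polyf_const: "polyf (\<lambda>n. c)"
| polyf_id: "polyf (\<lambda>n. n)"
| polyf_add: "polyf P \<Longrightarrow> polyf Q \<Longrightarrow> polyf (\<lambda>n. P n + Q n)"
| polyf_mult: "polyf P \<Longrightarrow> polyf Q \<Longrightarrow> polyf (\<lambda>n. P n * Q n)"

lemmas polyf_intros = polyf_const polyf_id polyf_add polyf_mult

lemma polyf_mono: "polyf P \<Longrightarrow> m \<le> n \<Longrightarrow> P m \<le> P n"
  by (induction rule: polyf.induct) (auto intro: add_mono mult_le_mono)

lemma polyf_comp: "polyf P \<Longrightarrow> polyf Q \<Longrightarrow> polyf (\<lambda>n. P (Q n))"
  by (induction rule: polyf.induct) (auto intro: polyf_intros)

text \<open>Turns a polynomial in the number 2^m of configurations back into a power of two with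
  linear exponent. The summand 1 in \<open>m + 1\<close> absorbs constant factors, also for m =
  0.\<close>

lemma polyf_exp_bound: "polyf P \<Longrightarrow> \<exists>e. \<forall>m. P (2 ^ m) \<le> 2 ^ (e * (m + 1))"
proof (induction rule: polyf.induct)
  case (polyf_const c)
  have "c \<le> 2 ^ (c * (m + 1))" for m
    by (rule order_trans[OF less_imp_le[OF less_exp] power_increasing]) simp_all
  then show ?case by blast
next
  case polyf_id
  show ?case by (rule exI[of _ 1]) simp
next
  case (polyf_add P Q)
  then obtain d e where de: "\<And>m. P (2 ^ m) \<le> 2 ^ (d * (m + 1))" "\<And>m. Q (2 ^ m) \<le> 2 ^ (e * (m + 1))"
    by blast
  have "P (2 ^ m) + Q (2 ^ m) \<le> 2 ^ ((d + e + 1) * (m + 1))" for m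
  proof -
    have "(2::nat) ^ (d * (m + 1)) \<le> 2 ^ ((d + e) * (m + 1))" "(2::nat) ^ (e * (m + 1)) \<le> 2 ^ ((d + e) * (m + 1))"
      by (rule power_increasing[OF mult_le_mono1]; simp)+
    moreover have "(2::nat) * 2 ^ ((d + e) * (m + 1)) \<le> 2 ^ ((d + e + 1) * (m + 1))"
      using power_increasing[of "Suc ((d + e) * (m + 1))" "(d + e + 1) * (m + 1)" "2::nat"] by (simp add: algebra_simps)
    ultimately show ?thesis using de[of m] by linarith
  qed
  then show ?case by blast
next
  case (polyf_mult P Q)
  then obtain d e where de: "\<And>m. P (2 ^ m) \<le> 2 ^ (d * (m + 1))" "\<And>m. Q (2 ^ m) \<le> 2 ^ (e * (m + 1))"
    by blast
  have "P (2 ^ m) * Q (2 ^ m) \<le> 2 ^ ((d + e) * (m + 1))" for m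
    using mult_le_mono[OF de(1)[of m] de(2)[of m]] by (simp add: algebra_simps power_add)
  then show ?case by blast
qed

definition valid_inp :: "(nat \<Rightarrow> nat) \<Rightarrow> bool" where
  "valid_inp inp \<longleftrightarrow> (\<forall>a. inp a < 4)"

text \<open>The output size is bounded together with the time, so that the bound for a composition
  arises by substituting one polynomial into the other. The bound is uniform in the input tape,
  which acts as an oracle.\<close>

definition realizes :: "prog \<Rightarrow> (nat \<Rightarrow> nat) \<Rightarrow> ((nat \<Rightarrow> nat) \<Rightarrow> tree \<Rightarrow> tree) \<Rightarrow> bool" where
  "realizes p P f \<longleftrightarrow> (\<exists>B. wf_prog B p) \<and> polyf P \<and> (\<forall>inp x. valid_inp inp \<longrightarrow>
     computes inp p [x] (P (tsize x)) [f inp x] \<and> tsize (f inp x) \<le> P (tsize x))"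

definition ptime :: "((nat \<Rightarrow> nat) \<Rightarrow> tree \<Rightarrow> tree) \<Rightarrow> bool" where
  "ptime f \<longleftrightarrow> (\<exists>p P. realizes p P f)"

lemma wf_seqE:
  assumes "\<exists>B. wf_prog B p" "\<exists>B. wf_prog B q"
  shows "\<exists>B\<ge>6. wf_prog B p \<and> wf_prog B q"
proof -
  obtain B B' where "wf_prog B p" "wf_prog B' q" using assms by blast
  then have "wf_prog (B + B' + 6) p" "wf_prog (B + B' + 6) q"
    by (auto elim: wf_prog_mono)
  then show ?thesis by (intro exI[of _ "B + B' + 6"]) auto
qed

lemma realizes_polyf: "realizes p P f \<Longrightarrow> polyf P"
  by (simp add: realizes_def)

lemma realizesD:
  assumes "realizes p P f" "valid_inp inp" "tsize x \<le> n"
  shows "computes inp p [x] (P n) [f inp x]" "tsize (f inp x) \<le> P n"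
  using assms polyf_mono[of P "tsize x" n] unfolding realizes_def
  by (meson computes_mono le_trans)+

lemma realizes_frame:
  assumes "realizes p P f" "valid_inp inp" "tsize x \<le> n"
  shows "computes inp p (x # us) (P n) (f inp x # us)"
  using computes_frame[OF realizesD(1)[OF assms], of us] by simp

lemma realizes_comp:
  assumes "realizes p P f" "realizes q Q g"
  shows "realizes (q ;; p) (\<lambda>n. Q n + P (Q n) + 1) (\<lambda>inp x. f inp (g inp x))"
  unfolding realizes_def
proof (intro conjI allI impI)
  show "\<exists>B. wf_prog B (q ;; p)" using wf_seqE[of p q] assms by (auto simp: realizes_def)
  show "polyf (\<lambda>n. Q n + P (Q n) + 1)"
    by (intro polyf_intros polyf_comp[of P Q] assms[THEN realizes_polyf])
  fix inp x assume v: "valid_inp inp"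
  note g = realizesD[OF assms(2) v order_refl, of x]
  note f = realizesD[OF assms(1) v g(2)]
  show "computes inp (q ;; p) [x] (Q (tsize x) + P (Q (tsize x)) + 1) [f inp (g inp x)]"
    by (rule computes_seq[OF g(1) f(1)]) simp
  show "tsize (f inp (g inp x)) \<le> Q (tsize x) + P (Q (tsize x)) + 1" using f(2) by simp
qed

section \<open>Closure under composition, pairing and case distinction\<close>

lemma ptime_comp: "ptime f \<Longrightarrow> ptime g \<Longrightarrow> ptime (\<lambda>inp x. f inp (g inp x))"
  unfolding ptime_def using realizes_comp by blast

lemma computes_skip: "computes inp (Pop 0) us 3 us"
  unfolding computes_def by (intro allI Pop_evalI; simp add: reaches_refl)

lemma ptime_id: "ptime (\<lambda>inp x. x)"
  unfolding ptime_def realizes_def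
proof (intro exI[of _ "Pop 0"] exI[of _ "\<lambda>n. 3 + n"] conjI allI impI exI[of _ 1])
  show "computes inp (Pop 0) [x] (3 + tsize x) [x]" for inp x
    by (rule computes_mono[OF computes_skip]) simp
  show "polyf (\<lambda>n. 3 + n)" by (intro polyf_intros)
qed (auto intro: wf_Pop)

fun push_tree :: "tree \<Rightarrow> prog" where
  "push_tree (At a) = Push 2 (\<lambda>_ _. a + 2)"
| "push_tree (Nd u v) = push_tree v ;; push_tree u ;; Push 2 (\<lambda>_ _. 1)"

lemma computes_Push_1: "computes inp (Push 2 (\<lambda>_ _. 1)) [u, v] 3 [Nd u v]"
  unfolding computes_def by (intro allI Push_evalI; simp add: reaches_refl)

lemma computes_push_tree: "computes inp (push_tree v) [] (6 * tsize v) [v]"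
proof (induction v)
  case (At a)
  show ?case unfolding computes_def push_tree.simps by (intro allI Push_evalI; simp add: reaches_refl)
next
  case (Nd u v)
  from computes_seq[OF Nd(2) computes_seq[OF computes_frame[OF Nd(1), of "[v]", simplified]
      computes_Push_1 order_refl], of "6 * tsize (Nd u v)"]
  show ?case by simp
qed

lemma wf_push_tree: "\<exists>B. wf_prog B (push_tree v)"
proof (induction v)
  case (At a)
  have "wf_prog (a + 3) (push_tree (At a))"
    unfolding push_tree.simps by (rule wf_Push) (auto simp: bounded_sym_def)
  then show ?case by blast
next
  case (Nd u v)
  from wf_seqE[OF this] obtain B where "B \<ge> 6" "wf_prog B (push_tree u)" "wf_prog B (push_tree v)"
    by blast
  then have "wf_prog B (push_tree (Nd u v))"
    by (auto intro!: wf_Push simp: bounded_sym_def)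
  then show ?case by blast
qed

lemma ptime_const: "ptime (\<lambda>inp x. v)"
  unfolding ptime_def realizes_def
proof (intro exI[of _ "drop_op ;; push_tree v"] exI[of _ "\<lambda>n. 20 * n + (6 * tsize v + 21)"] conjI allI impI)
  show "\<exists>B. wf_prog B (drop_op ;; push_tree v)"
    using wf_seqE[OF wf_push_tree[of v] exI[of _ 6, OF wf_ops(1)]] by auto
  show "computes inp (drop_op ;; push_tree v) [x] (20 * tsize x + (6 * tsize v + 21)) [v]" for inp x
    by (rule computes_seq[OF computes_drop computes_push_tree]) simp
  show "polyf (\<lambda>n. 20 * n + (6 * tsize v + 21))" by (intro polyf_intros)
qed auto

definition bin_op :: "prog \<Rightarrow> prog \<Rightarrow> prog \<Rightarrow> prog" where
  "bin_op p q r = dup_op ;; p ;; swap_op ;; q ;; swap_op ;; r"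

lemma ptime_bin:
  assumes f: "ptime f" and g: "ptime g" and R: "\<exists>B. wf_prog B r" "polyf R"
    and r: "\<And>inp u v. valid_inp inp \<Longrightarrow> computes inp r [u, v] (R (tsize u + tsize v)) [h inp u v]"
      "\<And>inp u v. valid_inp inp \<Longrightarrow> tsize (h inp u v) \<le> R (tsize u + tsize v)"
  shows "ptime (\<lambda>inp x. h inp (f inp x) (g inp x))"
proof -
  obtain p P q Q where pq: "realizes p P f" "realizes q Q g" using f g unfolding ptime_def by blast
  let ?T = "\<lambda>n. 500 + 200 * n + 300 * P n + 300 * Q n + R (P n + Q n)"
  have pP: "polyf P" "polyf Q" using pq by (auto simp: realizes_def)
  have "realizes (bin_op p q r) ?T (\<lambda>inp x. h inp (f inp x) (g inp x))"
    unfolding realizes_def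
  proof (intro conjI allI impI)
    show "polyf ?T" using pP R(2) by (intro polyf_intros polyf_comp[of R "\<lambda>n. P n + Q n"])
    obtain B where "B \<ge> 6" "wf_prog B p" "wf_prog B q" using wf_seqE[of p q] pq by (auto simp: realizes_def)
    then obtain B' where "B' \<ge> 6" "wf_prog B' (p ;; q)" "wf_prog B' r"
      using wf_seqE[of "p ;; q" r] R by auto
    then have "wf_prog B' (bin_op p q r)" using wf_ops by (simp add: bin_op_def)
    then show "\<exists>B. wf_prog B (bin_op p q r)" by blast
    fix inp x assume v: "valid_inp inp"
    let ?n = "tsize x" let ?u = "f inp x" let ?v = "g inp x"
    note u = realizesD(2)[OF pq(1) v order_refl, of x]
    note w = realizesD(2)[OF pq(2) v order_refl, of x]
    have m: "R (tsize ?u + tsize ?v) \<le> R (P ?n + Q ?n)" by (rule polyf_mono[OF R(2)]) (use u w in simp)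
    have 5: "computes inp (swap_op ;; r) [?v, ?u] (100 * P ?n + 100 * Q ?n + 101 + R (P ?n + Q ?n)) [h inp ?u ?v]"
      by (rule computes_seq[OF computes_swap r(1)[OF v]]) (use u w m in simp)
    have 4: "computes inp (q ;; swap_op ;; r) [x, ?u] (100 * P ?n + 101 * Q ?n + 102 + R (P ?n + Q ?n)) [h inp ?u ?v]"
      by (rule computes_seq[OF realizes_frame[OF pq(2) v order_refl] 5]) simp
    have 3: "computes inp (swap_op ;; q ;; swap_op ;; r) [?u, x] (100 * ?n + 200 * P ?n + 101 * Q ?n + 203 + R (P ?n + Q ?n)) [h inp ?u ?v]"
      by (rule computes_seq[OF computes_swap 4]) (use u in simp)
    have 2: "computes inp (p ;; swap_op ;; q ;; swap_op ;; r) [x, x] (100 * ?n + 201 * P ?n + 101 * Q ?n + 204 + R (P ?n + Q ?n)) [h inp ?u ?v]"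
      by (rule computes_seq[OF realizes_frame[OF pq(1) v order_refl] 3]) simp
    show "computes inp (bin_op p q r) [x] (?T ?n) [h inp ?u ?v]" unfolding bin_op_def
      by (rule computes_seq[OF computes_dup 2]) simp
    show "tsize (h inp ?u ?v) \<le> ?T ?n" using r(2)[OF v, of ?u ?v] m by simp
  qed
  then show ?thesis unfolding ptime_def by blast
qed

lemma ptime_Nd: "ptime f \<Longrightarrow> ptime g \<Longrightarrow> ptime (\<lambda>inp x. Nd (f inp x) (g inp x))"
proof (rule ptime_bin[where r = "Push 2 (\<lambda>_ _. 1)" and R = "\<lambda>n. n + 3" and h = "\<lambda>inp u v. Nd u v"])
  show "\<exists>B. wf_prog B (Push 2 (\<lambda>_ _. 1))"
    by (rule exI[of _ 2], rule wf_Push) (auto simp: bounded_sym_def)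
  show "computes inp (Push 2 (\<lambda>_ _. 1)) [u, v] (tsize u + tsize v + 3) [Nd u v]" for inp u v
    by (rule computes_mono[OF computes_Push_1]) simp
  show "polyf (\<lambda>n. n + 3)" by (intro polyf_intros)
qed auto

lemma ptime_eq: "ptime f \<Longrightarrow> ptime g \<Longrightarrow> ptime (\<lambda>inp x. At (if f inp x = g inp x then 1 else 0))"
proof (rule ptime_bin[where r = eq_op and R = "\<lambda>n. 100 * n + 100" and h = "\<lambda>inp u v. At (if u = v then 1 else 0)"])
  show "computes inp eq_op [u, v] (100 * (tsize u + tsize v) + 100) [At (if u = v then 1 else 0)]" for inp u v
    by (rule computes_mono[OF computes_eq]) simp
  show "polyf (\<lambda>n. 100 * n + 100)" by (intro polyf_intros)
qed (auto intro: wf_ops)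

text \<open>Labels are tape symbols, so any function of two labels is a lookup in the finite
  transition table, whatever the function is. The bound \<open>B\<close> keeps the alphabet
  finite.\<close>

lemma ptime_at2:
  assumes "\<And>a b. h a b \<le> B" "ptime f" "ptime g"
  shows "ptime (\<lambda>inp x. At (h (label (f inp x)) (label (g inp x))))"
proof (rule ptime_bin[where r = "at2_op h" and R = "\<lambda>n. 100 * n + 100" and h = "\<lambda>inp u v. At (h (label u) (label v))", OF assms(2,3)])
  show "\<exists>B. wf_prog B (at2_op h)"
  proof (intro exI wf_at2)
    show "h a b + 2 < B + 6" for a b using assms(1)[of a b] by simp
  qed simp
  show "computes inp (at2_op h) [u, v] (100 * (tsize u + tsize v) + 100) [At (h (label u) (label v))]" for inp u v
    by (rule computes_mono[OF computes_at2]) simp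
  show "polyf (\<lambda>n. 100 * n + 100)" by (intro polyf_intros)
qed auto

lemma ptime_at1: "(\<And>a. h a \<le> B) \<Longrightarrow> ptime f \<Longrightarrow> ptime (\<lambda>inp x. At (h (label (f inp x))))"
  using ptime_at2[of "\<lambda>a b. h a" B f f] by simp

lemma ptime_unary:
  assumes "wf_prog 6 p"
    "\<And>inp x. computes inp p [x] (100 * tsize x + 100) [h inp x]"
    "\<And>inp x. tsize (h inp x) \<le> tsize x" "ptime f"
  shows "ptime (\<lambda>inp x. h inp (f inp x))"
proof (rule ptime_comp[OF _ assms(4)])
  show "ptime h" unfolding ptime_def realizes_def
  proof (intro exI[of _ p] exI[of _ "\<lambda>n. 100 * n + 100"] conjI allI impI)
    show "tsize (h inp x) \<le> 100 * tsize x + 100" for inp x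
      using assms(3)[of inp x] by simp
    show "polyf (\<lambda>n. 100 * n + 100)" by (intro polyf_intros)
  qed (use assms in auto)
qed

lemma tsize_tfst: "tsize (tfst u) \<le> tsize u"
  by (cases u) auto

lemma tsize_tsnd: "tsize (tsnd u) \<le> tsize u"
  by (cases u) auto

lemma ptime_fst: "ptime f \<Longrightarrow> ptime (\<lambda>inp x. tfst (f inp x))"
  by (rule ptime_unary[where p = fst_op]) (simp_all add: wf_ops computes_fst tsize_tfst)

lemma ptime_snd: "ptime f \<Longrightarrow> ptime (\<lambda>inp x. tsnd (f inp x))"
  by (rule ptime_unary[where p = snd_op]) (simp_all add: wf_ops computes_snd tsize_tsnd)

lemma ptime_lookup: "ptime f \<Longrightarrow> ptime (\<lambda>inp x. At (inp (addr (addr_syms (f inp x)))))"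
proof (rule ptime_unary[where p = lookup_op and h = "\<lambda>inp u. At (inp (addr (addr_syms u)))"])
  show "computes inp lookup_op [x] (100 * tsize x + 100) [At (inp (addr (addr_syms x)))]" for inp x
    by (rule computes_lookup)
  show "tsize (At (inp (addr (addr_syms x)))) \<le> tsize x" for inp x
    using tsize_pos[of x] by simp
qed (simp_all add: wf_ops)

definition branch_op :: "(nat \<Rightarrow> bool) \<Rightarrow> prog \<Rightarrow> prog \<Rightarrow> prog \<Rightarrow> prog" where
  "branch_op b p q r = dup_op ;; p ;; Cond (\<lambda>ws. b (ws ! 2)) (drop_op ;; q) (drop_op ;; r)"

lemma computes_cond:
  assumes "\<And>X. b (tops [[], [], concat (map enc us) @ X, [], [], []]) = Q" 
    "computes inp (if Q then p else q) us n vs"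
  shows "computes inp (Cond b p q) us (n + 1) vs"
  using assms unfolding computes_def by (intro allI reaches_condI) auto

lemma ptime_branch:
  assumes b: "\<And>t X. b (top0 (enc t @ X)) = Q t" and fs: "ptime c" "ptime f" "ptime g"
  shows "ptime (\<lambda>inp x. if Q (c inp x) then f inp x else g inp x)"
proof -
  obtain p P q Q' r R where pq: "realizes p P c" "realizes q Q' f" "realizes r R g"
    using fs unfolding ptime_def by blast
  let ?T = "\<lambda>n. 500 + 200 * n + 100 * P n + Q' n + R n"
  have "realizes (branch_op b p q r) ?T (\<lambda>inp x. if Q (c inp x) then f inp x else g inp x)"
    unfolding realizes_def
  proof (intro conjI allI impI)
    show "polyf ?T" by (intro polyf_intros pq[THEN realizes_polyf])
    obtain B where "B \<ge> 6" "wf_prog B p" "wf_prog B q" using wf_seqE[of p q] pq by (auto simp: realizes_def)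
    then obtain B' where "B' \<ge> 6" "wf_prog B' (p ;; q)" "wf_prog B' r"
      using wf_seqE[of "p ;; q" r] pq by (auto simp: realizes_def)
    then have "wf_prog B' (branch_op b p q r)" using wf_ops by (simp add: branch_op_def)
    then show "\<exists>B. wf_prog B (branch_op b p q r)" by blast
    fix inp x assume v: "valid_inp inp"
    let ?n = "tsize x"
    note P = realizesD(2)[OF pq(1) v order_refl, of x]
    note Q = realizesD(2)[OF pq(2) v order_refl, of x]
    note R = realizesD(2)[OF pq(3) v order_refl, of x]
    let ?h = "if Q (c inp x) then f inp x else g inp x"
    let ?D = "20 * P ?n + 22 + Q' ?n + R ?n"
    have "computes inp (if Q (c inp x) then drop_op ;; q else drop_op ;; r) [c inp x, x] ?D [?h]"
      using computes_frame[OF computes_drop, of inp "c inp x" "[x]"] P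
      by (auto intro!: computes_seq[OF _ realizesD(1)[OF pq(2) v order_refl]]
           computes_seq[OF _ realizesD(1)[OF pq(3) v order_refl]])
    then have "computes inp (Cond (\<lambda>ws. b (ws ! 2)) (drop_op ;; q) (drop_op ;; r)) [c inp x, x] (?D + 1) [?h]"
      by (intro computes_cond[where Q = "Q (c inp x)"]) (simp_all add: b)
    from computes_seq[OF realizes_frame[OF pq(1) v order_refl] this order_refl]
    have "computes inp (p ;; Cond (\<lambda>ws. b (ws ! 2)) (drop_op ;; q) (drop_op ;; r)) [x, x] (P ?n + (?D + 1) + 1) [?h]" .
    from computes_seq[OF computes_dup this]
    show "computes inp (branch_op b p q r) [x] (?T ?n) [?h]"
      by (simp add: branch_op_def)
    show "tsize ?h \<le> ?T ?n" using Q R by simp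
  qed
  then show ?thesis unfolding ptime_def by blast
qed

lemma ptime_if_Nd:
  "ptime c \<Longrightarrow> ptime f \<Longrightarrow> ptime g \<Longrightarrow> ptime (\<lambda>inp x. if is_Nd (c inp x) then f inp x else g inp x)"
  by (rule ptime_branch[where b = "\<lambda>a. a = 1"]) (simp_all add: top0_enc)

lemma ptime_if_label:
  "ptime c \<Longrightarrow> ptime f \<Longrightarrow> ptime g \<Longrightarrow> ptime (\<lambda>inp x. if Q (label (c inp x)) then f inp x else g inp x)"
proof (rule ptime_branch[where b = "\<lambda>a. Q (a - 2)" and Q = "\<lambda>t. Q (label t)"])
  show "Q (top0 (enc t @ X) - 2) = Q (label t)" for t X by (cases t) auto
qed

definition while_op :: "prog \<Rightarrow> prog \<Rightarrow> prog" where
  "while_op p q = dup_op ;; p ;; While (\<lambda>ws. ws ! 2 = 1) (drop_op ;; q ;; dup_op ;; p) ;; drop_op"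

lemma computes_whileF:
  assumes "\<And>X. \<not> b (tops [[], [], concat (map enc us) @ X, [], [], []])"
  shows "computes inp (While b p) us 1 us"
  using assms unfolding computes_def by (intro allI reaches_whileF) (auto intro: reaches_refl)

lemma computes_whileT:
  assumes "\<And>X. b (tops [[], [], concat (map enc us) @ X, [], [], []])"
    "computes inp p us m vs" "computes inp (While b p) vs n ws" "m + n + 1 \<le> l"
  shows "computes inp (While b p) us l ws"
  unfolding computes_def
proof (intro allI)
  fix K X
  let ?s = "\<lambda>us. [[], [], concat (map enc us) @ X, [], [], []]"
  have "reaches inp (p # While b p # K) (?s us) (m + n) K (?s ws)"
    using assms(2,3) unfolding computes_def by (blast intro: reaches_trans)
  then show "reaches inp (While b p # K) (?s us) l K (?s ws)"
    using assms(1,4) by - (rule reaches_whileT, auto elim: reaches_mono)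
qed

text \<open>A loop need not be polynomial in its input, so the number \<open>n\<close> of rounds and
  a common bound \<open>S\<close> on all intermediate sizes are left to the user. The 2 added to
  \<open>n\<close> pays for the first test and for the final clean-up.\<close>

definition iterates :: "prog \<Rightarrow> (nat \<Rightarrow> nat) \<Rightarrow> ((nat \<Rightarrow> nat) \<Rightarrow> tree \<Rightarrow> tree) \<Rightarrow> ((nat \<Rightarrow> nat) \<Rightarrow> tree \<Rightarrow> tree) \<Rightarrow> bool" where
  "iterates p R c f \<longleftrightarrow> (\<exists>B. wf_prog B p) \<and> polyf R \<and> (\<forall>inp x n S. valid_inp inp \<longrightarrow>
     (\<forall>i<n. is_Nd (c inp ((f inp ^^ i) x))) \<longrightarrow> \<not> is_Nd (c inp ((f inp ^^ n) x)) \<longrightarrow>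
     (\<forall>i\<le>n. tsize ((f inp ^^ i) x) \<le> S) \<longrightarrow> computes inp p [x] ((n + 2) * R S) [(f inp ^^ n) x])"

lemma iterates_wf: "iterates p R c f \<Longrightarrow> \<exists>B. wf_prog B p"
  by (simp add: iterates_def)

lemma iterates_polyf: "iterates p R c f \<Longrightarrow> polyf R"
  by (simp add: iterates_def)

lemma iterates_computes:
  assumes "iterates p R c f" "valid_inp inp" "\<forall>i<n. is_Nd (c inp ((f inp ^^ i) x))"
    "\<not> is_Nd (c inp ((f inp ^^ n) x))" "\<forall>i\<le>n. tsize ((f inp ^^ i) x) \<le> S"
  shows "computes inp p [x] ((n + 2) * R S) [(f inp ^^ n) x]"
  using assms unfolding iterates_def by blast

lemma realizes_while:
  assumes c: "realizes p P c" and f: "realizes q Q f"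
  shows "iterates (while_op p q) (\<lambda>S. 500 + 100 * S + 20 * P S + 2 * P S + Q S) c f"
  unfolding iterates_def
proof (intro conjI allI impI)
  obtain B where "B \<ge> 6" "wf_prog B p" "wf_prog B q" using wf_seqE[of p q] c f by (auto simp: realizes_def)
  then have "wf_prog B (while_op p q)" using wf_ops by (simp add: while_op_def)
  then show "\<exists>B. wf_prog B (while_op p q)" by blast
  show "polyf (\<lambda>S. 500 + 100 * S + 20 * P S + 2 * P S + Q S)"
    by (intro polyf_intros realizes_polyf[OF c] realizes_polyf[OF f])
  fix inp x n S
  let ?D = "500 + 100 * S + 20 * P S + 2 * P S + Q S"
  let ?W = "While (\<lambda>ws. ws ! 2 = 1) (drop_op ;; q ;; dup_op ;; p)"
  let ?x = "\<lambda>i. (f inp ^^ i) x"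
  assume v: "valid_inp inp" and cont: "\<forall>i<n. is_Nd (c inp (?x i))" and stop: "\<not> is_Nd (c inp (?x n))"
    and S: "\<forall>i\<le>n. tsize (?x i) \<le> S"
  have test: "computes inp (dup_op ;; p) [?x i] (60 * S + 61 + P S) [c inp (?x i), ?x i]" if "i \<le> n" for i
    by (rule computes_seq[OF computes_dup realizes_frame[OF c v, where n = S]]) (use S that in auto)
  have drop: "computes inp drop_op [c inp (?x i), ?x i] (20 * P S + 20) [?x i]" if "i \<le> n" for i
    using computes_frame[OF computes_drop, of inp "c inp (?x i)" "[?x i]"]
      realizesD(2)[OF c v, of "?x i" S] S that by (auto elim: computes_mono)
  \<comment> \<open>Induction on the number \<open>j\<close> of rounds still to come, because
    \<open>computes_whileT\<close> puts one round in front of the rest of the loop.\<close>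
  have loop: "computes inp ?W [c inp (?x (n - j)), ?x (n - j)] (j * ?D + 1) [c inp (?x n), ?x n]" if "j \<le> n" for j
    using that
  proof (induction j)
    case 0
    have "computes inp ?W [c inp (?x n), ?x n] 1 [c inp (?x n), ?x n]"
      by (rule computes_whileF) (use stop in \<open>simp add: top0_enc\<close>)
    then show ?case by simp
  next
    case (Suc j)
    let ?i = "n - Suc j"
    have i: "?i < n" "n - j = Suc ?i" using Suc.prems by auto
    have "computes inp q [?x ?i] (Q S) [?x (Suc ?i)]"
      using realizesD(1)[OF f v, of "?x ?i" S] S by simp
    from computes_seq[OF this test order_refl] i
    have "computes inp (q ;; dup_op ;; p) [?x ?i] (Q S + (60 * S + 61 + P S) + 1) [c inp (?x (Suc ?i)), ?x (Suc ?i)]" by simp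
    from computes_seq[OF drop this order_refl] i
    have body: "computes inp (drop_op ;; q ;; dup_op ;; p) [c inp (?x ?i), ?x ?i]
        (20 * P S + 20 + (Q S + (60 * S + 61 + P S) + 1) + 1) [c inp (?x (n - j)), ?x (n - j)]" by simp
    show ?case
      by (rule computes_whileT[OF _ body Suc.IH]) (use cont i Suc.prems in \<open>auto simp: top0_enc algebra_simps\<close>)
  qed
  have "computes inp (?W ;; drop_op) [c inp x, x] (n * ?D + 20 * P S + 22) [?x n]"
    by (rule computes_seq[OF _ drop]) (use loop[of n] in auto)
  moreover have "computes inp p [x, x] (P S) [c inp x, x]"
    by (rule realizes_frame[OF c v, where n = S]) (use S in auto)
  ultimately have "computes inp (p ;; ?W ;; drop_op) [x, x] (n * ?D + 20 * P S + 23 + P S) [?x n]"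
    by (auto intro: computes_seq)
  from computes_seq[OF computes_dup this]
  show "computes inp (while_op p q) [x] ((n + 2) * ?D) [?x n]"
    using S[rule_format, of 0] unfolding while_op_def by (simp add: algebra_simps)
qed

lemma ptime_while: "ptime c \<Longrightarrow> ptime f \<Longrightarrow> \<exists>p R. iterates p R c f"
  using realizes_while unfolding ptime_def by blast

section \<open>Bounded recursion along lists\<close>

fun tlist :: "tree \<Rightarrow> tree list" where
  "tlist (Nd u v) = u # tlist v"
| "tlist (At a) = []"

lemma length_tlist: "length (tlist t) \<le> tsize t"
  by (induction t) auto

lemma tsize_tlist_elem: "e \<in> set (tlist t) \<Longrightarrow> tsize e \<le> tsize t"
  by (induction t) auto

lemma tlist_drop: "tlist ((tsnd ^^ i) t) = drop i (tlist t)"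
proof (induction i arbitrary: t)
  case (Suc i)
  then show ?case by (cases t) (simp_all add: funpow_swap1)
qed simp

lemma is_Nd_iff: "is_Nd t \<longleftrightarrow> tlist t \<noteq> []"
  by (cases t) auto

lemma tfst_hd: "tlist t \<noteq> [] \<Longrightarrow> tfst t = hd (tlist t)"
  by (cases t) auto

lemma tsize_drop: "tsize ((tsnd ^^ i) t) \<le> tsize t"
  by (induction i) (auto intro: le_trans[OF tsize_tsnd])

text \<open>Bounded recursion on lists. The increment allowed by \<open>size\<close> may depend on
  the parameter and the list element but not on the accumulator; a step that doubled the accumulator
  would lead to exponential size.\<close>

lemma ptime_fold:
  assumes g: "ptime g" and a: "ptime a" and l: "ptime l" and Q: "polyf Q"
    and size: "\<And>inp x a e. valid_inp inp \<Longrightarrow> tsize (g inp (Nd x (Nd a e))) \<le> tsize a + Q (tsize x + tsize e)"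
  shows "ptime (\<lambda>inp x. foldl (\<lambda>a e. g inp (Nd x (Nd a e))) (a inp x) (tlist (l inp x)))"
proof -
  \<comment> \<open>The loop state consists of parameter, accumulator and remaining list. The
    remaining list is itself the test, being an inner node exactly as long as it is
    nonempty.\<close>
  let ?c = "\<lambda>(inp::nat \<Rightarrow> nat) s. tsnd (tsnd s)"
  let ?f = "\<lambda>(inp::nat \<Rightarrow> nat) s. Nd (tfst s) (Nd (g inp (Nd (tfst s) (Nd (tfst (tsnd s)) (tfst (tsnd (tsnd s))))))
      (tsnd (tsnd (tsnd s))))"
  have "ptime ?c" by (intro ptime_snd ptime_id)
  moreover have "ptime ?f"
    by (intro ptime_Nd ptime_fst ptime_snd ptime_id ptime_comp[OF g])
  ultimately obtain p R where pR: "iterates p R ?c ?f"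
    using ptime_while[of ?c ?f] by blast
  \<comment> \<open>With \<open>m\<close> bounding the initial parts: two nodes for the triple,
    \<open>3 * m\<close> for parameter, initial accumulator and list, and at most \<open>m\<close>
    increments of at most \<open>Q (m + m)\<close>.\<close>
  let ?S = "\<lambda>m. 2 + 3 * m + m * Q (m + m)"
  have iter: "(?f inp ^^ i) (Nd x (Nd a t)) =
      Nd x (Nd (foldl (\<lambda>a e. g inp (Nd x (Nd a e))) a (take i (tlist t))) ((tsnd ^^ i) t))"
    if "i \<le> length (tlist t)" for inp x a t i
    using that
  proof (induction i)
    case (Suc i)
    have "tfst ((tsnd ^^ i) t) = tlist t ! i"
      using Suc.prems by (simp add: tfst_hd tlist_drop hd_drop_conv_nth)
    then show ?case using Suc by (simp add: take_Suc_conv_app_nth)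
  qed simp
  have fold_size: "tsize (foldl (\<lambda>a e. g inp (Nd x (Nd a e))) a es) \<le> tsize a + length es * Q (tsize x + m)"
    if "\<forall>e\<in>set es. tsize e \<le> m" "valid_inp inp" for inp x a es m
    using that(1)
  proof (induction es arbitrary: a)
    case (Cons e es)
    have "tsize (g inp (Nd x (Nd a e))) \<le> tsize a + Q (tsize x + m)"
      using size[OF that(2), of x a e] polyf_mono[OF Q, of "tsize x + tsize e" "tsize x + m"] Cons.prems by force
    then show ?case using Cons.IH[of "g inp (Nd x (Nd a e))"] Cons.prems by simp
  qed simp
  let ?init = "\<lambda>inp x. Nd x (Nd (a inp x) (l inp x))"
  obtain p0 P0 where p0: "realizes p0 P0 ?init"
    using ptime_Nd[OF ptime_id ptime_Nd[OF a l]] unfolding ptime_def by blast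
  obtain q Q1 where q: "realizes q Q1 (\<lambda>inp s. tfst (tsnd s))"
    using ptime_fst[OF ptime_snd[OF ptime_id]] unfolding ptime_def by blast
  let ?T = "\<lambda>n. P0 n + (P0 n + 2) * R (?S (P0 n)) + Q1 (?S (P0 n)) + 2"
  let ?h = "\<lambda>inp x. foldl (\<lambda>a e. g inp (Nd x (Nd a e))) (a inp x) (tlist (l inp x))"
  have "realizes (p0 ;; p ;; q) ?T ?h"
    unfolding realizes_def
  proof (intro conjI allI impI)
    have "polyf P0" "polyf Q1" using p0 q by (auto simp: realizes_def)
    moreover from this have S: "polyf (\<lambda>n. ?S (P0 n))"
      by (intro polyf_intros polyf_comp[OF Q])
    ultimately show "polyf ?T"
      by (intro polyf_intros polyf_comp[OF iterates_polyf[OF pR] S] polyf_comp[of Q1, OF _ S])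
    obtain B where "wf_prog B p" "wf_prog B q" using wf_seqE[of p q] iterates_wf[OF pR] q by (auto simp: realizes_def)
    then show "\<exists>B. wf_prog B (p0 ;; p ;; q)"
      using wf_seqE[of p0 "p ;; q"] p0 by (auto simp: realizes_def)
    fix inp x assume v: "valid_inp inp"
    let ?m = "P0 (tsize x)" and ?t = "l inp x"
    let ?n = "length (tlist ?t)"
    have m: "tsize x \<le> ?m" "tsize (a inp x) \<le> ?m" "tsize ?t \<le> ?m"
      using realizesD(2)[OF p0 v order_refl, of x] by auto
    have n: "?n \<le> ?m" using length_tlist[of ?t] m by simp
    let ?fold = "\<lambda>i. foldl (\<lambda>a e. g inp (Nd x (Nd a e))) (a inp x) (take i (tlist ?t))"
    have fsz: "tsize (?fold i) \<le> ?m + ?m * Q (?m + ?m)" for i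
    proof -
      have "tsize (?fold i) \<le> tsize (a inp x) + length (take i (tlist ?t)) * Q (tsize x + ?m)"
        by (rule fold_size[OF _ v]) (use m tsize_tlist_elem in \<open>fastforce dest: in_set_takeD\<close>)
      also have "\<dots> \<le> ?m + ?m * Q (?m + ?m)"
        using m n by (intro add_mono mult_le_mono polyf_mono[OF Q]) auto
      finally show ?thesis .
    qed
    have sz: "tsize ((?f inp ^^ i) (?init inp x)) \<le> ?S ?m" if "i \<le> ?n" for i
      using fsz[of i] m tsize_drop[of i ?t] by (simp add: iter[OF that])
    have "computes inp p [?init inp x] ((?n + 2) * R (?S ?m)) [(?f inp ^^ ?n) (?init inp x)]"
      by (rule iterates_computes[OF pR v]) (use sz in \<open>auto simp: iter is_Nd_iff tlist_drop\<close>)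
    then have 1: "computes inp p [?init inp x] ((?m + 2) * R (?S ?m)) [(?f inp ^^ ?n) (?init inp x)]"
      by (rule computes_mono) (use n in simp)
    have 2: "computes inp q [(?f inp ^^ ?n) (?init inp x)] (Q1 (?S ?m)) [?h inp x]"
      using realizesD(1)[OF q v sz[OF order_refl]] by (simp add: iter)
    from computes_seq[OF realizesD(1)[OF p0 v order_refl] computes_seq[OF 1 2 order_refl]]
    show "computes inp (p0 ;; p ;; q) [x] (?T (tsize x)) [?h inp x]" by simp
    have "tsize (?h inp x) \<le> Q1 (?S ?m)"
      using realizesD(2)[OF q v sz[OF order_refl]] by (simp add: iter)
    then show "tsize (?h inp x) \<le> ?T (tsize x)" by linarith
  qed
  then show ?thesis unfolding ptime_def by blast
qed

section \<open>Machine configurations as trees\<close>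

fun ltree :: "tree list \<Rightarrow> tree" where
  "ltree [] = At 0"
| "ltree (t # ts) = Nd t (ltree ts)"

lemma tlist_ltree [simp]: "tlist (ltree ts) = ts"
  by (induction ts) auto

abbreviation atoms :: "nat list \<Rightarrow> tree" where
  "atoms l \<equiv> ltree (map At l)"

text \<open>A tape is kept as a zipper \<open>(l, r)\<close>: the cells left of the head, nearest first, and the cells
  from the head on; cells beyond \<open>r\<close> are blank.\<close>
type_synonym zipper = "nat list \<times> nat list"

text \<open>State, bit under the choice head, and work tapes.\<close>
type_synonym zconfig = "nat \<times> bool \<times> zipper list"

definition list_fun :: "nat list \<Rightarrow> nat \<Rightarrow> nat" where
  "list_fun s = (\<lambda>j. if j < length s then s ! j else 0)"

definition cells :: "zipper \<Rightarrow> nat list" where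
  "cells = (\<lambda>(l, r). rev l @ r)"

text \<open>A left move with nothing on the left stays in place, as \<open>move\<close> does at cell
  0 by truncation. Beyond the stored cells \<open>tl r\<close> is empty, which stands for
  blanks.\<close>

definition zact :: "nat \<Rightarrow> int \<Rightarrow> zipper \<Rightarrow> zipper" where
  "zact w d = (\<lambda>(l, r). if d = 1 then (w # l, tl r)
     else if d = -1 \<and> l \<noteq> [] then (tl l, hd l # w # tl r) else (l, w # tl r))"

definition zdelta :: "machine \<Rightarrow> (nat \<Rightarrow> nat) \<Rightarrow> zconfig \<Rightarrow> nat \<times> nat list \<times> int list \<times> int" where
  "zdelta M inp = (\<lambda>(q, b, zs).
     delta M q (inp (tape_num (list_fun (cells (zs ! 0))))) (map (top0 \<circ> snd) zs) b)"

text \<open>With the position of the choice head forgotten, the bit it scans after the step cannot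
  be looked up; it is supplied as \<open>b'\<close>.\<close>

definition znext :: "machine \<Rightarrow> (nat \<Rightarrow> nat) \<Rightarrow> bool \<Rightarrow> zconfig \<Rightarrow> zconfig" where
  "znext M inp b' z = (case zdelta M inp z of (q', wr, mv, cm) \<Rightarrow>
     (q', b', map (\<lambda>i. zact (wr ! i) (mv ! i) (snd (snd z) ! i)) [0..<ntapes M]))"

definition zmove :: "machine \<Rightarrow> (nat \<Rightarrow> nat) \<Rightarrow> zconfig \<Rightarrow> int" where
  "zmove M inp z = snd (snd (snd (zdelta M inp z)))"

definition zhalted :: "machine \<Rightarrow> zconfig \<Rightarrow> bool" where
  "zhalted M z \<longleftrightarrow> fst z = acc M \<or> fst z = rej M"

definition wf_zconfig :: "machine \<Rightarrow> zconfig \<Rightarrow> bool" where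
  "wf_zconfig M = (\<lambda>(q, b, zs). q < nstates M \<and> length zs = ntapes M \<and>
     (\<forall>z\<in>set zs. \<forall>s\<in>set (fst z) \<union> set (snd z). s < nsyms M))"

definition conf_of :: "zconfig \<Rightarrow> nat \<Rightarrow> config" where
  "conf_of = (\<lambda>(q, b, zs) h. \<lparr> state = q, tapes = map (\<lambda>z. (list_fun (cells z), length (fst z))) zs, chead = h \<rparr>)"

lemma cells_zact: "cells (zact w d (l, r)) = rev l @ w # tl r"
  by (cases l) (auto simp: zact_def cells_def)

lemma list_fun_update: "(list_fun (rev l @ r))(length l := w) = list_fun (rev l @ w # tl r)"
  by (cases r) (auto simp: list_fun_def fun_eq_iff nth_append nth_Cons split: nat.splits)

lemma zact_correct:
  assumes "d \<in> {-1, 0, 1}"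
  shows "((list_fun (cells z))(length (fst z) := w), move (length (fst z)) d)
    = (list_fun (cells (zact w d z)), length (fst (zact w d z)))"
proof -
  obtain l r where z: "z = (l, r)" by fastforce
  have "move (length l) d = length (fst (zact w d z))"
    using assms by (cases l) (auto simp: z zact_def move_def nat_add_distrib)
  then show ?thesis by (simp add: z cells_zact list_fun_update) (simp add: cells_def list_fun_update)
qed

lemma list_fun_scanned: "list_fun (cells z) (length (fst z)) = top0 (snd z)"
proof -
  obtain l r where z: "z = (l, r)" by fastforce
  show ?thesis unfolding z by (cases r) (auto simp: cells_def list_fun_def nth_append)
qed

lemma top0_less: "0 < n \<Longrightarrow> \<forall>s\<in>set l. s < n \<Longrightarrow> top0 l < n"
  by (cases l) auto

lemma zdelta_wf:
  assumes "wf_machine M" "wf_zconfig M z" "valid_inp inp" "zdelta M inp z = (q', wr, mv, cm)"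
  shows "q' < nstates M" "length wr = ntapes M" "\<forall>s\<in>set wr. s < nsyms M"
    "length mv = ntapes M" "\<forall>d\<in>set mv. d \<in> {-1, 0, 1}" "cm \<in> {-1, 0, 1}"
proof -
  obtain q b zs where z: "z = (q, b, zs)" by (metis prod_cases3)
  have "0 < nsyms M" using assms(1) by (auto simp: wf_machine_def)
  then have "\<forall>s\<in>set (map (top0 \<circ> snd) zs). s < nsyms M"
    using assms(2) unfolding z wf_zconfig_def by (auto intro!: top0_less)
  moreover have "q < nstates M" "length (map (top0 \<circ> snd) zs) = ntapes M"
    using assms(2) by (auto simp: z wf_zconfig_def)
  moreover have "inp (tape_num (list_fun (cells (zs ! 0)))) < 4" using assms(3) by (simp add: valid_inp_def)
  ultimately have "case delta M q (inp (tape_num (list_fun (cells (zs ! 0))))) (map (top0 \<circ> snd) zs) b of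
      (q', wr, mv, cm) \<Rightarrow> q' < nstates M \<and> length wr = ntapes M \<and> (\<forall>s\<in>set wr. s < nsyms M) \<and>
      length mv = ntapes M \<and> (\<forall>d\<in>set mv. d \<in> {-1, 0, 1}) \<and> cm \<in> {-1, 0, 1}"
    by - (rule assms(1)[unfolded wf_machine_def, THEN conjunct2, THEN conjunct2, THEN conjunct2, THEN conjunct2,
        THEN conjunct2, THEN conjunct2, THEN spec, THEN spec, THEN spec, THEN spec, THEN mp], intro conjI, assumption+)
  moreover have "delta M q (inp (tape_num (list_fun (cells (zs ! 0))))) (map (top0 \<circ> snd) zs) b = (q', wr, mv, cm)"
    using assms(4) by (simp add: zdelta_def z)
  ultimately have "q' < nstates M \<and> length wr = ntapes M \<and> (\<forall>s\<in>set wr. s < nsyms M) \<and>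
      length mv = ntapes M \<and> (\<forall>d\<in>set mv. d \<in> {-1, 0, 1}) \<and> cm \<in> {-1, 0, 1}" by simp
  then show "q' < nstates M" "length wr = ntapes M" "\<forall>s\<in>set wr. s < nsyms M"
    "length mv = ntapes M" "\<forall>d\<in>set mv. d \<in> {-1, 0, 1}" "cm \<in> {-1, 0, 1}"
    by blast+
qed

lemma step_conf_of:
  assumes "wf_machine M" "wf_zconfig M z" "fst (snd z) = c h" "\<not> zhalted M z"
  shows "step M x k c (conf_of z h) = conf_of (znext M (input_sym x k) b' z) (move h (zmove M (input_sym x k) z))"
proof -
  obtain q zs where z: "z = (q, c h, zs)" using assms(3) by (cases z) auto
  have v: "valid_inp (input_sym x k)" by (simp add: valid_inp_def input_sym_less)
  obtain q' wr mv cm where d: "zdelta M (input_sym x k) z = (q', wr, mv, cm)" by (metis prod_cases4)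
  note wf = zdelta_wf[OF assms(1,2) v d]
  have len: "length zs = ntapes M" "0 < ntapes M" using assms(1,2) by (auto simp: z wf_zconfig_def wf_machine_def)
  let ?ts = "map (\<lambda>z. (list_fun (cells z), length (fst z))) zs"
  have t0: "fst (?ts ! 0) = list_fun (cells (zs ! 0))" using len by simp
  have ws: "map (\<lambda>(t, h). t h) ?ts = map (top0 \<circ> snd) zs" by (simp add: list_fun_scanned)
  have "delta M q (input_sym x k (tape_num (fst (?ts ! 0)))) (map (\<lambda>(t, h). t h) ?ts) (c h) = (q', wr, mv, cm)"
    using d unfolding t0 ws by (simp add: zdelta_def z)
  moreover have "map (\<lambda>i. case ?ts ! i of (t, h) \<Rightarrow> (t(h := wr ! i), move h (mv ! i))) [0..<length ?ts]
      = map (\<lambda>z. (list_fun (cells z), length (fst z))) (map (\<lambda>i. zact (wr ! i) (mv ! i) (zs ! i)) [0..<ntapes M])"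
  proof (rule nth_equalityI)
    fix i assume "i < length (map (\<lambda>i. case ?ts ! i of (t, h) \<Rightarrow> (t(h := wr ! i), move h (mv ! i))) [0..<length ?ts])"
    then have i: "i < ntapes M" using len by simp
    then have "mv ! i \<in> {-1, 0, 1}" using wf by simp
    from zact_correct[OF this, of "zs ! i" "wr ! i"] i len
    show "map (\<lambda>i. case ?ts ! i of (t, h) \<Rightarrow> (t(h := wr ! i), move h (mv ! i))) [0..<length ?ts] ! i
      = map (\<lambda>z. (list_fun (cells z), length (fst z))) (map (\<lambda>i. zact (wr ! i) (mv ! i) (zs ! i)) [0..<ntapes M]) ! i"
      by simp
  qed (simp add: len)
  moreover have "\<not> halted M (conf_of z h)" using assms(4) by (simp add: halted_def zhalted_def conf_of_def z)
  ultimately show ?thesis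
    using d unfolding step_def znext_def zmove_def by (simp add: conf_of_def z Let_def)
qed

lemma wf_znext:
  assumes "wf_machine M" "wf_zconfig M z" "valid_inp inp"
  shows "wf_zconfig M (znext M inp b' z)"
proof -
  obtain q b zs where z: "z = (q, b, zs)" by (metis prod_cases3)
  obtain q' wr mv cm where d: "zdelta M inp z = (q', wr, mv, cm)" by (metis prod_cases4)
  note wf = zdelta_wf[OF assms d]
  have sym: "s < nsyms M" if i: "i < ntapes M" and s: "s \<in> set (fst (zact (wr ! i) (mv ! i) (zs ! i))) \<union> set (snd (zact (wr ! i) (mv ! i) (zs ! i)))" for i s
  proof -
    obtain l r where lr: "zs ! i = (l, r)" by fastforce
    have "zs ! i \<in> set zs" using assms(2) i by (simp add: z wf_zconfig_def)
    then have "\<forall>s\<in>set l \<union> set r. s < nsyms M" using assms(2) lr by (fastforce simp: z wf_zconfig_def)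
    moreover have "wr ! i < nsyms M" using wf i by simp
    ultimately show ?thesis using s by (cases l; cases r) (auto simp: lr zact_def split: if_splits)
  qed
  have nz: "znext M inp b' z = (q', b', map (\<lambda>i. zact (wr ! i) (mv ! i) (zs ! i)) [0..<ntapes M])"
    unfolding znext_def d by (simp add: z)
  show ?thesis unfolding nz wf_zconfig_def prod.case
  proof (intro conjI ballI)
    fix y s
    assume "y \<in> set (map (\<lambda>i. zact (wr ! i) (mv ! i) (zs ! i)) [0..<ntapes M])" and s: "s \<in> set (fst y) \<union> set (snd y)"
    then obtain i where "i < ntapes M" "y = zact (wr ! i) (mv ! i) (zs ! i)" by auto
    then show "s < nsyms M" using sym s by blast
  qed (use wf(1) in auto)
qed

lemma chead_conf_of [simp]: "chead (conf_of z h) = h"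
  by (simp add: conf_of_def split: prod.split)

lemma state_conf_of [simp]: "state (conf_of z h) = fst z"
  by (simp add: conf_of_def split: prod.split)

section \<open>Runs as sequences of zipper configurations\<close>

primrec trace :: "machine \<Rightarrow> bool list \<Rightarrow> nat \<Rightarrow> (nat \<Rightarrow> bool) \<Rightarrow> nat \<Rightarrow> zconfig" where
  "trace M x k c 0 = (start M, c 0, replicate (ntapes M) ([], []))"
| "trace M x k c (Suc n) = (if zhalted M (trace M x k c n) then trace M x k c n
     else znext M (input_sym x k) (c (chead (run M x k c (Suc n)))) (trace M x k c n))"

lemma run_Suc: "run M x k c (Suc n) = step M x k c (run M x k c n)"
  by (simp add: run_def)

lemma valid_input_sym: "valid_inp (input_sym x k)"
  by (simp add: valid_inp_def input_sym_less)

lemma trace_correct: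
  assumes "wf_machine M"
  shows "run M x k c n = conf_of (trace M x k c n) (chead (run M x k c n)) \<and>
    fst (snd (trace M x k c n)) = c (chead (run M x k c n)) \<and> wf_zconfig M (trace M x k c n)"
proof (induction n)
  case 0
  have "list_fun (cells ([], [])) = (\<lambda>_. 0)" by (simp add: list_fun_def cells_def)
  then show ?case using assms by (auto simp: run_def init_config_def conf_of_def wf_zconfig_def wf_machine_def)
next
  case (Suc n)
  let ?z = "trace M x k c n" let ?h = "chead (run M x k c n)"
  have r: "run M x k c n = conf_of ?z ?h" and bit: "fst (snd ?z) = c ?h" and wf: "wf_zconfig M ?z"
    using Suc by blast+
  show ?case
  proof (cases "zhalted M ?z")
    case True
    then have "halted M (conf_of ?z ?h)" by (simp add: halted_def zhalted_def)
    then have e: "run M x k c (Suc n) = run M x k c n" unfolding run_Suc using r by (simp add: step_def)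
    have tr: "trace M x k c (Suc n) = ?z" using True by simp
    show ?thesis unfolding e tr using r bit wf by blast
  next
    case False
    have "step M x k c (conf_of ?z ?h) = conf_of (znext M (input_sym x k) (c (chead (run M x k c (Suc n)))) ?z)
        (move ?h (zmove M (input_sym x k) ?z))"
      by (rule step_conf_of[where c = c and h = ?h, OF assms wf bit False])
    then have r': "run M x k c (Suc n) = conf_of (trace M x k c (Suc n)) (move ?h (zmove M (input_sym x k) ?z))"
      using r False unfolding run_Suc[of M x k c n] trace.simps by simp
    then have "chead (run M x k c (Suc n)) = move ?h (zmove M (input_sym x k) ?z)" by (metis chead_conf_of)
    then have "run M x k c (Suc n) = conf_of (trace M x k c (Suc n)) (chead (run M x k c (Suc n)))"
      using r' by (metis chead_conf_of)
    moreover have "fst (snd (trace M x k c (Suc n))) = c (chead (run M x k c (Suc n)))"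
      using False by (simp add: znext_def split: prod.split)
    moreover have "wf_zconfig M (trace M x k c (Suc n))"
      using False wf_znext[OF assms wf valid_input_sym] by simp
    ultimately show ?thesis by blast
  qed
qed

lemma halted_trace: "wf_machine M \<Longrightarrow> halted M (run M x k c n) \<longleftrightarrow> zhalted M (trace M x k c n)"
  using trace_correct[of M x k c n] by (metis halted_def state_conf_of zhalted_def)

lemma chead_Suc:
  assumes "wf_machine M" "\<not> zhalted M (trace M x k c n)"
  shows "chead (run M x k c (Suc n)) = move (chead (run M x k c n)) (zmove M (input_sym x k) (trace M x k c n))"
proof -
  let ?h = "chead (run M x k c n)" and ?z = "trace M x k c n"
  have r: "run M x k c n = conf_of ?z ?h" and b: "fst (snd ?z) = c ?h" and w: "wf_zconfig M ?z"
    using trace_correct[OF assms(1), of x k c n] by blast+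
  have "run M x k c (Suc n) = conf_of (znext M (input_sym x k) True ?z) (move ?h (zmove M (input_sym x k) ?z))"
    using step_conf_of[where c = c and h = ?h, OF assms(1) w b assms(2)] r unfolding run_Suc by metis
  then show ?thesis by (metis chead_conf_of)
qed

text \<open>A zipper gets longer only when the head stands just past the stored cells, and then the
  new length is the head position plus one. Thus the bound on head positions in
  \<open>paraL_machine\<close> bounds the whole tape content.\<close>

lemma trace_size:
  assumes "wf_machine M" and S: "\<And>n i. i < ntapes M \<Longrightarrow> snd (tapes (run M x k c n) ! i) \<le> S"
  shows "\<forall>z\<in>set (snd (snd (trace M x k c n))). length (fst z) + length (snd z) \<le> S + 1"
proof (induction n)
  case (Suc n)
  let ?z = "trace M x k c n"
  show ?case
  proof (cases "zhalted M ?z")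
    case False
    obtain q b zs where z: "?z = (q, b, zs)" by (metis prod_cases3)
    have len: "length zs = ntapes M" and r: "run M x k c n = conf_of ?z (chead (run M x k c n))"
      using trace_correct[OF assms(1), of x k c n] by (auto simp: z wf_zconfig_def)
    obtain q' wr mv cm where d: "zdelta M (input_sym x k) ?z = (q', wr, mv, cm)" by (metis prod_cases4)
    have "length (fst (zact w e (zs ! i))) + length (snd (zact w e (zs ! i))) \<le> S + 1" if "i < ntapes M" for w e i
    proof -
      obtain l r where lr: "zs ! i = (l, r)" by fastforce
      have "snd (tapes (run M x k c n) ! i) = length l"
        using that len by (subst r) (simp add: conf_of_def z lr)
      then have "length l \<le> S" using S[OF that, of n] by simp
      moreover have "length l + length r \<le> S + 1"
        using Suc that len lr nth_mem[of i zs] by (fastforce simp: z)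
      ultimately show ?thesis by (cases l; cases r) (auto simp: lr zact_def)
    qed
    moreover have "znext M (input_sym x k) b' ?z = (q', b', map (\<lambda>i. zact (wr ! i) (mv ! i) (zs ! i)) [0..<ntapes M])" for b'
      unfolding znext_def d by (simp add: z)
    ultimately show ?thesis using False by auto
  qed (use Suc in simp)
qed simp

section \<open>Configurations and single machine steps on trees\<close>

fun ctree :: "zconfig \<Rightarrow> tree" where
  "ctree (q, b, zs) = Nd (Nd (At q) (At (of_bool b))) (ltree (map (\<lambda>(l, r). Nd (atoms l) (atoms r)) zs))"

lemma ltree_inject [simp]: "ltree ts = ltree us \<longleftrightarrow> ts = us"
  by (metis tlist_ltree)

lemma atoms_inject [simp]: "atoms l = atoms r \<longleftrightarrow> l = r"
  by (simp add: inj_map_eq_map inj_def)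

lemma ctree_inject: "ctree y = ctree z \<Longrightarrow> y = z"
proof -
  assume e: "ctree y = ctree z"
  obtain q b zs q' b' zs' where yz: "y = (q, b, zs)" "z = (q', b', zs')" by (metis prod_cases3)
  have "inj (\<lambda>(l, r). Nd (atoms l) (atoms r))" by (auto simp: inj_def)
  then show "y = z" using e by (auto simp: yz inj_map_eq_map of_bool_eq_iff)
qed

lemma tape_num_takeWhile:
  "tape_num (list_fun s) = tape_num (list_fun (takeWhile (\<lambda>a. a = 1 \<or> a = 2) s))"
proof -
  let ?P = "\<lambda>a. a = 1 \<or> a = (2::nat)"
  have L: "(LEAST i. list_fun s i \<notin> {1, 2}) = length (takeWhile ?P s)" "\<exists>i. list_fun s i \<notin> {1, 2}" for s
  proof -
    have out: "list_fun s (length (takeWhile ?P s)) \<notin> {1, 2}"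
      using nth_length_takeWhile[of ?P s] by (auto simp: list_fun_def)
    show "\<exists>i. list_fun s i \<notin> {1, 2}" using out by blast
    show "(LEAST i. list_fun s i \<notin> {1, 2}) = length (takeWhile ?P s)"
    proof (rule Least_equality, rule out, rule ccontr)
      fix i assume i: "list_fun s i \<notin> {1, 2}" "\<not> length (takeWhile ?P s) \<le> i"
      then have "i < length (takeWhile ?P s)" by simp
      then have "takeWhile ?P s ! i \<in> set (takeWhile ?P s)" "takeWhile ?P s ! i = s ! i"
        by (rule nth_mem, rule takeWhile_nth)
      moreover from this(1) have "?P (takeWhile ?P s ! i)" using set_takeWhileD[of _ ?P s] by blast
      ultimately show False using i length_takeWhile_le[of ?P s] by (auto simp: list_fun_def)
    qed
  qed
  have "takeWhile ?P (takeWhile ?P s) = takeWhile ?P s" 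
    unfolding takeWhile_eq_all_conv using set_takeWhileD[of _ ?P s] by blast
  moreover have "list_fun s i = list_fun (takeWhile ?P s) i" if "i < length (takeWhile ?P s)" for i
    using that length_takeWhile_le[of ?P s] by (simp add: list_fun_def takeWhile_nth)
  ultimately show ?thesis unfolding tape_num_def Let_def using L by simp
qed

lemma addr_atoms: "addr (addr_syms (atoms s)) = tape_num (list_fun s)"
proof -
  have "addr_syms (atoms s) = takeWhile (\<lambda>a. a = 1 \<or> a = 2) s" by (induction s) auto
  moreover have "addr t = tape_num (list_fun t)" for t by (simp add: addr_def list_fun_def)
  ultimately show ?thesis using tape_num_takeWhile[of s] by simp
qed

definition rev_onto :: "tree \<Rightarrow> tree \<Rightarrow> tree" where
  "rev_onto t l = foldl (\<lambda>a e. Nd e a) t (tlist l)"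

lemma foldl_Nd: "foldl (\<lambda>a e. Nd e a) (ltree ts) us = ltree (rev us @ ts)"
  by (induction us arbitrary: ts) (simp, metis (no_types) foldl.simps(2) ltree.simps(2) rev.simps(2) append_Cons append_Nil append_assoc)

lemma rev_onto_ltree: "rev_onto (ltree ts) l = ltree (rev (tlist l) @ ts)"
  unfolding rev_onto_def by (rule foldl_Nd)

lemma ptime_rev_onto:
  assumes "ptime f" "ptime g"
  shows "ptime (\<lambda>inp x. rev_onto (f inp x) (g inp x))"
  unfolding rev_onto_def
proof -
  have "ptime (\<lambda>inp x. foldl (\<lambda>a e. (\<lambda>inp s. Nd (tsnd (tsnd s)) (tfst (tsnd s))) inp (Nd x (Nd a e))) (f inp x) (tlist (g inp x)))"
    by (rule ptime_fold[where Q = "\<lambda>n. n + 1"]) (intro ptime_Nd ptime_fst ptime_snd ptime_id assms polyf_intros | simp)+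
  then show "ptime (\<lambda>inp x. foldl (\<lambda>a e. Nd e a) (f inp x) (tlist (g inp x)))" by simp
qed

lemma ptime_drop: "ptime f \<Longrightarrow> ptime (\<lambda>inp x. (tsnd ^^ i) (f inp x))"
  by (induction i) (simp_all add: ptime_snd)

lemma ptime_ltree: "(\<And>i. i \<in> set is \<Longrightarrow> ptime (f i)) \<Longrightarrow> ptime (\<lambda>inp x. ltree (map (\<lambda>i. f i inp x) is))"
  by (induction "is") (simp_all add: ptime_const ptime_Nd)

text \<open>Everything the transition function depends on is gathered into a single atom; the bound keeps
  the alphabet finite and is never attained on trees that encode configurations.\<close>
fun gather :: "nat \<Rightarrow> ((nat \<Rightarrow> nat) \<Rightarrow> tree \<Rightarrow> tree) list \<Rightarrow> (nat \<Rightarrow> nat) \<Rightarrow> tree \<Rightarrow> tree" where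
  "gather B [] inp x = At 0"
| "gather B (c # cs) inp x = At (min B (Suc (prod_encode (label (c inp x), label (gather B cs inp x)))))"

lemma ptime_gather: "(\<And>c. c \<in> set cs \<Longrightarrow> ptime c) \<Longrightarrow> ptime (gather B cs)"
proof (induction cs)
  case Nil
  have "gather B [] = (\<lambda>inp x. At 0)" by (intro ext) simp
  then show ?case by (simp add: ptime_const)
next
  case (Cons c cs)
  have "gather B (c # cs) = (\<lambda>inp x. At (min B (Suc (prod_encode (label (c inp x), label (gather B cs inp x))))))"
    by (intro ext) simp
  then show ?case
    using ptime_at2[of "\<lambda>a b. min B (Suc (prod_encode (a, b)))" B c "gather B cs"] Cons by simp
qed

lemma label_gather:
  "list_encode (map (\<lambda>c. label (c inp x)) cs) \<le> B \<Longrightarrow>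
   label (gather B cs inp x) = list_encode (map (\<lambda>c. label (c inp x)) cs)"
proof (induction cs)
  case (Cons c cs)
  have "list_encode (map (\<lambda>c. label (c inp x)) cs) \<le> list_encode (map (\<lambda>c. label (c inp x)) (c # cs))"
    using le_prod_encode_2[of "list_encode (map (\<lambda>c. label (c inp x)) cs)" "label (c inp x)"] by simp
  then show ?case using Cons by simp
qed simp

definition t_state :: "tree \<Rightarrow> tree" where "t_state v = tfst (tfst v)"
definition t_bit :: "tree \<Rightarrow> tree" where "t_bit v = tsnd (tfst v)"
definition t_left :: "nat \<Rightarrow> tree \<Rightarrow> tree" where "t_left i v = tfst (tfst ((tsnd ^^ i) (tsnd v)))"
definition t_right :: "nat \<Rightarrow> tree \<Rightarrow> tree" where "t_right i v = tsnd (tfst ((tsnd ^^ i) (tsnd v)))"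

lemma tfst_drop_ltree: "i < length ts \<Longrightarrow> tfst ((tsnd ^^ i) (ltree ts)) = ts ! i"
  by (simp add: tfst_hd tlist_drop hd_drop_conv_nth)

lemma t_ctree [simp]:
  "t_state (ctree (q, b, zs)) = At q" "t_bit (ctree (q, b, zs)) = At (of_bool b)"
  "i < length zs \<Longrightarrow> t_left i (ctree (q, b, zs)) = atoms (fst (zs ! i))"
  "i < length zs \<Longrightarrow> t_right i (ctree (q, b, zs)) = atoms (snd (zs ! i))"
  by (simp_all add: t_state_def t_bit_def t_left_def t_right_def tfst_drop_ltree split: prod.split)

lemma ptime_t:
  assumes "ptime f"
  shows "ptime (\<lambda>inp x. t_state (f inp x))" "ptime (\<lambda>inp x. t_bit (f inp x))"
    "ptime (\<lambda>inp x. t_left i (f inp x))" "ptime (\<lambda>inp x. t_right i (f inp x))"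
  unfolding t_state_def t_bit_def t_left_def t_right_def
  by (intro ptime_fst ptime_snd ptime_drop assms)+

text \<open>The lists in question hold state, input symbol and choice bit, followed by one symbol
  per work tape; every entry is below the sum of the numbers of states, tape symbols and input
  symbols.\<close>

definition code_bound :: "machine \<Rightarrow> nat" where
  "code_bound M = Max (list_encode ` {l. set l \<subseteq> {..<nstates M + nsyms M + 4} \<and> length l = ntapes M + 3})"

definition scan_code :: "machine \<Rightarrow> (nat \<Rightarrow> nat) \<Rightarrow> tree \<Rightarrow> tree" where
  "scan_code M = gather (code_bound M)
     ((\<lambda>inp. t_state) # (\<lambda>inp v. At (inp (addr (addr_syms (rev_onto (t_right 0 v) (t_left 0 v)))))) # (\<lambda>inp. t_bit) #
      map (\<lambda>i inp v. tfst (t_right i v)) [0..<ntapes M])"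

definition decoded :: "machine \<Rightarrow> nat \<Rightarrow> nat \<times> nat list \<times> int list \<times> int" where
  "decoded M z = (let l = list_decode z in delta M (l ! 0) (l ! 1) (drop 3 l) (l ! 2 = 1))"

lemma ptime_scan_code: "ptime f \<Longrightarrow> ptime (\<lambda>inp x. scan_code M inp (f inp x))"
  unfolding scan_code_def
  by (rule ptime_comp[OF ptime_gather])
    (auto intro!: ptime_t ptime_id ptime_fst ptime_lookup ptime_rev_onto)

lemma decoded_scan_code:
  assumes "wf_machine M" "wf_zconfig M z" "valid_inp inp"
  shows "decoded M (label (scan_code M inp (ctree z))) = zdelta M inp z"
proof -
  obtain q b zs where z: "z = (q, b, zs)" by (metis prod_cases3)
  have len: "length zs = ntapes M" "0 < ntapes M" and q: "q < nstates M" and n: "3 \<le> nsyms M"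
    using assms(1,2) by (auto simp: z wf_zconfig_def wf_machine_def)
  let ?cs = "(\<lambda>inp. t_state) # (\<lambda>inp v. At (inp (addr (addr_syms (rev_onto (t_right 0 v) (t_left 0 v)))))) #
      (\<lambda>inp. t_bit) # map (\<lambda>i inp v. tfst (t_right i v)) [0..<ntapes M]"
  let ?a = "inp (tape_num (list_fun (cells (zs ! 0))))"
  let ?l = "q # ?a # of_bool b # map (top0 \<circ> snd) zs"
  have "rev_onto (atoms (snd (zs ! 0))) (atoms (fst (zs ! 0))) = atoms (cells (zs ! 0))"
    by (simp add: rev_onto_ltree cells_def rev_map split: prod.split)
  moreover have "label (tfst (atoms l)) = top0 l" for l by (cases l) auto
  ultimately have l: "map (\<lambda>c. label (c inp (ctree z))) ?cs = ?l"
    using len by (auto simp: z addr_atoms simp del: ctree.simps intro!: nth_equalityI)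
  have "?a < 4" using assms(3) by (simp add: valid_inp_def)
  moreover have "\<forall>s\<in>set (map (top0 \<circ> snd) zs). s < nsyms M"
    using assms(2) n unfolding z wf_zconfig_def by (auto intro!: top0_less)
  ultimately have "?l \<in> {l. set l \<subseteq> {..<nstates M + nsyms M + 4} \<and> length l = ntapes M + 3}"
    using q len by (auto simp: less_Suc_eq)
  then have "list_encode ?l \<le> code_bound M" unfolding code_bound_def
    by (intro Max_ge finite_imageI finite_lists_length_eq imageI) auto
  then have "label (scan_code M inp (ctree z)) = list_encode ?l"
    unfolding scan_code_def using label_gather[of inp "ctree z" ?cs "code_bound M"] l by simp
  then show ?thesis by (simp add: decoded_def z zdelta_def numeral_2_eq_2 numeral_3_eq_3)
qed

text \<open>On arbitrary trees \<open>decoded\<close> may return anything, while new labels need a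
  fixed bound. The cap by \<open>nsyms M\<close>, like the one by \<open>nstates M\<close> in
  \<open>tree_next\<close>, provides it and is inactive on encoded configurations.\<close>

definition tree_tape :: "machine \<Rightarrow> nat \<Rightarrow> (nat \<Rightarrow> nat) \<Rightarrow> tree \<Rightarrow> tree" where
  "tree_tape M i inp v = (let z = label (scan_code M inp v); l = t_left i v; r = tsnd (t_right i v);
      w = At (min (nsyms M) (fst (snd (decoded M z)) ! i)) in
    if fst (snd (snd (decoded M z))) ! i = 1 then Nd (Nd w l) r
    else if fst (snd (snd (decoded M z))) ! i = -1
    then if is_Nd l then Nd (tsnd l) (Nd (tfst l) (Nd w r)) else Nd l (Nd w r)
    else Nd l (Nd w r))"

definition tree_next :: "machine \<Rightarrow> (nat \<Rightarrow> nat) \<Rightarrow> tree \<Rightarrow> tree \<Rightarrow> tree" where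
  "tree_next M inp b v = Nd (Nd (At (min (nstates M) (fst (decoded M (label (scan_code M inp v)))))) b)
     (ltree (map (\<lambda>i. tree_tape M i inp v) [0..<ntapes M]))"

lemma ptime_tree_next:
  assumes f: "ptime f" and b: "ptime b"
  shows "ptime (\<lambda>inp x. tree_next M inp (b inp x) (f inp x))"
proof -
  note code = ptime_scan_code[OF f, of M]
  have w: "ptime (\<lambda>inp x. At (min (nsyms M) (fst (snd (decoded M (label (scan_code M inp (f inp x))))) ! i)))" for i
    by (rule ptime_at1[where B = "nsyms M", OF _ code]) simp
  have "ptime (\<lambda>inp x. tree_tape M i inp (f inp x))" for i
    unfolding tree_tape_def Let_def
    by (rule ptime_if_label[OF code, where Q = "\<lambda>z. fst (snd (snd (decoded M z))) ! i = 1"],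
        (intro ptime_Nd ptime_snd ptime_t f w)[1],
        rule ptime_if_label[OF code, where Q = "\<lambda>z. fst (snd (snd (decoded M z))) ! i = -1"])
      (intro ptime_if_Nd ptime_Nd ptime_fst ptime_snd ptime_t f w)+
  then have "ptime (\<lambda>inp x. ltree (map (\<lambda>i. tree_tape M i inp (f inp x)) [0..<ntapes M]))"
    by (rule ptime_ltree[where f = "\<lambda>i inp x. tree_tape M i inp (f inp x)"])
  moreover have "ptime (\<lambda>inp x. At (min (nstates M) (fst (decoded M (label (scan_code M inp (f inp x)))))))"
    by (rule ptime_at1[where B = "nstates M", OF _ code]) simp
  ultimately show ?thesis unfolding tree_next_def by (intro ptime_Nd b)
qed

lemma tree_next_ctree:
  assumes "wf_machine M" "wf_zconfig M z" "valid_inp inp"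
  shows "tree_next M inp (At (of_bool b')) (ctree z) = ctree (znext M inp b' z)"
proof -
  obtain q b zs where z: "z = (q, b, zs)" by (metis prod_cases3)
  obtain q' wr mv cm where d: "zdelta M inp z = (q', wr, mv, cm)" by (metis prod_cases4)
  note wf = zdelta_wf[OF assms d]
  note dec = decoded_scan_code[OF assms, unfolded d]
  have len: "length zs = ntapes M" using assms(2) by (auto simp: z wf_zconfig_def)
  have "tree_tape M i inp (ctree z) = (\<lambda>(l, r). Nd (atoms l) (atoms r)) (zact (wr ! i) (mv ! i) (zs ! i))"
    if i: "i < ntapes M" for i
  proof -
    obtain l r where lr: "zs ! i = (l, r)" by fastforce
    have t: "t_left i (ctree z) = atoms l" "t_right i (ctree z) = atoms r"
      using i len lr by (simp_all add: z del: ctree.simps)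
    have s: "tsnd (atoms r) = atoms (tl r)" by (cases r) auto
    have "wr ! i < nsyms M" using wf i by simp
    then have "min (nsyms M) (wr ! i) = wr ! i" by simp
    then show ?thesis unfolding tree_tape_def Let_def dec t lr by (cases l) (simp_all add: zact_def s)
  qed
  moreover have "min (nstates M) q' = q'" using wf(1) by simp
  moreover have "znext M inp b' z = (q', b', map (\<lambda>i. zact (wr ! i) (mv ! i) (zs ! i)) [0..<ntapes M])"
    unfolding znext_def d by (simp add: z)
  ultimately show ?thesis unfolding tree_next_def dec by simp
qed

definition tree_halted :: "machine \<Rightarrow> tree \<Rightarrow> bool" where
  "tree_halted M v \<longleftrightarrow> label (t_state v) = acc M \<or> label (t_state v) = rej M"

lemma tree_halted_ctree: "tree_halted M (ctree z) \<longleftrightarrow> zhalted M z"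
  by (cases z) (simp add: tree_halted_def zhalted_def del: ctree.simps)

definition tree_branches :: "machine \<Rightarrow> (nat \<Rightarrow> nat) \<Rightarrow> tree \<Rightarrow> bool" where
  "tree_branches M inp v \<longleftrightarrow> snd (snd (snd (decoded M (label (scan_code M inp v))))) = 1"

lemma tree_branches_ctree:
  "wf_machine M \<Longrightarrow> wf_zconfig M z \<Longrightarrow> valid_inp inp \<Longrightarrow> tree_branches M inp (ctree z) \<longleftrightarrow> zmove M inp z = 1"
  by (simp add: tree_branches_def decoded_scan_code zmove_def)

section \<open>Tables of configurations with multiplicities\<close>

definition btree :: "nat \<Rightarrow> tree" where
  "btree n = ltree (map (\<lambda>b. At (of_bool b)) (bits n))"

lemma bits_0 [simp]: "bits 0 = []"
  by (simp add: bits.simps)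

lemma bits_pos: "0 < n \<Longrightarrow> bits n = odd n # bits (n div 2)"
  by (subst bits.simps) simp

lemma btree_0 [simp]: "btree 0 = At 0"
  by (simp add: btree_def)

lemma btree_pos: "0 < n \<Longrightarrow> btree n = Nd (At (of_bool (odd n))) (btree (n div 2))"
  by (simp add: btree_def bits_pos)

lemma is_Nd_btree [simp]: "is_Nd (btree n) \<longleftrightarrow> 0 < n"
  by (cases "n = 0") (simp_all add: btree_pos)

lemma label_tfst_btree [simp]: "label (tfst (btree n)) = of_bool (odd n)"
  by (cases "n = 0") (simp_all add: btree_pos)

lemma tsnd_btree [simp]: "tsnd (btree n) = btree (n div 2)"
  by (cases "n = 0") (simp_all add: btree_pos)

lemma less_exp_length_bits: "n < 2 ^ length (bits n)"
proof (induction n rule: less_induct)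
  case (less n)
  show ?case
  proof (cases "n = 0")
    case False
    then have "n div 2 < 2 ^ length (bits (n div 2))" by (intro less) simp
    then show ?thesis using False by (simp add: bits_pos)
  qed simp
qed

lemma length_bits_le: "n < 2 ^ m \<Longrightarrow> length (bits n) \<le> m"
proof (induction m arbitrary: n)
  case (Suc m)
  show ?case
  proof (cases "n = 0")
    case False
    have "length (bits (n div 2)) \<le> m" by (rule Suc.IH) (use Suc.prems in simp)
    then show ?thesis using False by (simp add: bits_pos)
  qed simp
qed simp

lemma tsize_ltree: "tsize (ltree ts) = 1 + sum_list (map (\<lambda>t. Suc (tsize t)) ts)"
  by (induction ts) auto

lemma tsize_btree: "tsize (btree n) = 2 * length (bits n) + 1"
  by (simp add: btree_def tsize_ltree comp_def sum_list_triv)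

text \<open>The three digits are added in two stages because label functions take two arguments.
  Three bits sum to at most 3, so the caps are inactive on binary numbers.\<close>

definition add_sum :: "tree \<Rightarrow> tree" where
  "add_sum a = At (min 3 (label (At (min 3 (label (tfst (tfst a)) + label (tfst (tfst (tsnd a))))))
     + label (tfst (tsnd (tsnd a)))))"

definition add_emit :: "tree \<Rightarrow> tree" where
  "add_emit a = Nd (tsnd (tfst a)) (Nd (tsnd (tfst (tsnd a)))
     (Nd (At (min 1 (label (add_sum a) div 2))) (Nd (At (label (add_sum a) mod 2)) (tsnd (tsnd (tsnd a))))))"

text \<open>The state consists of the two remaining summands, the carry, and the digits produced so far,
  most significant first.\<close>
definition add_step :: "tree \<Rightarrow> tree" where
  "add_step a = (if is_Nd (tfst a) then add_emit a else if is_Nd (tfst (tsnd a)) then add_emit a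
     else if label (tfst (tsnd (tsnd a))) = 1 then add_emit a else a)"

text \<open>The list that drives the fold matters only through its length: one more than the digits
  of both summands together, which suffices for the digits of the sum. The outer
  \<open>rev_onto\<close> restores the order with the least significant digit first.\<close>

definition tadd :: "tree \<Rightarrow> tree \<Rightarrow> tree" where
  "tadd a b = rev_onto (At 0) (tsnd (tsnd (tsnd
     (foldl (\<lambda>s e. add_step s) (Nd a (Nd b (Nd (At 0) (At 0)))) (tlist (rev_onto (Nd (At 0) a) b))))))"

lemma tlist_rev_onto: "tlist (rev_onto t l) = rev (tlist l) @ tlist t"
proof -
  have "tlist (foldl (\<lambda>a e. Nd e a) t us) = rev us @ tlist t" for us
    by (induction us arbitrary: t) auto
  then show ?thesis by (simp add: rev_onto_def)
qed

lemma add_step_btree: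
  assumes "s = a + b + of_bool c"
  shows "add_step (Nd (btree a) (Nd (btree b) (Nd (At (of_bool c)) r))) =
    (if s = 0 then Nd (At 0) (Nd (At 0) (Nd (At 0) r))
     else Nd (btree (a div 2)) (Nd (btree (b div 2)) (Nd (At (of_bool (2 \<le> of_bool (odd a) + of_bool (odd b) + (of_bool c :: nat))))
       (Nd (At (of_bool (odd s))) r))))"
proof -
  have "add_emit (Nd (btree a) (Nd (btree b) (Nd (At (of_bool c)) r))) =
     Nd (btree (a div 2)) (Nd (btree (b div 2)) (Nd (At (of_bool (2 \<le> of_bool (odd a) + of_bool (odd b) + (of_bool c :: nat))))
       (Nd (At (of_bool (odd s))) r)))"
    unfolding add_emit_def add_sum_def assms by (cases "odd a"; cases "odd b"; cases c) simp_all
  then show ?thesis unfolding add_step_def assms by (cases c) auto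
qed

lemma foldl_add_step:
  "length (bits (a + b + of_bool c)) \<le> length es \<Longrightarrow>
   \<exists>r'. foldl (\<lambda>s e. add_step s) (Nd (btree a) (Nd (btree b) (Nd (At (of_bool c)) r))) es =
      Nd (At 0) (Nd (At 0) (Nd (At 0) r')) \<and>
      rev (tlist r') = rev (tlist r) @ map (\<lambda>b. At (of_bool b)) (bits (a + b + of_bool c))"
proof (induction es arbitrary: a b c r)
  case Nil
  then have "a + b + of_bool c = 0" by (cases "a + b + of_bool c = 0") (simp_all add: bits_pos)
  then show ?case by simp
next
  case (Cons e es)
  show ?case
  proof (cases "a + b + of_bool c = 0")
    case True
    then have "a = 0" "b = 0" "c = False" by auto
    then show ?thesis using Cons.IH[of 0 0 False r] add_step_btree[of 0 0 0 False r] by simp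
  next
    case False
    let ?c = "2 \<le> of_bool (odd a) + of_bool (odd b) + (of_bool c :: nat)"
    let ?s = "a + b + of_bool c"
    have s: "a div 2 + b div 2 + of_bool ?c = ?s div 2"
      by (cases "odd a"; cases "odd b"; cases c) (auto elim!: evenE oddE)
    have bits: "bits ?s = odd ?s # bits (?s div 2)" using False by (intro bits_pos) simp
    then have "length (bits (?s div 2)) \<le> length es" using Cons.prems by simp
    moreover have st: "add_step (Nd (btree a) (Nd (btree b) (Nd (At (of_bool c)) r))) =
        Nd (btree (a div 2)) (Nd (btree (b div 2)) (Nd (At (of_bool ?c)) (Nd (At (of_bool (odd ?s))) r)))"
      unfolding add_step_btree[OF refl] if_not_P[OF False] by (rule refl)
    ultimately show ?thesis
      using Cons.IH[of "a div 2" "b div 2" ?c "Nd (At (of_bool (odd ?s))) r"]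
      unfolding s bits foldl.simps st by simp
  qed
qed

lemma tadd_btree: "tadd (btree a) (btree b) = btree (a + b)"
proof -
  have "a + b < 2 ^ (length (bits a) + length (bits b) + 1)"
  proof -
    have "a < 2 ^ (length (bits a) + length (bits b))" "b < 2 ^ (length (bits a) + length (bits b))"
      using less_exp_length_bits[of a] less_exp_length_bits[of b]
      by (auto elim!: less_le_trans intro!: power_increasing)
    then show ?thesis by simp
  qed
  then have "length (bits (a + b)) \<le> length (tlist (rev_onto (Nd (At 0) (btree a)) (btree b)))"
    using length_bits_le by (simp add: tlist_rev_onto btree_def add.commute)
  from foldl_add_step[of a b False, simplified, OF this, of "At 0"]
  obtain r' where "foldl (\<lambda>s e. add_step s) (Nd (btree a) (Nd (btree b) (Nd (At 0) (At 0))))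
       (tlist (rev_onto (Nd (At 0) (btree a)) (btree b))) = Nd (At 0) (Nd (At 0) (Nd (At 0) r'))"
      "rev (tlist r') = map (\<lambda>b. At (of_bool b)) (bits (a + b))" by auto
  then show ?thesis using rev_onto_ltree[of "[]" r'] by (simp add: tadd_def btree_def)
qed

lemma tsize_foldl_add_step:
  "\<exists>u v w r'. foldl (\<lambda>s e. add_step s) (Nd u0 (Nd v0 (Nd w0 r))) es = Nd u (Nd v (Nd w r')) \<and> tsize r' \<le> tsize r + 2 * length es"
proof (induction es arbitrary: u0 v0 w0 r)
  case (Cons e es)
  let ?a = "Nd u0 (Nd v0 (Nd w0 r))"
  have "add_step ?a = add_emit ?a \<or> add_step ?a = ?a" by (simp add: add_step_def)
  then have "\<exists>u v w r1. add_step ?a = Nd u (Nd v (Nd w r1)) \<and> tsize r1 \<le> tsize r + 2"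
    by (auto simp: add_emit_def)
  then obtain u v w r1 where "add_step ?a = Nd u (Nd v (Nd w r1))" "tsize r1 \<le> tsize r + 2" by blast
  then show ?case using Cons[of u v w r1] by fastforce
qed auto

lemma two_length_tlist: "2 * length (tlist t) + 1 \<le> tsize t"
proof (induction t)
  case (Nd u v)
  then show ?case using tsize_pos[of u] by simp
qed simp

lemma tsize_rev_onto: "tsize (rev_onto t l) \<le> tsize t + tsize l"
proof -
  have "tsize (foldl (\<lambda>a e. Nd e a) t us) = tsize t + sum_list (map (\<lambda>t. Suc (tsize t)) us)" for us
    by (induction us arbitrary: t) auto
  moreover have "sum_list (map (\<lambda>t. Suc (tsize t)) (tlist l)) \<le> tsize l"
    by (induction l) auto
  ultimately show ?thesis by (simp add: rev_onto_def)
qed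

text \<open>The coefficient 1 of \<open>tsize a\<close> is the point: sums accumulated along a list
  meet the growth condition of \<open>ptime_fold\<close>. It holds for all trees, as that condition
  requires.\<close>

lemma tsize_tadd: "tsize (tadd a b) \<le> tsize a + tsize b + 3"
proof -
  let ?es = "tlist (rev_onto (Nd (At 0) a) b)"
  obtain u v w r where r: "foldl (\<lambda>s e. add_step s) (Nd a (Nd b (Nd (At 0) (At 0)))) ?es = Nd u (Nd v (Nd w r))"
      "tsize r \<le> 1 + 2 * length ?es"
    using tsize_foldl_add_step[of a b "At 0" "At 0" ?es] by auto
  have "2 * length ?es \<le> tsize a + tsize b"
    using two_length_tlist[of a] two_length_tlist[of b] by (simp add: tlist_rev_onto)
  then show ?thesis using r tsize_rev_onto[of "At 0" r] by (simp add: tadd_def)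
qed

lemma ptime_add_step: "ptime f \<Longrightarrow> ptime (\<lambda>inp x. add_step (f inp x))"
proof -
  assume f: "ptime f"
  have sum: "ptime (\<lambda>inp x. add_sum (f inp x))" unfolding add_sum_def
    by (rule ptime_at2[where B = 3 and h = "\<lambda>a b. min 3 (a + b)"], simp,
        rule ptime_at2[where B = 3 and h = "\<lambda>a b. min 3 (a + b)"]) (simp | intro ptime_fst ptime_snd f)+
  have "ptime (\<lambda>inp x. At (min 1 (label (add_sum (f inp x)) div 2)))" "ptime (\<lambda>inp x. At (label (add_sum (f inp x)) mod 2))"
    by (rule ptime_at1[where B = 1, OF _ sum]; simp)+
  then have emit: "ptime (\<lambda>inp x. add_emit (f inp x))" unfolding add_emit_def
    by (intro ptime_Nd ptime_fst ptime_snd f)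
  show ?thesis unfolding add_step_def
    by (intro ptime_if_Nd emit ptime_fst ptime_snd f ptime_if_label[where Q = "\<lambda>n. n = 1"])
qed

lemma tsize_add_step: "tsize (add_step a) \<le> tsize a + 8"
proof -
  have "tsize (add_emit a) \<le> tsize a + 8"
    using tsize_tsnd[of "tfst a"] tsize_tsnd[of "tfst (tsnd a)"]
    by (cases a; cases "tsnd a"; cases "tsnd (tsnd a)") (auto simp: add_emit_def)
  then show ?thesis by (simp add: add_step_def)
qed

lemma ptime_tadd:
  assumes "ptime f" "ptime g"
  shows "ptime (\<lambda>inp x. tadd (f inp x) (g inp x))"
proof -
  have "ptime (\<lambda>inp x. foldl (\<lambda>a e. (\<lambda>inp s. add_step (tfst (tsnd s))) inp (Nd x (Nd a e)))
     (Nd (f inp x) (Nd (g inp x) (Nd (At 0) (At 0)))) (tlist (rev_onto (Nd (At 0) (f inp x)) (g inp x))))"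
  proof (rule ptime_fold[where Q = "\<lambda>n. 8"])
    show "tsize (add_step (tfst (tsnd (Nd x (Nd a e))))) \<le> tsize a + 8" for x a e
      using tsize_add_step[of a] by simp
  qed (intro ptime_Nd ptime_fst ptime_snd ptime_id ptime_const ptime_rev_onto ptime_add_step assms polyf_intros)+
  then show ?thesis unfolding tadd_def
    by (intro ptime_rev_onto ptime_snd ptime_const) simp
qed

section \<open>Insertion into tables\<close>

lemma ptime_if_eq:
  "ptime f \<Longrightarrow> ptime g \<Longrightarrow> ptime a \<Longrightarrow> ptime b \<Longrightarrow> ptime (\<lambda>inp x. if f inp x = g inp x then a inp x else b inp x)"
proof -
  have e: "label (At (if u = v then 1 else 0)) = 1 \<longleftrightarrow> u = v" for u v :: tree by simp
  show "ptime f \<Longrightarrow> ptime g \<Longrightarrow> ptime a \<Longrightarrow> ptime b \<Longrightarrow> ?thesis"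
    using ptime_if_label[where Q = "\<lambda>n. n = 1", OF ptime_eq[of f g], of a b] unfolding e .
qed

text \<open>The accumulator pairs a flag, set once \<open>w\<close> has been met, with the entries
  already passed. Tables come out reversed, which is immaterial since their order carries no
  meaning.\<close>

definition ins_step :: "tree \<Rightarrow> tree \<Rightarrow> tree \<Rightarrow> tree \<Rightarrow> tree" where
  "ins_step w c a e = (if label (tfst a) = 1 then Nd (tfst a) (Nd e (tsnd a))
     else if tfst e = w then Nd (At 1) (Nd (Nd w (tadd (tsnd e) c)) (tsnd a))
     else Nd (tfst a) (Nd e (tsnd a)))"

definition tinsert :: "tree \<Rightarrow> tree \<Rightarrow> tree \<Rightarrow> tree" where
  "tinsert t w c = (if label (tfst (foldl (ins_step w c) (Nd (At 0) (At 0)) (tlist t))) = 1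
     then tsnd (foldl (ins_step w c) (Nd (At 0) (At 0)) (tlist t))
     else Nd (Nd w c) (tsnd (foldl (ins_step w c) (Nd (At 0) (At 0)) (tlist t))))"

type_synonym table = "(tree \<times> nat) list"

definition ttree :: "table \<Rightarrow> tree" where
  "ttree tb = ltree (map (\<lambda>(w, n). Nd w (btree n)) tb)"

lemma ttree_simps [simp]: "ttree [] = At 0" "ttree ((w, n) # tb) = Nd (Nd w (btree n)) (ttree tb)"
  by (simp_all add: ttree_def)

lemma ins_step_simps:
  "ins_step w c (Nd (At 1) t) e = Nd (At 1) (Nd e t)"
  "v \<noteq> w \<Longrightarrow> ins_step w c (Nd (At 0) t) (Nd v u) = Nd (At 0) (Nd (Nd v u) t)"
  "ins_step w c (Nd (At 0) t) (Nd w u) = Nd (At 1) (Nd (Nd w (tadd u c)) t)"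
  by (simp_all add: ins_step_def)

lemma foldl_ins_step_found:
  "foldl (ins_step w c) (Nd (At 1) (ttree out)) (map (\<lambda>(w, n). Nd w (btree n)) tb) = Nd (At 1) (ttree (rev tb @ out))"
proof (induction tb arbitrary: out)
  case (Cons p tb)
  obtain v n where "p = (v, n)" by fastforce
  then show ?case using Cons[of "(v, n) # out"] by (simp add: ins_step_simps[simplified])
qed simp

lemma foldl_ins_step_absent:
  "w \<notin> fst ` set tb \<Longrightarrow> foldl (ins_step w c) (Nd (At 0) (ttree out)) (map (\<lambda>(w, n). Nd w (btree n)) tb) = Nd (At 0) (ttree (rev tb @ out))"
proof (induction tb arbitrary: out)
  case (Cons p tb)
  obtain v n where "p = (v, n)" by fastforce
  then show ?case using Cons.IH[of "(v, n) # out"] Cons.prems by (auto simp: ins_step_simps)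
qed simp

definition weigh :: "(tree \<Rightarrow> nat) \<Rightarrow> table \<Rightarrow> nat" where
  "weigh F tb = sum_list (map (\<lambda>(w, n). n * F w) tb)"

lemma weigh_simps [simp]: "weigh F [] = 0" "weigh F ((w, n) # tb) = n * F w + weigh F tb"
  "weigh F (tb @ tb') = weigh F tb + weigh F tb'" "weigh F (rev tb) = weigh F tb"
  by (simp_all add: weigh_def sum_list_rev rev_map[symmetric])

lemma tinsert_ttree:
  assumes "distinct (map fst tb)"
  shows "\<exists>tb'. tinsert (ttree tb) w (btree n) = ttree tb' \<and> distinct (map fst tb') \<and>
    fst ` set tb' = insert w (fst ` set tb) \<and> (\<forall>F. weigh F tb' = weigh F tb + n * F w)"
proof (cases "w \<in> fst ` set tb")
  case False
  have "tinsert (ttree tb) w (btree n) = ttree ((w, n) # rev tb)"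
    using foldl_ins_step_absent[OF False, of "btree n" "[]"] by (simp add: tinsert_def) (simp add: ttree_def)
  then show ?thesis using False assms
    by (intro exI[of _ "(w, n) # rev tb"]) (auto simp: rev_map[symmetric])
next
  case True
  then obtain m where "(w, m) \<in> set tb" by force
  then obtain p s where tb: "tb = p @ (w, m) # s" by (meson split_list)
  then have w: "w \<notin> fst ` set p" using assms by auto
  have "foldl (ins_step w (btree n)) (Nd (At 0) (ttree [])) (tlist (ttree tb)) =
      Nd (At 1) (ttree (rev s @ (w, m + n) # rev p))"
    using foldl_ins_step_absent[OF w, of "btree n" "[]"] foldl_ins_step_found[of w "btree n" "(w, m + n) # rev p" s]
    by (simp add: ttree_def tb ins_step_simps[simplified] tadd_btree)
  then have "tinsert (ttree tb) w (btree n) = ttree (rev s @ (w, m + n) # rev p)"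
    by (simp add: tinsert_def)
  then show ?thesis using assms
    by (intro exI[of _ "rev s @ (w, m + n) # rev p"]) (auto simp: tb rev_map[symmetric] algebra_simps)
qed

lemma tsize_split: "tsize (tfst a) + tsize (tsnd a) \<le> tsize a + 1"
  by (cases a) auto

lemma sum_tsize_tlist: "sum_list (map (\<lambda>e. tsize e + 1) (tlist t)) \<le> tsize t"
  by (induction t) auto

lemma tsize_tinsert: "tsize (tinsert t w c) \<le> tsize t + tsize w + tsize c + 10"
proof -
  \<comment> \<open>A potential: only one entry can grow through an addition, and while the flag is
    not set this growth is paid for in advance.\<close>
  let ?pot = "\<lambda>a. if label (tfst a) = 1 then 0 else tsize c + 5"
  have step: "tsize (tsnd (ins_step w c a e)) + ?pot (ins_step w c a e) \<le> tsize (tsnd a) + ?pot a + tsize e + 1" for a e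
    using tsize_tadd[of "tsnd e" c] by (cases e) (auto simp: ins_step_def)
  have "tsize (tsnd (foldl (ins_step w c) a es)) + ?pot (foldl (ins_step w c) a es)
      \<le> tsize (tsnd a) + ?pot a + sum_list (map (\<lambda>e. tsize e + 1) es)" for a es
  proof (induction es arbitrary: a)
    case (Cons e es)
    show ?case using Cons[of "ins_step w c a e"] step[of a e] by simp
  qed simp
  from this[of "Nd (At 0) (At 0)" "tlist t"] sum_tsize_tlist[of t]
  show ?thesis unfolding tinsert_def by (simp split: if_splits)
qed

lemma ptime_tinsert:
  assumes "ptime f" "ptime g" "ptime h"
  shows "ptime (\<lambda>inp x. tinsert (f inp x) (g inp x) (h inp x))"
proof -
  let ?g = "\<lambda>(inp :: nat \<Rightarrow> nat) s. ins_step (tfst (tsnd (tfst s))) (tsnd (tsnd (tfst s))) (tfst (tsnd s)) (tsnd (tsnd s))"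
  have "ptime (\<lambda>inp x. foldl (\<lambda>a e. ?g inp (Nd x (Nd a e))) (Nd (At 0) (At 0)) (tlist (tfst x)))"
  proof (rule ptime_fold[where Q = "\<lambda>n. 3 * n + 20"])
    show "ptime ?g" unfolding ins_step_def
      by (intro ptime_if_label[where Q = "\<lambda>n. n = 1"] ptime_if_eq ptime_Nd ptime_tadd ptime_fst ptime_snd ptime_id ptime_const)
    show "tsize (?g inp (Nd x (Nd a e))) \<le> tsize a + (3 * (tsize x + tsize e) + 20)" for inp x a e
    proof -
      have "tsize (tsnd e) \<le> tsize e" "tsize (tfst (tsnd x)) \<le> tsize x" "tsize (tsnd (tsnd x)) \<le> tsize x"
        by (meson tsize_tfst tsize_tsnd le_trans)+
      then show ?thesis
        using tsize_split[of a] tsize_tadd[of "tsnd e" "tsnd (tsnd x)"] by (simp add: ins_step_def)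
    qed
  qed (intro ptime_fst ptime_id ptime_const polyf_intros)+
  then have fold: "ptime (\<lambda>inp x. foldl (ins_step (tfst (tsnd x)) (tsnd (tsnd x))) (Nd (At 0) (At 0)) (tlist (tfst x)))"
    by simp
  have "ptime (\<lambda>inp x. tinsert (tfst x) (tfst (tsnd x)) (tsnd (tsnd x)))"
    unfolding tinsert_def
    by (intro ptime_if_label[where Q = "\<lambda>n. n = 1"] ptime_Nd ptime_fst ptime_snd fold ptime_id)
  from ptime_comp[OF this ptime_Nd[OF assms(1) ptime_Nd[OF assms(2,3)]]] show ?thesis by simp
qed

section \<open>One round of the simulation\<close>

lemma ptime_size: "ptime f \<Longrightarrow> \<exists>P. polyf P \<and> (\<forall>inp x. valid_inp inp \<longrightarrow> tsize (f inp x) \<le> P (tsize x))"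
  unfolding ptime_def realizes_def by blast

text \<open>A halted configuration is its own successor, so accepting paths are still counted in
  whatever round the loop stops. Branching occurs only when the choice head enters a new cell;
  otherwise the bit under it is kept.\<close>

definition tree_succs :: "machine \<Rightarrow> (nat \<Rightarrow> nat) \<Rightarrow> tree \<Rightarrow> tree list" where
  "tree_succs M inp w = (if tree_halted M w then [w]
     else if tree_branches M inp w then [tree_next M inp (At 0) w, tree_next M inp (At 1) w]
     else [tree_next M inp (t_bit w) w])"

definition spread :: "machine \<Rightarrow> (nat \<Rightarrow> nat) \<Rightarrow> tree \<Rightarrow> tree \<Rightarrow> tree" where
  "spread M inp t e = foldl (\<lambda>a w. tinsert a w (tsnd e)) t (tree_succs M inp (tfst e))"

text \<open>Starting the next table from the old keys with multiplicity 0 is what remembers the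
  configurations seen, so the length of the table can be used in the stopping test.\<close>

definition zero_table :: "tree \<Rightarrow> tree" where
  "zero_table t = foldl (\<lambda>a e. Nd (Nd (tfst e) (At 0)) a) (At 0) (tlist t)"

definition advance :: "machine \<Rightarrow> (nat \<Rightarrow> nat) \<Rightarrow> tree \<Rightarrow> tree" where
  "advance M inp t = foldl (spread M inp) (zero_table t) (tlist t)"

definition accepted :: "machine \<Rightarrow> tree \<Rightarrow> tree" where
  "accepted M t = foldl (\<lambda>a e. if label (t_state (tfst e)) = acc M then tadd a (tsnd e) else a) (At 0) (tlist t)"

lemma ptime_spread:
  assumes "ptime f" "ptime g"
  shows "ptime (\<lambda>inp x. spread M inp (f inp x) (g inp x))"
proof -
  note g = ptime_fst[OF assms(2)]
  have "spread M inp t e = (if label (t_state (tfst e)) = acc M then tinsert t (tfst e) (tsnd e)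
     else if label (t_state (tfst e)) = rej M then tinsert t (tfst e) (tsnd e)
     else if tree_branches M inp (tfst e)
       then tinsert (tinsert t (tree_next M inp (At 0) (tfst e)) (tsnd e)) (tree_next M inp (At 1) (tfst e)) (tsnd e)
       else tinsert t (tree_next M inp (t_bit (tfst e)) (tfst e)) (tsnd e))" for inp t e
    by (simp add: spread_def tree_succs_def tree_halted_def)
  then show ?thesis
    by (simp only: tree_branches_def) (intro ptime_if_label[where Q = "\<lambda>n. n = acc M"] ptime_if_label[where Q = "\<lambda>n. n = rej M"]
        ptime_if_label[where Q = "\<lambda>n. snd (snd (snd (decoded M n))) = 1"]
        ptime_tinsert ptime_tree_next ptime_scan_code ptime_t ptime_const ptime_snd g assms)
qed

lemma ptime_zero_table: "ptime f \<Longrightarrow> ptime (\<lambda>inp x. zero_table (f inp x))"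
proof -
  assume f: "ptime f"
  have "ptime (\<lambda>inp x. foldl (\<lambda>a e. (\<lambda>inp s. Nd (Nd (tfst (tsnd (tsnd s))) (At 0)) (tfst (tsnd s))) inp (Nd x (Nd a e)))
     (At 0) (tlist (f inp x)))"
  proof (rule ptime_fold[where Q = "\<lambda>n. n + 3"])
    show "tsize ((\<lambda>inp s. Nd (Nd (tfst (tsnd (tsnd s))) (At 0)) (tfst (tsnd s))) inp (Nd x (Nd a e)))
      \<le> tsize a + (tsize x + tsize e + 3)" for inp :: "nat \<Rightarrow> nat" and x a e
      using tsize_tfst[of e] by simp
  qed (intro ptime_Nd ptime_fst ptime_snd ptime_id ptime_const f polyf_intros)+
  then show ?thesis by (simp add: zero_table_def)
qed

lemma ptime_advance:
  assumes f: "ptime f"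
  shows "ptime (\<lambda>inp x. advance M inp (f inp x))"
proof -
  let ?g = "\<lambda>inp s. spread M inp (tfst (tsnd s)) (tsnd (tsnd s))"
  \<comment> \<open>All possible successors are bundled into one tree to obtain a single polynomial
    for their sizes.\<close>
  have "ptime (\<lambda>inp e. Nd (tree_next M inp (At 0) e) (Nd (tree_next M inp (At 1) e) (tree_next M inp (t_bit e) e)))"
    by (intro ptime_Nd ptime_tree_next ptime_t ptime_const ptime_id)
  from ptime_size[OF this] obtain P where P: "polyf P" and P': "\<And>inp e. valid_inp inp \<Longrightarrow>
      tsize (Nd (tree_next M inp (At 0) e) (Nd (tree_next M inp (At 1) e) (tree_next M inp (t_bit e) e))) \<le> P (tsize e)"
    by blast
  have "ptime (\<lambda>inp x. foldl (\<lambda>a e. ?g inp (Nd x (Nd a e))) (zero_table (f inp x)) (tlist (f inp x)))"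
  proof (rule ptime_fold[where Q = "\<lambda>n. 2 * P n + 3 * n + 30"])
    show "polyf (\<lambda>n. 2 * P n + 3 * n + 30)" by (intro polyf_intros P)
    fix inp x a e assume v: "valid_inp inp"
    have "P (tsize (tfst e)) \<le> P (tsize x + tsize e)"
      by (rule polyf_mono[OF P]) (use tsize_tfst[of e] in simp)
    then have n: "tsize (tree_next M inp b (tfst e)) \<le> P (tsize x + tsize e)" if "b \<in> {At 0, At 1, t_bit (tfst e)}" for b
      using P'[OF v, of "tfst e"] that by auto
    have "tsize (spread M inp a e) \<le> tsize a + 2 * P (tsize x + tsize e) + tsize (tfst e) + 2 * tsize (tsnd e) + 20"
    proof -
      note ti = tsize_tinsert[of a _ "tsnd e"]
      show ?thesis
        using ti[of "tfst e"] ti[of "tree_next M inp (t_bit (tfst e)) (tfst e)"]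
          ti[of "tree_next M inp (At 0) (tfst e)"] n[of "At 0"] n[of "At 1"] n[of "t_bit (tfst e)"]
          tsize_tinsert[of "tinsert a (tree_next M inp (At 0) (tfst e)) (tsnd e)" "tree_next M inp (At 1) (tfst e)" "tsnd e"]
        by (simp add: spread_def tree_succs_def)
    qed
    then show "tsize (?g inp (Nd x (Nd a e))) \<le> tsize a + (2 * P (tsize x + tsize e) + 3 * (tsize x + tsize e) + 30)"
      using tsize_tfst[of e] tsize_tsnd[of e] by simp
  qed (intro ptime_spread ptime_zero_table ptime_fst ptime_snd ptime_id f)+
  then show ?thesis by (simp add: advance_def)
qed

lemma ptime_accepted:
  assumes f: "ptime f"
  shows "ptime (\<lambda>inp x. accepted M (f inp x))"
proof -
  let ?g = "\<lambda>(inp :: nat \<Rightarrow> nat) s. if label (t_state (tfst (tsnd (tsnd s)))) = acc M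
      then tadd (tfst (tsnd s)) (tsnd (tsnd (tsnd s))) else tfst (tsnd s)"
  have "ptime (\<lambda>inp x. foldl (\<lambda>a e. ?g inp (Nd x (Nd a e))) (At 0) (tlist (f inp x)))"
  proof (rule ptime_fold[where Q = "\<lambda>n. n + 3"])
    show "tsize (?g inp (Nd x (Nd a e))) \<le> tsize a + (tsize x + tsize e + 3)" for inp :: "nat \<Rightarrow> nat" and x a e
      using tsize_tadd[of a "tsnd e"] tsize_tsnd[of e] by simp
  qed (intro ptime_if_label[where Q = "\<lambda>n. n = acc M"] ptime_t ptime_tadd ptime_fst ptime_snd ptime_id ptime_const f polyf_intros)+
  then show ?thesis by (simp add: accepted_def cong del: if_weak_cong)
qed

text \<open>Testing against all weight functions expresses equality of multisets, with entries of
  multiplicity 0 invisible, and turns every table update into a linear identity.\<close>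

definition represents :: "table \<Rightarrow> tree list \<Rightarrow> bool" where
  "represents tb zs \<longleftrightarrow> (\<forall>F. weigh F tb = sum_list (map F zs))"

lemma spread_ttree:
  assumes "distinct (map fst tb)"
  shows "\<exists>tb'. foldl (\<lambda>a w. tinsert a w (btree n)) (ttree tb) ws = ttree tb' \<and> distinct (map fst tb') \<and>
    fst ` set tb' = fst ` set tb \<union> set ws \<and> (\<forall>F. weigh F tb' = weigh F tb + n * sum_list (map F ws))"
  using assms
proof (induction ws arbitrary: tb)
  case (Cons w ws)
  obtain tb1 where 1: "tinsert (ttree tb) w (btree n) = ttree tb1" "distinct (map fst tb1)"
    "fst ` set tb1 = insert w (fst ` set tb)" "\<forall>F. weigh F tb1 = weigh F tb + n * F w"
    using tinsert_ttree[OF Cons.prems, of w n] by blast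
  obtain tb2 where "foldl (\<lambda>a w. tinsert a w (btree n)) (ttree tb1) ws = ttree tb2" "distinct (map fst tb2)"
    "fst ` set tb2 = fst ` set tb1 \<union> set ws" "\<forall>F. weigh F tb2 = weigh F tb1 + n * sum_list (map F ws)"
    using Cons.IH[OF 1(2)] by blast
  then show ?case using 1 by (intro exI[of _ tb2]) (auto simp: algebra_simps)
qed (auto intro: exI[of _ tb])

lemma advance_ttree:
  assumes d: "distinct (map fst tb)" and r: "represents tb zs"
  shows "\<exists>tb'. advance M inp (ttree tb) = ttree tb' \<and> distinct (map fst tb') \<and>
    fst ` set tb' = fst ` set tb \<union> (\<Union>w\<in>fst ` set tb. set (tree_succs M inp w)) \<and>
    represents tb' (concat (map (tree_succs M inp) zs))"
proof -
  have "foldl (\<lambda>a e. Nd (Nd (tfst e) (At 0)) a) (ttree tb0) (map (\<lambda>(w, n). Nd w (btree n)) tb1) =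
      ttree (rev (map (\<lambda>(w, n). (w, 0)) tb1) @ tb0)" for tb0 tb1
  proof (induction tb1 arbitrary: tb0)
    case (Cons p tb1)
    obtain v n where "p = (v, n)" by fastforce
    then show ?case using Cons[of "(v, 0) # tb0"] by simp
  qed simp
  from this[of "[]" tb] have z: "zero_table (ttree tb) = ttree (rev (map (\<lambda>(w, n). (w, 0)) tb))"
    by (simp add: zero_table_def) (simp add: ttree_def)
  \<comment> \<open>Dual form of a round: testing the new table with \<open>F\<close> amounts to
    testing the old one with the sum of \<open>F\<close> over the successors. Since \<open>F\<close>
    is universally quantified, \<open>represents\<close> can be instantiated with that sum.\<close>
  have fold: "\<exists>tb'. foldl (spread M inp) (ttree tb0) (map (\<lambda>(w, n). Nd w (btree n)) tb1) = ttree tb' \<and> distinct (map fst tb') \<and>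
     fst ` set tb' = fst ` set tb0 \<union> (\<Union>w\<in>fst ` set tb1. set (tree_succs M inp w)) \<and>
     (\<forall>F. weigh F tb' = weigh F tb0 + weigh (\<lambda>w. sum_list (map F (tree_succs M inp w))) tb1)"
    if "distinct (map fst tb0)" for tb0 tb1
    using that
  proof (induction tb1 arbitrary: tb0)
    case (Cons p tb1)
    obtain v n where p: "p = (v, n)" by fastforce
    obtain tb2 where 2: "foldl (\<lambda>a w. tinsert a w (btree n)) (ttree tb0) (tree_succs M inp v) = ttree tb2"
      "distinct (map fst tb2)" "fst ` set tb2 = fst ` set tb0 \<union> set (tree_succs M inp v)"
      "\<forall>F. weigh F tb2 = weigh F tb0 + n * sum_list (map F (tree_succs M inp v))"
      using spread_ttree[OF Cons.prems, of n "tree_succs M inp v"] by blast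
    obtain tb3 where 3: "foldl (spread M inp) (ttree tb2) (map (\<lambda>(w, n). Nd w (btree n)) tb1) = ttree tb3" "distinct (map fst tb3)"
     "fst ` set tb3 = fst ` set tb2 \<union> (\<Union>w\<in>fst ` set tb1. set (tree_succs M inp w))"
     "\<forall>F. weigh F tb3 = weigh F tb2 + weigh (\<lambda>w. sum_list (map F (tree_succs M inp w))) tb1"
      using Cons.IH[OF 2(2)] by blast
    have "spread M inp (ttree tb0) (Nd v (btree n)) = ttree tb2" using 2(1) by (simp add: spread_def)
    then show ?case using 2 3 p by (intro exI[of _ tb3]) auto
  qed (auto intro: exI[of _ tb0])
  have d0: "distinct (map fst (rev (map (\<lambda>(w, n). (w, 0::nat)) tb)))"
    using d by (simp add: rev_map[symmetric] comp_def split_def)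
  have w0: "weigh F (rev (map (\<lambda>(w, n). (w, 0)) tb)) = 0" for F
    by (simp, induction tb) auto
  have f0: "fst ` set (rev (map (\<lambda>(w, n). (w, 0::nat)) tb)) = fst ` set tb" by force
  have sc: "sum_list (map F (concat (map (tree_succs M inp) zs))) = sum_list (map (\<lambda>w. sum_list (map F (tree_succs M inp w))) zs)" for F :: "tree \<Rightarrow> nat"
    by (induction zs) auto
  obtain tb' where "foldl (spread M inp) (ttree (rev (map (\<lambda>(w, n). (w, 0)) tb))) (map (\<lambda>(w, n). Nd w (btree n)) tb) = ttree tb'"
     "distinct (map fst tb')" "fst ` set tb' = fst ` set tb \<union> (\<Union>w\<in>fst ` set tb. set (tree_succs M inp w))"
     "\<forall>F. weigh F tb' = weigh (\<lambda>w. sum_list (map F (tree_succs M inp w))) tb"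
    using fold[OF d0, of tb] unfolding f0 w0 by auto
  moreover have "tlist (ttree tb) = map (\<lambda>(w, n). Nd w (btree n)) tb" by (simp add: ttree_def)
  ultimately show ?thesis using r
    by (intro exI[of _ tb']) (simp add: advance_def z represents_def sc)
qed

lemma accepted_ttree:
  "accepted M (ttree tb) = btree (weigh (\<lambda>w. if label (t_state w) = acc M then 1 else 0) tb)"
proof -
  have "foldl (\<lambda>a e. if label (t_state (tfst e)) = acc M then tadd a (tsnd e) else a) (btree m)
     (map (\<lambda>(w, n). Nd w (btree n)) tb) = btree (m + weigh (\<lambda>w. if label (t_state w) = acc M then 1 else 0) tb)" for m
  proof (induction tb arbitrary: m)
    case (Cons p tb)
    obtain v n where "p = (v, n)" by fastforce
    then show ?case using Cons by (simp add: tadd_btree ac_simps)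
  qed simp
  from this[of 0] show ?thesis by (simp add: accepted_def ttree_def)
qed

section \<open>Computation paths\<close>

lemma choice_of_append: "p \<le> length w \<Longrightarrow> choice_of (w @ v) p = choice_of w p"
  by (auto simp: choice_of_def nth_append)

lemma choice_of_take: "p \<le> h \<Longrightarrow> choice_of (take h w) p = choice_of w p"
  by (auto simp: choice_of_def)

locale bounded_machine =
  fixes M :: machine and x :: "bool list" and k G :: nat
  assumes wf: "wf_machine M"
    and mono: "\<And>c n. chead (run M x k c n) \<le> chead (run M x k c (Suc n))"
    and bound: "\<And>c n. chead (run M x k c n) \<le> G"
begin

abbreviation "inp \<equiv> input_sym x k"
abbreviation "rn \<equiv> run M x k"
abbreviation "tr \<equiv> trace M x k"
abbreviation "pos c n \<equiv> chead (rn c n)"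

definition advances :: "zconfig \<Rightarrow> bool" where
  "advances z \<longleftrightarrow> \<not> zhalted M z \<and> zmove M inp z = 1"

lemma pos_mono: "m \<le> n \<Longrightarrow> pos c m \<le> pos c n"
  by (rule lift_Suc_mono_le[of "pos c"]) (use mono in auto)

lemma rn_eq: "rn c n = conf_of (tr c n) (pos c n)"
  and tr_bit: "fst (snd (tr c n)) = c (pos c n)"
  and wf_tr: "wf_zconfig M (tr c n)"
  using trace_correct[OF wf] by blast+

lemma rn_halted: "zhalted M (tr c n) \<Longrightarrow> rn c (Suc n) = rn c n"
  using halted_trace[OF wf, of x k c n] by (simp add: run_Suc step_def)

text \<open>A left move would contradict monotonicity except at cell 0, where \<open>move\<close>
  truncates and the head stays. So the head advances precisely on move 1.\<close>

lemma pos_Suc: "pos c (Suc n) = pos c n + of_bool (advances (tr c n))"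
proof (cases "zhalted M (tr c n)")
  case False
  obtain q' wr mv cm where d: "zdelta M inp (tr c n) = (q', wr, mv, cm)" by (metis prod_cases4)
  then have "zmove M inp (tr c n) \<in> {-1, 0, 1}"
    using zdelta_wf(6)[OF wf wf_tr valid_input_sym d] by (simp add: zmove_def)
  moreover have "pos c (Suc n) = move (pos c n) (zmove M inp (tr c n))" by (rule chead_Suc[OF wf False])
  ultimately show ?thesis using mono[of c n] False by (auto simp: advances_def move_def)
qed (simp add: rn_halted advances_def)

text \<open>As the head never turns back, the first \<open>n\<close> steps have seen only cells up
  to \<open>pos c n\<close>. The following step is determined too, but only for the run: the trace
  at \<open>Suc n\<close> also contains the bit of a possibly new cell.\<close>

lemma agree:
  assumes "\<And>p. p \<le> pos c n \<Longrightarrow> c p = c' p"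
  shows "m \<le> n \<Longrightarrow> rn c' m = rn c m \<and> tr c' m = tr c m"
    and "rn c' (Suc n) = rn c (Suc n)"
proof -
  have step: "rn c' (Suc m) = rn c (Suc m)" if "rn c' m = rn c m" "m \<le> n" for m
    using assms[of "pos c m"] that pos_mono[of m n c] by (simp add: run_Suc step_def)
  show main: "rn c' m = rn c m \<and> tr c' m = tr c m" if "m \<le> n" for m
    using that
  proof (induction m)
    case 0
    have "pos c 0 = 0" by (simp add: run_def init_config_def)
    then show ?case using assms[of 0] by (simp add: run_def)
  next
    case (Suc m)
    then show ?case using step[of m] assms[of "pos c (Suc m)"] pos_mono[of "Suc m" n c] by simp
  qed
  show "rn c' (Suc n) = rn c (Suc n)" using step[of n] main[of n] by simp
qed

text \<open>Only the cells strictly ahead of the heads have to agree, because the bit under the head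
  belongs to the configuration. The two heads keep a constant distance, stated additively to avoid
  subtraction.\<close>

lemma shift:
  assumes "tr c m = tr c' m'" "\<And>q. 0 < q \<Longrightarrow> c (pos c m + q) = c' (pos c' m' + q)"
  shows "tr c (m + s) = tr c' (m' + s) \<and> pos c (m + s) + pos c' m' = pos c' (m' + s) + pos c m"
proof (induction s)
  case 0
  show ?case using assms(1) by simp
next
  case (Suc s)
  then have z: "tr c (m + s) = tr c' (m' + s)" by simp
  have p: "pos c (m + Suc s) + pos c' m' = pos c' (m' + Suc s) + pos c m"
    using Suc pos_Suc[of c "m + s"] pos_Suc[of c' "m' + s"] by simp
  define q where "q = pos c (m + Suc s) - pos c m"
  have q: "pos c (m + Suc s) = pos c m + q" "pos c' (m' + Suc s) = pos c' m' + q"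
    using p pos_mono[of m "m + Suc s" c] by (auto simp: q_def)
  have "c (pos c (m + Suc s)) = c' (pos c' (m' + Suc s))"
  proof (cases "q = 0")
    case True
    then show ?thesis using q assms(1) tr_bit[of c m] tr_bit[of c' m'] by simp
  qed (use q assms(2)[of q] in simp)
  then have "tr c (m + Suc s) = tr c' (m' + Suc s)" using z by simp
  then show ?case using p by blast
qed

lemma halted_stays: "zhalted M (tr c n) \<Longrightarrow> n \<le> m \<Longrightarrow> tr c m = tr c n \<and> pos c m = pos c n"
proof (induction m)
  case (Suc m)
  then show ?case by (cases "n = Suc m") (auto simp: rn_halted le_Suc_eq)
qed simp

text \<open>A repeated configuration either pumps the choice head beyond every bound or belongs to a
  deterministic infinite loop.\<close>
lemma no_repetition:
  assumes rep: "tr c i = tr c j" "i < j" and acc: "fst (tr c n) = acc M"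
  shows "fst (tr c i) = acc M"
proof -
  let ?hi = "pos c i" and ?D = "pos c j - pos c i" and ?T = "j - i"
  \<comment> \<open>Beyond \<open>?hi\<close> the bits read between times \<open>i\<close> and
    \<open>j\<close> are repeated periodically; up to \<open>pos c j\<close> this agrees with
    \<open>c\<close>. If \<open>?D = 0\<close>, then \<open>mod 0\<close> is the identity and
    \<open>c' = c\<close>, so one definition serves both the pumping and the deterministic
    loop.\<close>
  define c' where "c' p = (if p \<le> ?hi then c p else c (?hi + 1 + (p - ?hi - 1) mod ?D))" for p
  have hij: "?hi \<le> pos c j" using pos_mono rep(2) by simp
  have "c p = c' p" if "p \<le> pos c j" for p
    using that hij by (auto simp: c'_def)
  from agree(1)[of c j c', OF this] have same: "rn c' m = rn c m \<and> tr c' m = tr c m" if "m \<le> j" for m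
    using that by blast
  have "c' (?hi + q) = c' (pos c j + q)" if "0 < q" for q
  proof -
    have "(pos c j + q - ?hi - 1) mod ?D = (?D + (q - 1)) mod ?D" using that hij by (intro arg_cong[of _ _ "\<lambda>a. a mod ?D"]) simp
    also have "\<dots> = (q - 1) mod ?D" by simp
    finally show ?thesis using that hij by (simp add: c'_def)
  qed
  then have per: "tr c' (i + s) = tr c' (j + s) \<and> pos c' (i + s) + pos c j = pos c' (j + s) + ?hi" for s
    using shift[of c' i c' j s] same[of i] same[of j] rep by simp
  have T: "j + s = i + (?T + s)" for s using rep(2) by simp
  have pump: "tr c' (i + m * ?T) = tr c' i \<and> pos c' (i + m * ?T) = ?hi + m * ?D" for m
  proof (induction m)
    case 0
    then show ?case using same[of i] rep by simp
  next
    case (Suc m)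
    have "i + Suc m * ?T = j + m * ?T" using rep(2) by simp
    then show ?case using per[of "m * ?T"] Suc hij by simp
  qed
  have "?D = 0"
  proof (rule ccontr)
    assume "?D \<noteq> 0"
    then have "Suc G * 1 \<le> Suc G * ?D" by (intro mult_le_mono2) simp
    then have "Suc G \<le> ?hi + Suc G * ?D" by (simp only: mult_1_right trans_le_add2)
    then show False using pump[of "Suc G"] bound[of c' "i + Suc G * ?T"] by (metis Suc_n_not_le_n le_trans)
  qed
  then have "c' = c" using hij by (auto simp: c'_def fun_eq_iff)
  \<comment> \<open>After \<open>n\<close> periods at least \<open>n\<close> steps have passed, so
    the run has already halted there; yet it is back in the configuration of time
    \<open>i\<close>.\<close>
  then have loop: "tr c (i + n * ?T) = tr c i" using pump by simp
  have "n * 1 \<le> n * ?T" using rep(2) by (intro mult_le_mono2) simp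
  then have "n \<le> n * ?T" by simp
  then have "tr c (i + n * ?T) = tr c n"
    using halted_stays[of c n "i + n * ?T"] acc by (simp add: zhalted_def trans_le_add2)
  then show ?thesis using loop acc by simp
qed

section \<open>Enumeration of the choice words\<close>

definition extensions :: "nat \<Rightarrow> bool list \<Rightarrow> bool list list" where
  "extensions t w = (if advances (tr (choice_of w) t) then [w @ [False], w @ [True]] else [w])"

primrec paths :: "nat \<Rightarrow> bool list list" where
  "paths 0 = [[]]"
| "paths (Suc t) = concat (map (extensions t) (paths t))"

lemma run_extension:
  assumes "pos (choice_of w) t = length w"
  shows "m \<le> t \<Longrightarrow> rn (choice_of (w @ v)) m = rn (choice_of w) m \<and> tr (choice_of (w @ v)) m = tr (choice_of w) m"
    and "rn (choice_of (w @ v)) (Suc t) = rn (choice_of w) (Suc t)"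
  using agree[of "choice_of w" t "choice_of (w @ v)"] assms choice_of_append[of _ w v] by auto

lemma run_take:
  assumes "h = pos (choice_of w) t"
  shows "m \<le> t \<Longrightarrow> rn (choice_of (take h w)) m = rn (choice_of w) m \<and> tr (choice_of (take h w)) m = tr (choice_of w) m"
  using agree(1)[of "choice_of w" t "choice_of (take h w)"] assms choice_of_take[of _ h w] by auto

text \<open>\<open>choice_of w\<close> pads \<open>w\<close> with \<open>False\<close>, but the
  padding is not scanned up to time \<open>t\<close> if the head is at the end of \<open>w\<close>.
  Conversely, cutting a word at an earlier head position yields the path at that earlier
  time.\<close>

lemma mem_paths: "w \<in> set (paths t) \<longleftrightarrow> pos (choice_of w) t = length w"
proof (induction t arbitrary: w)
  case 0
  then show ?case by (auto simp: run_def init_config_def)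
next
  case (Suc t)
  show ?case
  proof
    assume "w \<in> set (paths (Suc t))"
    then obtain v where v: "v \<in> set (paths t)" "w \<in> set (extensions t v)" by auto
    then have pv: "pos (choice_of v) t = length v" using Suc by simp
    show "pos (choice_of w) (Suc t) = length w"
    proof (cases "advances (tr (choice_of v) t)")
      case True
      then obtain b where "w = v @ [b]" using v(2) by (auto simp: extensions_def)
      then show ?thesis using run_extension(2)[OF pv, of "[b]"] pos_Suc[of "choice_of v" t] pv True by simp
    next
      case False
      then show ?thesis using v(2) pv pos_Suc[of "choice_of v" t] by (simp add: extensions_def)
    qed
  next
    assume w: "pos (choice_of w) (Suc t) = length w"
    define h where "h = pos (choice_of w) t"
    define v where "v = take h w"
    have h: "h \<le> length w" using w mono[of "choice_of w" t] by (simp add: h_def)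
    have rv: "rn (choice_of v) t = rn (choice_of w) t" "tr (choice_of v) t = tr (choice_of w) t"
      using run_take[OF h_def, of t] by (simp_all add: v_def)
    then have "v \<in> set (paths t)" using Suc h by (simp add: h_def[symmetric]) (simp add: v_def)
    moreover have "w \<in> set (extensions t v)"
    proof (cases "advances (tr (choice_of w) t)")
      case True
      then have "length w = Suc h" using w pos_Suc[of "choice_of w" t] by (simp add: h_def)
      then have "w = v @ [w ! h]" by (simp add: v_def take_Suc_conv_app_nth[symmetric])
      then show ?thesis using True rv(2) by (cases "w ! h") (auto simp: extensions_def)
    next
      case False
      then have "length w = h" using w pos_Suc[of "choice_of w" t] by (simp add: h_def)
      then show ?thesis using False rv(2) by (simp add: extensions_def v_def)
    qed
    ultimately show "w \<in> set (paths (Suc t))" by auto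
  qed
qed

text \<open>The parent is recovered by cutting at the head position of time \<open>t\<close>, so
  different paths have disjoint lists of extensions and no word is enumerated twice.\<close>

lemma extension_parent:
  assumes "v \<in> set (paths t)" "w \<in> set (extensions t v)"
  shows "v = take (pos (choice_of w) t) w"
proof -
  have "pos (choice_of v) t = length v" using assms(1) mem_paths by blast
  then show ?thesis using assms(2) run_extension(1)[of v t t] by (auto simp: extensions_def split: if_splits)
qed

lemma distinct_paths: "distinct (paths t)"
proof (induction t)
  case (Suc t)
  have ne: "set (extensions t w) \<noteq> {}" for w by (simp add: extensions_def)
  show ?case unfolding paths.simps
  proof (rule distinct_concat)
    show "distinct (map (extensions t) (paths t))"
      unfolding distinct_map using Suc
    proof (intro conjI inj_onI)
      fix v w assume "v \<in> set (paths t)" "w \<in> set (paths t)" "extensions t v = extensions t w"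
      then show "v = w" using ne[of v] extension_parent by (metis equals0I)
    qed
    show "distinct ys" if "ys \<in> set (map (extensions t) (paths t))" for ys
      using that by (auto simp: extensions_def)
    show "set ys \<inter> set zs = {}"
      if "ys \<in> set (map (extensions t) (paths t))" "zs \<in> set (map (extensions t) (paths t))" "ys \<noteq> zs" for ys zs
    proof -
      obtain v v' where v: "v \<in> set (paths t)" "ys = extensions t v" "v' \<in> set (paths t)" "zs = extensions t v'"
        using \<open>ys \<in> _\<close> \<open>zs \<in> _\<close> by auto
      have False if "w \<in> set ys" "w \<in> set zs" for w
        using extension_parent[OF v(1), of w] extension_parent[OF v(3), of w] that v \<open>ys \<noteq> zs\<close> by auto
      then show ?thesis by blast
    qed
  qed
qed simp

section \<open>Configurations reached along the paths\<close>

definition words :: "nat \<Rightarrow> tree list" where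
  "words t = map (\<lambda>w. ctree (tr (choice_of w) t)) (paths t)"

text \<open>Cell 0 is the starting cell and no nondeterministic bit; \<open>choice_of\<close> fixes
  it to \<open>False\<close>, so there is a single initial configuration.\<close>

lemma words_0: "words 0 = [ctree (start M, False, replicate (ntapes M) ([], []))]"
  by (simp add: words_def choice_of_def)

lemma map_extensions:
  assumes "w \<in> set (paths t)"
  shows "map (\<lambda>w. ctree (tr (choice_of w) (Suc t))) (extensions t w) = tree_succs M inp (ctree (tr (choice_of w) t))"
proof -
  let ?z = "tr (choice_of w) t"
  have pw: "pos (choice_of w) t = length w" using assms mem_paths by blast
  have next': "tree_next M inp (At (of_bool b)) (ctree ?z) = ctree (znext M inp b ?z)" for b
    by (rule tree_next_ctree[OF wf wf_tr valid_input_sym])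
  show ?thesis
  proof (cases "zhalted M ?z")
    case True
    then show ?thesis by (simp add: extensions_def advances_def tree_succs_def tree_halted_ctree)
  next
    case False
    show ?thesis
    proof (cases "zmove M inp ?z = 1")
      case True
      have "tr (choice_of (w @ [b])) (Suc t) = znext M inp b ?z" for b
      proof -
        have "pos (choice_of (w @ [b])) (Suc t) = Suc (length w)"
          using run_extension(2)[OF pw, of "[b]"] pos_Suc[of "choice_of w" t] pw True False by (simp add: advances_def)
        then show ?thesis using run_extension(1)[OF pw, of t "[b]"] False by (simp add: choice_of_def)
      qed
      then show ?thesis using True False next'[of False] next'[of True]
        by (simp add: extensions_def advances_def tree_succs_def tree_halted_ctree tree_branches_ctree[OF wf wf_tr valid_input_sym]
            del: trace.simps)
    next
      case nadv: False
      then have "pos (choice_of w) (Suc t) = pos (choice_of w) t" using pos_Suc[of "choice_of w" t] by (simp add: advances_def)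
      then have "tr (choice_of w) (Suc t) = znext M inp (fst (snd ?z)) ?z" using False tr_bit[of "choice_of w" t] by simp
      moreover have "t_bit (ctree ?z) = At (of_bool (fst (snd ?z)))" by (cases ?z) (simp del: ctree.simps)
      ultimately show ?thesis using nadv False next'[of "fst (snd ?z)"]
        by (simp add: extensions_def advances_def tree_succs_def tree_halted_ctree tree_branches_ctree[OF wf wf_tr valid_input_sym]
            del: trace.simps)
    qed
  qed
qed

lemma words_Suc: "words (Suc t) = concat (map (tree_succs M inp) (words t))"
proof -
  have "map (\<lambda>w. ctree (tr (choice_of w) (Suc t))) (concat (map (extensions t) ws)) =
      concat (map (tree_succs M inp) (map (\<lambda>w. ctree (tr (choice_of w) t)) ws))" if "set ws \<subseteq> set (paths t)" for ws
    using that
  proof (induction ws)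
    case (Cons w ws)
    then show ?case using map_extensions[of w t] by simp
  qed simp
  then show ?thesis by (simp add: words_def del: trace.simps)
qed

lemma length_paths: "length (paths t) \<le> 2 ^ t"
proof (induction t)
  case (Suc t)
  have "length (concat (map (extensions t) ws)) \<le> 2 * length ws" for ws
    by (induction ws) (auto simp: extensions_def)
  from this[of "paths t"] Suc show ?case by simp
qed simp

lemma mem_words:
  assumes "pos (choice_of w) s \<le> length w"
  shows "ctree (tr (choice_of w) s) \<in> set (words s)"
proof -
  let ?v = "take (pos (choice_of w) s) w"
  have r: "rn (choice_of ?v) s = rn (choice_of w) s" "tr (choice_of ?v) s = tr (choice_of w) s"
    using run_take[OF refl, of s s w] by simp_all
  have "?v \<in> set (paths s)" unfolding mem_paths r(1) using assms by simp
  then have "ctree (tr (choice_of ?v) s) \<in> set (words s)" unfolding words_def by (simp only: set_map image_eqI)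
  then show ?thesis unfolding r(2) .
qed

text \<open>Pigeonhole: before the first acceptance no configuration repeats, so a first acceptance
  after time \<open>T\<close> would put \<open>T + 1\<close> distinct configurations into
  \<open>A\<close>. Earlier acceptances persist until \<open>T\<close> because halted runs stand
  still.\<close>

lemma num_acc_words:
  assumes A: "finite A" "card A \<le> T" "\<And>s. s \<le> T \<Longrightarrow> set (words s) \<subseteq> A"
  shows "num_acc M x k = length (filter (\<lambda>z. label (t_state z) = acc M) (words T))"
proof -
  have state: "state (rn c n) = fst (tr c n)" for c n using rn_eq[of c n] by (metis state_conf_of)
  have "acc_paths M x k = {w \<in> set (paths T). fst (tr (choice_of w) T) = acc M}"
  proof (intro equalityI subsetI)
    fix w assume "w \<in> {w \<in> set (paths T). fst (tr (choice_of w) T) = acc M}"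
    then have p: "pos (choice_of w) T = length w" and a: "fst (tr (choice_of w) T) = acc M" using mem_paths by auto
    have "\<forall>m\<le>T. pos (choice_of w) m \<le> length w" using pos_mono p by metis
    then show "w \<in> acc_paths M x k" unfolding acc_paths_def state using a p by blast
  next
    fix w assume "w \<in> acc_paths M x k"
    then obtain n m where n: "fst (tr (choice_of w) n) = acc M" "\<And>m. m \<le> n \<Longrightarrow> pos (choice_of w) m \<le> length w"
      "m \<le> n" "pos (choice_of w) m = length w" unfolding acc_paths_def state by blast
    let ?c = "choice_of w"
    \<comment> \<open>The head attains \<open>length w\<close> at some time up to \<open>n\<close>
      and never retreats, while the length also bounds it.\<close>
    have pn: "pos ?c n = length w" using n pos_mono[OF n(3), of ?c] by (metis le_antisym order_refl)
    define n0 where "n0 = (LEAST n. fst (tr ?c n) = acc M)"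
    have n0: "fst (tr ?c n0) = acc M" "n0 \<le> n" unfolding n0_def using n(1) by (auto intro: LeastI Least_le)
    have first: "fst (tr ?c i) \<noteq> acc M" if "i < n0" for i using that not_less_Least unfolding n0_def by blast
    have h: "zhalted M (tr ?c n0)" unfolding zhalted_def using n0(1) by (rule disjI1)
    have "n0 \<le> T"
    proof (rule ccontr)
      assume T: "\<not> n0 \<le> T"
      have "inj_on (\<lambda>s. ctree (tr ?c s)) {..T}"
      proof (rule linorder_inj_onI)
        fix i j assume ij: "i < j" "i \<in> {..T}" "j \<in> {..T}"
        show "ctree (tr ?c i) \<noteq> ctree (tr ?c j)"
        proof
          assume "ctree (tr ?c i) = ctree (tr ?c j)"
          then have "fst (tr ?c i) = acc M" by (rule no_repetition[OF ctree_inject ij(1) n0(1)])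
          then show False using first[of i] ij T by simp
        qed
      qed auto
      then have "card ((\<lambda>s. ctree (tr ?c s)) ` {..T}) = Suc T" by (simp add: card_image)
      moreover have "(\<lambda>s. ctree (tr ?c s)) ` {..T} \<subseteq> A"
      proof clarify
        fix s assume "s \<le> T"
        then have "s \<le> n" using T n0(2) by simp
        from mem_words[OF n(2)[OF this]] A(3)[OF \<open>s \<le> T\<close>] show "ctree (tr ?c s) \<in> A" by blast
      qed
      ultimately show False using card_mono[OF A(1)] A(2) by (metis Suc_n_not_le_n le_trans)
    qed
    then have "tr ?c T = tr ?c n0 \<and> pos ?c T = pos ?c n0" by (rule halted_stays[OF h])
    moreover have "pos ?c n = pos ?c n0" using halted_stays[OF h n0(2)] by blast
    ultimately show "w \<in> {w \<in> set (paths T). fst (tr (choice_of w) T) = acc M}" using n0(1) pn mem_paths by simp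
  qed
  also have "\<dots> = set (filter (\<lambda>w. fst (tr (choice_of w) T) = acc M) (paths T))" by auto
  finally have "num_acc M x k = length (filter (\<lambda>w. fst (tr (choice_of w) T) = acc M) (paths T))"
    unfolding num_acc_def by (simp only: distinct_card distinct_filter distinct_paths)
  moreover have "label (t_state (ctree z)) = fst z" for z by (cases z) (simp del: ctree.simps)
  ultimately show ?thesis by (simp add: words_def filter_map comp_def)
qed

text \<open>A table after \<open>t\<close> rounds keeps every configuration seen so far, possibly with multiplicity 0.\<close>
lemma table_after:
  "\<exists>tb. (advance M inp ^^ t) (ttree [(ctree (start M, False, replicate (ntapes M) ([], [])), 1)]) = ttree tb \<and>
     distinct (map fst tb) \<and> fst ` set tb = (\<Union>s\<le>t. set (words s)) \<and> represents tb (words t)"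
proof (induction t)
  case 0
  show ?case
    by (intro exI[of _ "[(ctree (start M, False, replicate (ntapes M) ([], [])), 1)]"])
      (auto simp: words_0 represents_def)
next
  case (Suc t)
  then obtain tb where tb: "(advance M inp ^^ t) (ttree [(ctree (start M, False, replicate (ntapes M) ([], [])), 1)]) = ttree tb"
    "distinct (map fst tb)" "fst ` set tb = (\<Union>s\<le>t. set (words s))" "represents tb (words t)" by blast
  obtain tb' where tb': "advance M inp (ttree tb) = ttree tb'" "distinct (map fst tb')"
    "fst ` set tb' = fst ` set tb \<union> (\<Union>w\<in>fst ` set tb. set (tree_succs M inp w))"
    "represents tb' (words (Suc t))"
    using advance_ttree[OF tb(2,4), of M inp] unfolding words_Suc by blast
  have "(\<Union>w\<in>(\<Union>s\<le>t. set (words s)). set (tree_succs M inp w)) = (\<Union>s\<le>t. set (words (Suc s)))"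
    unfolding words_Suc by auto
  moreover have "(\<Union>s\<le>t. set (words s)) \<union> (\<Union>s\<le>t. set (words (Suc s))) = (\<Union>s\<le>Suc t. set (words s))"
  proof -
    have "{..Suc t} = {..t} \<union> Suc ` {..t}" by (auto simp: image_iff le_Suc_eq)
    then show ?thesis by auto
  qed
  ultimately show ?case using tb tb' by (intro exI[of _ tb']) auto
qed

end

section \<open>From programs to output machines\<close>

lemma tape_num_Least:
  assumes "t j \<notin> {1, 2}"
  shows "tape_num t = (\<Sum>i<(LEAST i. t i \<notin> {1, 2}). if t i = 2 then 2 ^ i else 0)"
  unfolding tape_num_def Let_def if_P[OF exI[of "\<lambda>i. t i \<notin> {1, 2}", OF assms]] by (rule refl)

lemma tape_num_marked:
  "tape_num (list_fun (map (\<lambda>b. of_bool b + 1) ds)) = (\<Sum>i<length ds. if ds ! i then 2 ^ i else 0)"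
proof -
  let ?s = "map (\<lambda>b. of_bool b + 1) ds :: nat list"
  have in12: "list_fun ?s i \<in> {1, 2}" if "i < length ds" for i using that by (simp add: list_fun_def)
  have out: "list_fun ?s (length ds) \<notin> {1, 2}" by (simp add: list_fun_def)
  have "(LEAST i. list_fun ?s i \<notin> {1, 2}) = length ds"
  proof (rule Least_equality, rule out)
    show "length ds \<le> i" if "list_fun ?s i \<notin> {1, 2}" for i using that in12[of i] by (meson not_le)
  qed
  then have "tape_num (list_fun ?s) = (\<Sum>i<length ds. if list_fun ?s i = 2 then 2 ^ i else 0)"
    using tape_num_Least[of "list_fun ?s", OF out] by simp
  also have "\<dots> = (\<Sum>i<length ds. if ds ! i then 2 ^ i else 0)"
    by (rule sum.cong) (auto simp: list_fun_def)
  finally show ?thesis .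
qed

lemma sum_bits: "(\<Sum>i<length (bits n). if bits n ! i then 2 ^ i else 0) = n"
proof (induction n rule: less_induct)
  case (less n)
  show ?case
  proof (cases "n = 0")
    case False
    have "(\<Sum>i<length (bits n). if bits n ! i then 2 ^ i else 0) =
        of_bool (odd n) + 2 * (\<Sum>i<length (bits (n div 2)). if bits (n div 2) ! i then 2 ^ i else (0::nat))"
      using False by (simp add: bits_pos sum.lessThan_Suc_shift sum_distrib_left if_distrib del: sum.lessThan_Suc cong: if_cong)
    also have "\<dots> = of_bool (odd n) + 2 * (n div 2)" using less.IH[of "n div 2"] False by simp
    finally show ?thesis by simp
  qed simp
qed

lemma wf_seq: "\<exists>B. wf_prog B p \<Longrightarrow> \<exists>B. wf_prog B q \<Longrightarrow> \<exists>B. wf_prog B (p ;; q)"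
  using wf_seqE[of p q] by auto

lemma realizes_wf: "realizes p P f \<Longrightarrow> \<exists>B. wf_prog B p"
  by (simp add: realizes_def)

text \<open>A list entry has the code 1 followed by its label plus 2, whereas an output digit is its
  bit plus 1; hence the subtraction of 1. The code 2 of the end of the list remains on stack
  2.\<close>

definition out_op :: prog where
  "out_op = While (\<lambda>ws. ws ! 2 = 1) (Pop 2 ;; Push 1 (\<lambda>a ws. ws ! 2 - 1) ;; Pop 2)"

lemma reaches_out:
  "reaches inp (out_op # K) [[], O', enc (ltree (map (\<lambda>b. At (of_bool b)) ds)), [], [], []] (12 * length ds + 1) K
     [[], rev (map (\<lambda>b. of_bool b + 1) ds) @ O', [2], [], [], []]"
proof (induction ds arbitrary: O')
  case Nil
  show ?case unfolding out_op_def by (rule reaches_whileF) (auto simp: reaches_refl numeral_2_eq_2)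
next
  case (Cons d ds)
  let ?t = "ltree (map (\<lambda>b. At (of_bool b)) ds)"
  have "reaches inp (out_op # K) [[], O', 1 # (a + 2) # enc ?t, [], [], []] 12 (out_op # K)
     [[], (a + 1) # O', enc ?t, [], [], []]" for a
    unfolding out_op_def
    by (rule reaches_whileT; (intro reaches_seqI Pop_evalI)?; simp; (intro reaches_intros)?; simp add: reaches_refl)
  from reaches_trans[OF this Cons.IH[of "(of_bool d + 1) # O'"] order_refl] show ?case by simp
qed

lemma wf_out: "wf_prog 6 out_op"
  unfolding out_op_def by (auto intro!: wf_Push wf_Pop) (auto simp: bounded_sym_def less_imp_diff_less)

lemma machine_of_prog:
  assumes "\<exists>B. wf_prog B p"
  shows "\<exists>M. wf_machine M \<and> 2 \<le> ntapes M \<and> (\<forall>x k n out X.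
     reaches (input_sym x k) [p] [[], [], [], [], [], []] n [] [[], out, X, [], [], []] \<longrightarrow>
     (\<exists>t\<le>n. halted M (det_run M x k t) \<and> out_value (det_run M x k t) = tape_num (list_fun (rev out))))"
proof -
  obtain B where "wf_prog B p" using assms by blast
  from compile_prog[OF this] obtain M where M: "wf_machine M" "ntapes M = 6"
    "\<And>x k n ts. (pstep (input_sym x k) ^^ n) ([p], replicate 6 (\<lambda>_. 0, 0)) = ([], ts) \<Longrightarrow>
       halted M (det_run M x k n) \<and> tapes (det_run M x k n) = ts" by blast
  show ?thesis
  proof (intro exI[of _ M] conjI allI impI M(1))
    show "2 \<le> ntapes M" by (simp add: M)
    fix x k n out X
    assume r: "reaches (input_sym x k) [p] [[], [], [], [], [], []] n [] [[], out, X, [], [], []]"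
    have "holds [[], [], [], [], [], []] (replicate 6 (\<lambda>_. 0, 0))"
      by (auto simp: holds_def plain_tape_def stack_tape_def less_Suc_eq numeral_eq_Suc)
    with r obtain t ts where t: "t \<le> n" "holds [[], out, X, [], [], []] ts"
      "(pstep (input_sym x k) ^^ t) ([p], replicate 6 (\<lambda>_. 0, 0)) = ([], ts)"
      unfolding reaches_def by blast
    have "plain_tape out (ts ! 1)"
      using t(2)[unfolded holds_def, THEN conjunct2, THEN conjunct2, rule_format, of 1] by simp
    then have "fst (ts ! 1) = list_fun (rev out)"
      by (auto simp: plain_tape_def list_fun_def split: prod.splits)
    then show "\<exists>t\<le>n. halted M (det_run M x k t) \<and> out_value (det_run M x k t) = tape_num (list_fun (rev out))"
      using t M(3)[OF t(3)] by (intro exI[of _ t]) (simp add: out_value_def)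
  qed
qed

lemma machine_of_computes:
  assumes "\<exists>B. wf_prog B p"
  shows "\<exists>M. wf_machine M \<and> 2 \<le> ntapes M \<and> (\<forall>x k n ds.
     computes (input_sym x k) p [] n [ltree (map (\<lambda>b. At (of_bool b)) ds)] \<longrightarrow>
     (\<exists>t\<le>n + 12 * length ds + 2. halted M (det_run M x k t) \<and>
        out_value (det_run M x k t) = (\<Sum>i<length ds. if ds ! i then 2 ^ i else 0)))"
proof -
  have "\<exists>B. wf_prog B (p ;; out_op)" using wf_seqE[OF assms] wf_out by auto
  from machine_of_prog[OF this] obtain M where M: "wf_machine M" "2 \<le> ntapes M"
    "\<And>x k n out X. reaches (input_sym x k) [p ;; out_op] [[], [], [], [], [], []] n [] [[], out, X, [], [], []] \<Longrightarrow>
     (\<exists>t\<le>n. halted M (det_run M x k t) \<and> out_value (det_run M x k t) = tape_num (list_fun (rev out)))"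
    by blast
  show ?thesis
  proof (intro exI[of _ M] conjI allI impI M(1,2))
    fix x k n ds
    assume c: "computes (input_sym x k) p [] n [ltree (map (\<lambda>b. At (of_bool b)) ds)]"
    then have "reaches (input_sym x k) (p # [out_op]) [[], [], [], [], [], []] n [out_op]
       [[], [], enc (ltree (map (\<lambda>b. At (of_bool b)) ds)), [], [], []]"
      using c[unfolded computes_def, THEN spec, THEN spec, of "[out_op]" "[]"] by simp
    from reaches_trans[OF this reaches_out[of _ "[]"] order_refl]
    have "reaches (input_sym x k) [p ;; out_op] [[], [], [], [], [], []] (n + 12 * length ds + 2) []
        [[], rev (map (\<lambda>b. of_bool b + 1) ds), [2], [], [], []]"
      by (intro reaches_seqI) simp_all
    from M(3)[OF this] show "\<exists>t\<le>n + 12 * length ds + 2. halted M (det_run M x k t) \<and>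
        out_value (det_run M x k t) = (\<Sum>i<length ds. if ds ! i then 2 ^ i else 0)"
      by (simp only: tape_num_marked rev_rev_ident)
  qed
qed

section \<open>Computable bounds\<close>

lemma tape_num_less: "tape_num (list_fun s) < 2 ^ length s"
proof -
  have out: "list_fun s (length s) \<notin> {1, 2}" by (simp add: list_fun_def)
  define L where "L = (LEAST i. list_fun s i \<notin> {1, 2})"
  have L: "L \<le> length s" unfolding L_def by (rule Least_le) (rule out)
  have "tape_num (list_fun s) = (\<Sum>i<L. if list_fun s i = 2 then 2 ^ i else 0)"
    unfolding L_def by (rule tape_num_Least) (rule out)
  also have "\<dots> \<le> (\<Sum>i<L. 2 ^ i)" by (rule sum_mono) auto
  also have "\<dots> < 2 ^ L" by (induction L) auto
  also have "\<dots> \<le> 2 ^ length s" using L by (rule power_increasing) simp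
  finally show ?thesis .
qed

lemma run_halted:
  assumes "halted M (run M x k c n)" "n \<le> m"
  shows "run M x k c m = run M x k c n"
  using assms(2)
proof (induction m rule: dec_induct)
  case (step m)
  then show ?case using assms(1) by (simp add: run_Suc step_def)
qed simp

lemma le_sum_atMost: "i \<le> n \<Longrightarrow> h i \<le> (\<Sum>i\<le>n. h i)" for h :: "nat \<Rightarrow> nat"
  using member_le_sum[of i "{..n}" h] by simp

lemma sum_exp2: "(\<Sum>i<m. 2 ^ i) = (2 ^ m - 1 :: nat)"
  by (induction m) auto

text \<open>Since only an upper bound is wanted, \<open>f'\<close> can be whatever the constructed
  machine outputs. If the machine for \<open>f\<close> ends with \<open>cs\<close> on its output
  tape, then f(k) < 2^|cs|. Doubling a list of g + 1 ones |cs| times gives m = (g + 1) 2^|cs| ones,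
  and these, read in binary, are 2^m - 1.\<close>

lemma computable_exp:
  assumes "computable f"
  shows "\<exists>f'. computable f' \<and> (\<forall>k. 2 ^ (g * f k) \<le> f' k)"
proof -
  obtain M where M: "wf_machine M" "2 \<le> ntapes M"
    "\<And>k. \<exists>t. halted M (det_run M [] k t) \<and> out_value (det_run M [] k t) = f k"
    using assms unfolding computable_def by blast
  let ?c1 = "\<lambda>(inp::nat \<Rightarrow> nat) v. if label (t_state v) = acc M then At 0 else if label (t_state v) = rej M then At 0 else Nd (At 0) (At 0)"
  let ?f1 = "\<lambda>inp v. tree_next M inp (At 0) v"
  \<comment> \<open>The second loop works on a list of ones and the cells of the output tape: each
    round doubles the list by \<open>rev_onto\<close> and removes one cell. Starting with
    \<open>Suc g\<close> ones keeps the estimate valid for g = 0.\<close>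
  let ?mid = "\<lambda>(inp::nat \<Rightarrow> nat) v. Nd (atoms (replicate (Suc g) 1)) (rev_onto (t_right 1 v) (t_left 1 v))"
  let ?c2 = "\<lambda>(inp::nat \<Rightarrow> nat) s. tsnd s"
  let ?f2 = "\<lambda>(inp::nat \<Rightarrow> nat) s. Nd (rev_onto (tfst s) (tfst s)) (tsnd (tsnd s))"
  have "ptime ?c1"
    by (intro ptime_if_label[where Q = "\<lambda>n. n = acc M"] ptime_if_label[where Q = "\<lambda>n. n = rej M"] ptime_t ptime_id ptime_const)
  moreover have "ptime ?f1" by (intro ptime_tree_next ptime_const ptime_id)
  ultimately obtain p1 R1 where p1: "iterates p1 R1 ?c1 ?f1"
    using ptime_while[of ?c1 ?f1] by blast
  have "ptime ?c2" "ptime ?f2" by (intro ptime_Nd ptime_rev_onto ptime_fst ptime_snd ptime_id)+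
  then obtain p2 R2 where p2: "iterates p2 R2 ?c2 ?f2"
    using ptime_while[of ?c2 ?f2] by blast
  have "ptime ?mid" by (intro ptime_Nd ptime_const ptime_rev_onto ptime_t ptime_id)
  then obtain pm Rm where pm: "realizes pm Rm ?mid" unfolding ptime_def by blast
  have "ptime (\<lambda>inp s. tfst s)" by (intro ptime_fst ptime_id)
  then obtain pf Rf where pf: "realizes pf Rf (\<lambda>inp s. tfst s)" unfolding ptime_def by blast
  let ?v0 = "ctree (start M, False, replicate (ntapes M) ([], []))"
  let ?p = "push_tree ?v0 ;; p1 ;; pm ;; p2 ;; pf"
  have "\<exists>B. wf_prog B ?p"
    by (intro wf_seq wf_push_tree iterates_wf[OF p1] iterates_wf[OF p2] realizes_wf[OF pm] realizes_wf[OF pf])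
  from machine_of_computes[OF this] obtain M' where M': "wf_machine M'" "2 \<le> ntapes M'"
    "\<And>x k n ds. computes (input_sym x k) ?p [] n [ltree (map (\<lambda>b. At (of_bool b)) ds)] \<Longrightarrow>
     (\<exists>t\<le>n + 12 * length ds + 2. halted M' (det_run M' x k t) \<and>
        out_value (det_run M' x k t) = (\<Sum>i<length ds. if ds ! i then 2 ^ i else 0))"
    by blast
  have "\<exists>t m. halted M' (det_run M' [] k t) \<and> out_value (det_run M' [] k t) = m \<and> 2 ^ (g * f k) \<le> m" for k
  proof -
    let ?inp = "input_sym [] k" and ?c = "\<lambda>_::nat. False"
    let ?tr = "trace M [] k ?c"
    have tr: "det_run M [] k t = conf_of (?tr t) (chead (det_run M [] k t))" "wf_zconfig M (?tr t)" for t
      using trace_correct[OF M(1), of "[]" k ?c t] unfolding det_run_def by blast+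
    have hl: "halted M (det_run M [] k t) \<longleftrightarrow> zhalted M (?tr t)" for t
      unfolding det_run_def by (rule halted_trace[OF M(1)])
    obtain t where t: "halted M (det_run M [] k t)" "out_value (det_run M [] k t) = f k" using M(3) by blast
    define n where "n = (LEAST t. zhalted M (?tr t))"
    have ht: "zhalted M (?tr t)" using t(1) hl by blast
    have n: "zhalted M (?tr n)" "n \<le> t" unfolding n_def by (rule LeastI, rule ht, rule Least_le, rule ht)
    have n': "\<not> zhalted M (?tr i)" if "i < n" for i using that unfolding n_def by (rule not_less_Least)
    have "det_run M [] k t = det_run M [] k n"
      using run_halted[of M "[]" k ?c n t] n hl[of n] unfolding det_run_def by blast
    then have outn: "out_value (det_run M [] k n) = f k" using t(2) by simp
    have it1: "(?f1 ?inp ^^ i) ?v0 = ctree (?tr i)" if "i \<le> n" for i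
      using that
    proof (induction i)
      case (Suc i)
      have "tree_next M ?inp (At (of_bool False)) (ctree (?tr i)) = ctree (znext M ?inp False (?tr i))"
        by (rule tree_next_ctree[OF M(1) tr(2) valid_input_sym])
      then show ?case using Suc n'[of i] by simp
    qed simp
    have st: "label (t_state (ctree z)) = fst z" for z by (cases z) (simp del: ctree.simps)
    \<comment> \<open>Any bound on the intermediate sizes will do, as computability sets no time
      limit; the sum is a convenient one.\<close>
    define S1 where "S1 = (\<Sum>i\<le>n. tsize (ctree (?tr i)))"
    have "computes ?inp p1 [?v0] ((n + 2) * R1 S1) [(?f1 ?inp ^^ n) ?v0]"
    proof (rule iterates_computes[OF p1 valid_input_sym])
      show "\<forall>i\<le>n. tsize ((?f1 ?inp ^^ i) ?v0) \<le> S1"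
        unfolding S1_def by (auto simp: it1 simp del: ctree.simps intro!: member_le_sum[where f = "\<lambda>i. tsize (ctree (?tr i))"])
      show "\<forall>i<n. is_Nd (?c1 ?inp ((?f1 ?inp ^^ i) ?v0))"
        using n' by (auto simp: it1 st zhalted_def simp del: ctree.simps)
      show "\<not> is_Nd (?c1 ?inp ((?f1 ?inp ^^ n) ?v0))"
        using n(1) by (auto simp: it1 st zhalted_def simp del: ctree.simps)
    qed
    then have 1: "computes ?inp p1 [?v0] ((n + 2) * R1 S1) [ctree (?tr n)]" by (simp only: it1 order_refl)
    obtain q b zs where z: "?tr n = (q, b, zs)" by (metis prod_cases3)
    have len: "length zs = ntapes M" using tr(2)[of n] by (simp add: z wf_zconfig_def)
    define cs where "cs = cells (zs ! 1)"
    have "fst (tapes (det_run M [] k n) ! 1) = list_fun cs"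
      using M(2) len by (subst tr(1)) (simp add: conf_of_def z cs_def)
    then have "f k < 2 ^ length cs" using tape_num_less[of cs] outn by (simp add: out_value_def)
    define s0 where "s0 = Nd (atoms (replicate (Suc g) 1)) (atoms cs)"
    have mid: "?mid ?inp (ctree (?tr n)) = s0"
      using M(2) len by (simp add: s0_def z cs_def rev_onto_ltree cells_def rev_map split: prod.split del: ctree.simps)
    have 2: "computes ?inp pm [ctree (?tr n)] (Rm (tsize (ctree (?tr n)))) [s0]"
      using realizesD(1)[OF pm valid_input_sym[of "[]" k] order_refl, of "ctree (?tr n)"] unfolding mid .
    have it2: "(?f2 ?inp ^^ i) s0 = Nd (atoms (replicate (Suc g * 2 ^ i) 1)) (atoms (drop i cs))" if "i \<le> length cs" for i
      using that
    proof (induction i)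
      case (Suc i)
      have "tsnd (atoms (drop i cs)) = atoms (drop (Suc i) cs)"
        using Suc.prems by (simp add: Cons_nth_drop_Suc[symmetric])
      then show ?case using Suc by (simp add: rev_onto_ltree replicate_add[symmetric] mult_2 algebra_simps)
    qed (simp add: s0_def)
    define S2 where "S2 = (\<Sum>i\<le>length cs. tsize ((?f2 ?inp ^^ i) s0))"
    have "computes ?inp p2 [s0] ((length cs + 2) * R2 S2) [(?f2 ?inp ^^ length cs) s0]"
    proof (rule iterates_computes[OF p2 valid_input_sym])
      show "\<forall>i\<le>length cs. tsize ((?f2 ?inp ^^ i) s0) \<le> S2"
        unfolding S2_def using le_sum_atMost[where h = "\<lambda>i. tsize ((?f2 ?inp ^^ i) s0)"] by blast
      show "\<forall>i<length cs. is_Nd (?c2 ?inp ((?f2 ?inp ^^ i) s0))" by (simp add: it2 is_Nd_iff)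
      show "\<not> is_Nd (?c2 ?inp ((?f2 ?inp ^^ length cs) s0))" by (simp add: it2)
    qed
    then have 3: "computes ?inp p2 [s0] ((length cs + 2) * R2 S2) [Nd (atoms (replicate (Suc g * 2 ^ length cs) 1)) (At 0)]"
      using it2[of "length cs"] by simp
    let ?m = "Suc g * 2 ^ length cs"
    let ?s1 = "Nd (atoms (replicate ?m 1)) (At 0)"
    have 4: "computes ?inp pf [?s1] (Rf (tsize ?s1)) [ltree (map (\<lambda>b. At (of_bool b)) (replicate ?m True))]"
      using realizesD(1)[OF pf valid_input_sym[of "[]" k] order_refl, of ?s1] by simp
    from computes_seq[OF computes_push_tree computes_seq[OF 1 computes_seq[OF 2 computes_seq[OF 3 4 order_refl] order_refl] order_refl] order_refl]
    obtain t' where t': "halted M' (det_run M' [] k t')"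
      "out_value (det_run M' [] k t') = (\<Sum>i<length (replicate ?m True). if replicate ?m True ! i then 2 ^ i else 0)"
      using M'(3) by blast
    have "(\<Sum>i<length (replicate ?m True). if replicate ?m True ! i then 2 ^ i else 0) = (\<Sum>i<?m. 2 ^ i :: nat)"
      by (rule sum.cong) auto
    also have "\<dots> = 2 ^ ?m - 1" by (simp only: sum_exp2)
    finally have o: "out_value (det_run M' [] k t') = 2 ^ ?m - 1" using t'(2) by (simp only:)
    \<comment> \<open>The additional 1 in the exponent makes up for the subtraction in 2^m -
      1.\<close>
    have "g * f k + 1 \<le> Suc g * (f k + 1)" by simp
    also have "\<dots> \<le> ?m" using \<open>f k < 2 ^ length cs\<close> by (intro mult_le_mono2) simp
    finally have "(2::nat) ^ (g * f k + 1) \<le> 2 ^ ?m" by (rule power_increasing) simp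
    moreover have "(1::nat) \<le> 2 ^ (g * f k)" by simp
    ultimately have "2 ^ (g * f k) \<le> out_value (det_run M' [] k t')" unfolding o by simp
    then show ?thesis using t'(1) by blast
  qed
  then have "\<forall>k. \<exists>m. \<exists>t. halted M' (det_run M' [] k t) \<and> out_value (det_run M' [] k t) = m \<and> 2 ^ (g * f k) \<le> m"
    by blast
  then obtain f' where f': "\<forall>k. \<exists>t. halted M' (det_run M' [] k t) \<and> out_value (det_run M' [] k t) = f' k \<and> 2 ^ (g * f k) \<le> f' k"
    by (rule choice[THEN exE])
  have "computable f'" unfolding computable_def
    by (rule exI[of _ M']) (use M'(1,2) f' in blast)
  then show ?thesis using f' by blast
qed

section \<open>Counting accepting paths\<close>

text \<open>A superset of the reachable configurations that depends on the space bound only. The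
  length is \<open>S + 1\<close> because a head on cell \<open>S\<close> has \<open>S\<close> cells
  to its left and scans one more.\<close>

definition word_space :: "machine \<Rightarrow> nat \<Rightarrow> tree set" where
  "word_space M S = (let L = {l. set l \<subseteq> {..<nsyms M} \<and> length l \<le> S + 1} in
     ctree ` ({..<nstates M} \<times> UNIV \<times> {zs. set zs \<subseteq> L \<times> L \<and> length zs = ntapes M}))"

text \<open>One exponent for two purposes: the first three summands bound the number of
  configurations (states, choice bit, two lists per tape), the last two the size of an encoded
  configuration.\<close>

definition space_exp :: "machine \<Rightarrow> nat" where
  "space_exp M = nstates M + 1 + 2 * ntapes M * (nsyms M + 1) + 5 + 8 * ntapes M"

lemma card_bounded_lists:
  "card {l. set l \<subseteq> {..<s::nat} \<and> length l \<le> m} \<le> 2 ^ ((s + 1) * (m + 1))"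
proof -
  have "card {l. set l \<subseteq> {..<s} \<and> length l \<le> m} = (\<Sum>i\<le>m. s ^ i)"
    using card_lists_length_le[of "{..<s}" m] by simp
  also have "\<dots> \<le> (\<Sum>i\<le>m. 2 ^ (s * m))"
  proof (rule sum_mono)
    fix i assume "i \<in> {..m}"
    \<comment> \<open>The crude estimate s \<le> 2^s costs only a constant factor in the exponent,
      since the alphabet of the machine is fixed.\<close>
    have "s ^ i \<le> (2 ^ s) ^ i" by (rule power_mono[OF less_imp_le[OF less_exp]]) simp
    also have "\<dots> = 2 ^ (s * i)" by (simp add: power_mult)
    also have "\<dots> \<le> 2 ^ (s * m)" using \<open>i \<in> {..m}\<close> by (intro power_increasing mult_le_mono2) auto
    finally show "s ^ i \<le> 2 ^ (s * m)" .
  qed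
  also have "\<dots> = (m + 1) * 2 ^ (s * m)" by simp
  also have "\<dots> \<le> 2 ^ (m + 1) * 2 ^ (s * m)" by (intro mult_le_mono1 less_imp_le less_exp)
  also have "\<dots> = 2 ^ (m + 1 + s * m)" by (simp only: power_add)
  also have "\<dots> \<le> 2 ^ ((s + 1) * (m + 1))" by (intro power_increasing) (auto simp: algebra_simps)
  finally show ?thesis .
qed

lemma word_space_bounds:
  shows "finite (word_space M S)" "card (word_space M S) \<le> 2 ^ (space_exp M * (S + 2))"
    "w \<in> word_space M S \<Longrightarrow> tsize w \<le> 2 ^ (space_exp M * (S + 2))"
proof -
  define L where "L = {l. set l \<subseteq> {..<nsyms M} \<and> length l \<le> S + 1}"
  define Z where "Z = {zs. set zs \<subseteq> L \<times> L \<and> length zs = ntapes M}"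
  have W: "word_space M S = ctree ` ({..<nstates M} \<times> UNIV \<times> Z)"
    by (simp add: word_space_def L_def Z_def Let_def)
  have L: "finite L" "card L \<le> 2 ^ ((nsyms M + 1) * (S + 2))"
    using card_bounded_lists[of "nsyms M" "S + 1"] finite_lists_length_le[of "{..<nsyms M}" "S + 1"] by (auto simp: L_def)
  then have Z: "finite Z" unfolding Z_def by (intro finite_lists_length_eq) simp
  have fin: "finite ({..<nstates M} \<times> (UNIV :: bool set) \<times> Z)" using Z by simp
  show "finite (word_space M S)" unfolding W using fin by (rule finite_imageI)
  have "card Z = (card L * card L) ^ ntapes M"
    unfolding Z_def using L(1) by (subst card_lists_length_eq) (auto simp: card_cartesian_product)
  also have "\<dots> \<le> (2 ^ ((nsyms M + 1) * (S + 2)) * 2 ^ ((nsyms M + 1) * (S + 2))) ^ ntapes M"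
    by (intro power_mono mult_le_mono L(2)) simp
  also have "\<dots> = 2 ^ (2 * ntapes M * (nsyms M + 1) * (S + 2))"
    by (simp only: power_add[symmetric] power_mult[symmetric]) (simp add: algebra_simps)
  finally have cZ: "card Z \<le> 2 ^ (2 * ntapes M * (nsyms M + 1) * (S + 2))" .
  have "card (word_space M S) \<le> card ({..<nstates M} \<times> (UNIV :: bool set) \<times> Z)"
    unfolding W by (rule card_image_le[OF fin])
  also have "\<dots> = nstates M * 2 * card Z" by (simp add: card_cartesian_product)
  also have "\<dots> \<le> 2 ^ nstates M * 2 ^ 1 * 2 ^ (2 * ntapes M * (nsyms M + 1) * (S + 2))"
    using less_exp[of "nstates M"] cZ by (intro mult_le_mono) auto
  also have "\<dots> = 2 ^ (nstates M + 1 + 2 * ntapes M * (nsyms M + 1) * (S + 2))" by (simp only: power_add)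
  also have "\<dots> \<le> 2 ^ (space_exp M * (S + 2))"
    by (intro power_increasing) (auto simp: space_exp_def algebra_simps)
  finally show "card (word_space M S) \<le> 2 ^ (space_exp M * (S + 2))" .
  assume "w \<in> word_space M S"
  then obtain q b zs where w: "w = ctree (q, b, zs)" "set zs \<subseteq> L \<times> L" "length zs = ntapes M"
    unfolding W Z_def by blast
  have zipper: "tsize (case z of (l, r) \<Rightarrow> Nd (atoms l) (atoms r)) \<le> 4 * S + 7" if "z \<in> set zs" for z
    using that w(2) by (auto simp: tsize_ltree comp_def sum_list_triv L_def)
  have "sum_list (map (\<lambda>z. Suc (tsize (case z of (l, r) \<Rightarrow> Nd (atoms l) (atoms r)))) zs) \<le> sum_list (map (\<lambda>z. 4 * S + 8) zs)"
  proof (rule sum_list_mono)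
    fix z assume "z \<in> set zs"
    from zipper[OF this] show "Suc (tsize (case z of (l, r) \<Rightarrow> Nd (atoms l) (atoms r))) \<le> 4 * S + 8" by linarith
  qed
  then have "tsize w \<le> 5 + ntapes M * (4 * S + 8)"
    using w(3) by (simp add: w(1) tsize_ltree comp_def sum_list_triv)
  also have "\<dots> \<le> space_exp M * (S + 2)" by (simp add: space_exp_def algebra_simps)
  also have "\<dots> \<le> 2 ^ (space_exp M * (S + 2))" by (rule less_imp_le[OF less_exp])
  finally show "tsize w \<le> 2 ^ (space_exp M * (S + 2))" .
qed

context bounded_machine
begin

lemma words_in_space:
  assumes S: "\<And>c n i. i < ntapes M \<Longrightarrow> snd (tapes (rn c n) ! i) \<le> S"
  shows "set (words t) \<subseteq> word_space M S"
proof -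
  define L where "L = {l. set l \<subseteq> {..<nsyms M} \<and> length l \<le> S + 1}"
  have "ctree (tr c t) \<in> word_space M S" for c
  proof -
    obtain q b zs where z: "tr c t = (q, b, zs)" by (metis prod_cases3)
    have "\<forall>y\<in>set zs. length (fst y) + length (snd y) \<le> S + 1"
      using trace_size[OF wf S, of c t] by (simp add: z)
    moreover have "q < nstates M" "length zs = ntapes M" "\<forall>y\<in>set zs. \<forall>s\<in>set (fst y) \<union> set (snd y). s < nsyms M"
      using wf_tr[of c t] by (auto simp: z wf_zconfig_def)
    ultimately have "set zs \<subseteq> L \<times> L" "q < nstates M" "length zs = ntapes M"
      by (fastforce simp: L_def)+
    then show ?thesis unfolding word_space_def Let_def z L_def[symmetric] by blast
  qed
  then show ?thesis by (auto simp: words_def)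
qed

lemma weigh_indicator: "sum_list (map (\<lambda>z. if P z then 1 else 0) zs) = length (filter P zs)" for zs :: "tree list"
  by (induction zs) auto

text \<open>The constant weight 1 shows that all multiplicities together equal the number of paths,
  at most 2^t. So each has at most t + 1 binary digits.\<close>

lemma table_multiplicity:
  assumes "represents tb (words t)" "(w, n) \<in> set tb"
  shows "n \<le> 2 ^ t"
proof -
  have "weigh (\<lambda>_. 1) tb = length (words t)"
    using assms(1) by (simp add: represents_def sum_list_triv)
  moreover have "n \<le> weigh (\<lambda>_. 1) tb" unfolding weigh_def
    by (rule member_le_sum_list) (use assms(2) in \<open>force, simp\<close>)
  ultimately show ?thesis using length_paths[of t] by (simp add: words_def)
qed

lemma tsize_table:
  assumes "represents tb (words t)" "\<And>w. w \<in> fst ` set tb \<Longrightarrow> tsize w \<le> W"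
  shows "tsize (ttree tb) \<le> 1 + length tb * (W + 2 * t + 5)"
proof -
  have entry: "Suc (tsize (case p of (w, n) \<Rightarrow> Nd w (btree n))) \<le> W + 2 * t + 5" if "p \<in> set tb" for p
  proof -
    obtain w n where p: "p = (w, n)" by fastforce
    have "n \<le> 2 ^ t" using table_multiplicity[OF assms(1)] that p by blast
    then have "n < 2 ^ (t + 1)" using power_strict_increasing[of t "t + 1" "2::nat"] by linarith
    then have "length (bits n) \<le> t + 1" by (rule length_bits_le)
    moreover have "tsize w \<le> W" using assms(2) that p by force
    ultimately show ?thesis by (simp add: p tsize_btree)
  qed
  have "sum_list (map (\<lambda>p. Suc (tsize (case p of (w, n) \<Rightarrow> Nd w (btree n)))) tb) \<le> sum_list (map (\<lambda>p. W + 2 * t + 5) tb)"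
    by (rule sum_list_mono) (rule entry)
  then show ?thesis by (simp add: ttree_def tsize_ltree comp_def sum_list_triv)
qed

end

lemma foldl_tsnd: "foldl (\<lambda>a e. tsnd a) u es = (tsnd ^^ length es) u"
  by (induction es arbitrary: u) (simp_all add: funpow_swap1)

text \<open>The loop keeps a unary round counter and stops once it exceeds the number of configurations
  seen so far: a longer accepting path would have to repeat a configuration.\<close>
lemma count_program:
  assumes wf: "wf_machine M"
  shows "\<exists>p Q. (\<exists>B. wf_prog B p) \<and> polyf Q \<and> (\<forall>x k G S. bounded_machine M x k G \<longrightarrow>
    (\<forall>c n i. i < ntapes M \<longrightarrow> snd (tapes (run M x k c n) ! i) \<le> S) \<longrightarrow>
    computes (input_sym x k) p [] (Q (2 ^ (space_exp M * (S + 2)))) [btree (num_acc M x k)] \<and>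
    length (bits (num_acc M x k)) \<le> Q (2 ^ (space_exp M * (S + 2))))"
proof -
  \<comment> \<open>Comparison of two lengths: the counter loses one element per table entry, and if
    something is left, the counter was longer and the loop stops.\<close>
  let ?c = "\<lambda>(inp::nat \<Rightarrow> nat) s. if is_Nd (foldl (\<lambda>a e. tsnd a) (tfst s) (tlist (tsnd s))) then At 0 else Nd (At 0) (At 0)"
  let ?f = "\<lambda>inp s. Nd (Nd (At 0) (tfst s)) (advance M inp (tsnd s))"
  have "ptime (\<lambda>inp s. foldl (\<lambda>a e. (\<lambda>(inp::nat \<Rightarrow> nat) s. tsnd (tfst (tsnd s))) inp (Nd s (Nd a e))) (tfst s) (tlist (tsnd s)))"
  proof (rule ptime_fold[where Q = "\<lambda>n. 0"])
    show "tsize ((\<lambda>(inp::nat \<Rightarrow> nat) s. tsnd (tfst (tsnd s))) inp (Nd x (Nd a e))) \<le> tsize a + 0" for inp x a e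
      using tsize_tsnd[of a] by simp
  qed (intro ptime_fst ptime_snd ptime_id polyf_intros)+
  then have "ptime ?c" by (intro ptime_if_Nd ptime_Nd ptime_const) simp
  moreover have "ptime ?f" by (intro ptime_Nd ptime_const ptime_fst ptime_snd ptime_id ptime_advance)
  ultimately obtain p R where p: "iterates p R ?c ?f"
    using ptime_while[of ?c ?f] by blast
  have "ptime (\<lambda>inp s. accepted M (tsnd s))" by (intro ptime_accepted ptime_snd ptime_id)
  then obtain q Q where q: "realizes q Q (\<lambda>inp s. accepted M (tsnd s))" unfolding ptime_def by blast
  let ?t0 = "ttree [(ctree (start M, False, replicate (ntapes M) ([], [])), 1)]"
  \<comment> \<open>The counter starts with one element, so after \<open>i\<close> rounds the test
    reads \<open>card (V i) < Suc i\<close>, which is the condition \<open>card A \<le> T\<close> of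
    \<open>num_acc_words\<close>.\<close>
  let ?s0 = "Nd (atoms [0]) ?t0"
  let ?p = "push_tree ?s0 ;; p ;; q"
  \<comment> \<open>\<open>N\<close> bounds three quantities at once: the number of table entries,
    the size of an encoded configuration, and the number of rounds, hence also the digits of a
    multiplicity and the length of the counter.\<close>
  let ?B = "\<lambda>N. 2 * N + 10 + N * (N + 2 * N + 10)"
  let ?Q = "\<lambda>N. 6 * tsize ?s0 + (N + 2) * R (?B N) + Q (?B N) + N + 10"
  have "\<exists>B. wf_prog B ?p" by (intro wf_seq wf_push_tree iterates_wf[OF p] realizes_wf[OF q])
  moreover have "polyf ?Q"
  proof -
    have B: "polyf ?B" by (intro polyf_intros)
    show ?thesis by (intro polyf_intros polyf_comp[OF iterates_polyf[OF p] B] polyf_comp[OF realizes_polyf[OF q] B])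
  qed
  moreover have "computes (input_sym x k) ?p [] (?Q (2 ^ (space_exp M * (S + 2)))) [btree (num_acc M x k)] \<and>
    length (bits (num_acc M x k)) \<le> ?Q (2 ^ (space_exp M * (S + 2)))"
    if bm: "bounded_machine M x k G" and S: "\<forall>c n i. i < ntapes M \<longrightarrow> snd (tapes (run M x k c n) ! i) \<le> S"
    for x k G S
  proof -
    interpret bounded_machine M x k G by (rule bm)
    define N where "N = (2::nat) ^ (space_exp M * (S + 2))"
    define V where "V t = (\<Union>s\<le>t. set (words s))" for t
    have sub: "V t \<subseteq> word_space M S" for t unfolding V_def using words_in_space S by blast
    have finV: "finite (V t)" for t unfolding V_def by simp
    have cV: "card (V t) \<le> N" for t
      using card_mono[OF word_space_bounds(1) sub] word_space_bounds(2)[of M S] le_trans unfolding N_def by blast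
    \<comment> \<open>At \<open>t = N\<close> the test succeeds, because at most \<open>N\<close>
      configurations exist; so the loop ends after at most \<open>N\<close> rounds.\<close>
    define T where "T = (LEAST t. card (V t) < Suc t)"
    have TN: "card (V T) < Suc T" "T \<le> N"
      unfolding T_def by (rule LeastI[of "\<lambda>t. card (V t) < Suc t" N] Least_le, use cV[of N] in simp)+
    have before: "\<not> card (V i) < Suc i" if "i < T" for i using that unfolding T_def by (rule not_less_Least)
    have "\<exists>tb. \<forall>t. (advance M inp ^^ t) ?t0 = ttree (tb t) \<and> distinct (map fst (tb t)) \<and>
        fst ` set (tb t) = V t \<and> represents (tb t) (words t)"
      unfolding V_def using table_after by metis
    then obtain tb where tb: "\<And>t. (advance M inp ^^ t) ?t0 = ttree (tb t)" "\<And>t. distinct (map fst (tb t))"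
      "\<And>t. fst ` set (tb t) = V t" "\<And>t. represents (tb t) (words t)" by blast
    have len: "length (tb t) = card (V t)" for t
      using distinct_card[OF tb(2)[of t]] tb(3)[of t] by simp
    have it: "(?f inp ^^ i) ?s0 = Nd (atoms (replicate (Suc i) 0)) (ttree (tb i))" for i
    proof -
      have "(?f inp ^^ i) ?s0 = Nd (atoms (replicate (Suc i) 0)) ((advance M inp ^^ i) ?t0)"
      proof (induction i)
        case (Suc i)
        then show ?case by (simp only: funpow.simps comp_apply tfst.simps tsnd.simps replicate.simps list.map ltree.simps)
      qed simp
      then show ?thesis by (simp only: tb(1))
    qed
    have cond: "is_Nd (?c inp ((?f inp ^^ i) ?s0)) \<longleftrightarrow> \<not> card (V i) < Suc i" for i
    proof -
      have "is_Nd ((tsnd ^^ length (tb i)) (atoms (replicate (Suc i) 0))) \<longleftrightarrow> length (tb i) < Suc i"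
        by (simp add: is_Nd_iff tlist_drop not_le del: replicate.simps ltree.simps)
      moreover have "length (tlist (ttree (tb i))) = length (tb i)" by (simp add: ttree_def)
      ultimately show ?thesis unfolding it foldl_tsnd tfst.simps tsnd.simps len by simp
    qed
    have size: "tsize ((?f inp ^^ i) ?s0) \<le> ?B N" if "i \<le> T" for i
    proof -
      have "tsize (ttree (tb i)) \<le> 1 + length (tb i) * (N + 2 * i + 5)"
        by (rule tsize_table[OF tb(4)]) (use tb(3)[of i] sub[of i] word_space_bounds(3)[of _ M S] in \<open>auto simp: N_def\<close>)
      also have "\<dots> \<le> 1 + N * (N + 2 * N + 5)"
        using that TN(2) cV[of i] len[of i] by (intro add_left_mono mult_le_mono) auto
      also have "\<dots> \<le> 1 + N * (N + 2 * N + 10)" by simp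
      finally have "tsize (ttree (tb i)) \<le> 1 + N * (N + 2 * N + 10)" .
      moreover have "tsize (atoms (replicate (Suc i) 0)) = 2 * i + 3"
        by (simp add: tsize_ltree sum_list_replicate)
      ultimately show ?thesis unfolding it using that TN(2) by simp
    qed
    have "computes inp p [?s0] ((T + 2) * R (?B N)) [(?f inp ^^ T) ?s0]"
      by (rule iterates_computes[OF p valid_input_sym]) (use before cond TN(1) size in blast)+
    then have 1: "computes inp p [?s0] ((T + 2) * R (?B N)) [Nd (atoms (replicate (Suc T) 0)) (ttree (tb T))]"
      unfolding it .
    have na: "num_acc M x k = length (filter (\<lambda>z. label (t_state z) = acc M) (words T))"
      by (rule num_acc_words[OF finV[of T]]) (use TN in \<open>auto simp: V_def\<close>)
    have "accepted M (ttree (tb T)) = btree (num_acc M x k)"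
      unfolding accepted_ttree na using tb(4)[of T] by (simp add: represents_def weigh_indicator)
    then have 2: "computes inp q [Nd (atoms (replicate (Suc T) 0)) (ttree (tb T))] (Q (?B N)) [btree (num_acc M x k)]"
      using realizesD(1)[OF q valid_input_sym[of x k] size[OF order_refl]] unfolding it tsnd.simps by simp
    have rounds: "(T + 2) * R (?B N) \<le> (N + 2) * R (?B N)" using TN(2) by (intro mult_le_mono1) simp
    have sum: "a + (b + c + 1) + 1 \<le> a + b' + c + d + 10" if "b \<le> b'" for a b b' c d :: nat
      using that by simp
    have "computes inp ?p [] (?Q N) [btree (num_acc M x k)]"
      by (rule computes_seq[OF computes_push_tree computes_seq[OF 1 2 order_refl] sum[OF rounds]])
    moreover have "length (bits (num_acc M x k)) \<le> ?Q N"
    proof -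
      have "num_acc M x k \<le> 2 ^ T"
        unfolding na by (rule order_trans[OF length_filter_le]) (simp add: words_def length_paths)
      then have "num_acc M x k < 2 ^ (T + 1)" using power_strict_increasing[of T "T + 1" "2::nat"] by linarith
      then have "length (bits (num_acc M x k)) \<le> T + 1" by (rule length_bits_le)
      then show ?thesis using TN(2) by simp
    qed
    ultimately show ?thesis unfolding N_def by blast
  qed
  ultimately show ?thesis by blast
qed

text \<open>Rounding up loses less than a factor 2 and the summand 1 another factor 2, so every base
  from 4 on serves. The additive constant covers n = 0, where \<open>ceillog2\<close> is 0.\<close>

lemma exp_ceillog2_le: "2 ^ (g * (ceillog2 n + 1)) \<le> 6 ^ g * n ^ g + (6 ^ g :: nat)"
proof (cases "n = 0")
  case True
  have "(2::nat) ^ g \<le> 6 ^ g" by (rule power_mono) simp_all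
  then show ?thesis using True by (simp add: trans_le_add2)
next
  case False
  then have "2 ^ ceillog2 n < 2 * n" by (intro two_power_ceillog2_gt) simp
  then have "2 ^ (ceillog2 n + 1) \<le> 6 * n" by simp
  then have "(2 ^ (ceillog2 n + 1)) ^ g \<le> (6 * n) ^ g" by (rule power_mono) simp
  then show ?thesis by (simp only: power_mult[symmetric] mult.commute[of g] power_mult_distrib)
qed

theorem theorem9:
  shows "sharp_para_beta_L \<subseteq> FFPT"
proof
  fix F assume "F \<in> sharp_para_beta_L"
  then obtain M where M: "wf_machine M" "paraL_machine M" "k_bounded M" "read_once M"
    and F: "\<And>x k. num_acc M x k = F x k" unfolding sharp_para_beta_L_def by blast
  obtain f C where f: "computable f" and space: "\<And>x k c n i. i < ntapes M \<Longrightarrow>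
      snd (tapes (run M x k c n) ! i) \<le> C * (ceillog2 (length x) + f k + 1)"
    using M(2) unfolding paraL_machine_def by blast
  obtain h where h: "\<And>x k c n. chead (run M x k c n) \<le> h k * ceillog2 (length x)"
    using M(3) unfolding k_bounded_def by blast
  have bm: "bounded_machine M x k (h k * ceillog2 (length x))" for x k
    by unfold_locales (use M(1,4) h in \<open>auto simp: read_once_def\<close>)
  obtain p Q where p: "\<exists>B. wf_prog B p" "polyf Q"
    "\<And>x k G S. bounded_machine M x k G \<Longrightarrow> (\<forall>c n i. i < ntapes M \<longrightarrow> snd (tapes (run M x k c n) ! i) \<le> S) \<Longrightarrow>
      computes (input_sym x k) p [] (Q (2 ^ (space_exp M * (S + 2)))) [btree (num_acc M x k)] \<and>
      length (bits (num_acc M x k)) \<le> Q (2 ^ (space_exp M * (S + 2)))"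
    using count_program[OF M(1)] by blast
  obtain M' where M': "wf_machine M'" "2 \<le> ntapes M'"
    "\<And>x k n ds. computes (input_sym x k) p [] n [ltree (map (\<lambda>b. At (of_bool b)) ds)] \<Longrightarrow>
     (\<exists>t\<le>n + 12 * length ds + 2. halted M' (det_run M' x k t) \<and>
        out_value (det_run M' x k t) = (\<Sum>i<length ds. if ds ! i then 2 ^ i else 0))"
    using machine_of_computes[OF p(1)] by blast
  have "polyf (\<lambda>n. Q n + 12 * Q n + 2)" by (intro polyf_intros p(2))
  then obtain e where e: "\<And>m. Q (2 ^ m) + 12 * Q (2 ^ m) + 2 \<le> 2 ^ (e * (m + 1))"
    using polyf_exp_bound[of "\<lambda>n. Q n + 12 * Q n + 2"] by blast
  \<comment> \<open>Chosen such that \<open>e * (?m + 1) \<le> g * ?l\<close> below: since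
    \<open>?l\<close> is at least 1, the constants 2 and 1 can be absorbed into multiples of
    \<open>?l\<close>.\<close>
  define g where "g = e * (space_exp M * (C + 2) + 1)"
  obtain f' where f': "computable f'" "\<And>k. 2 ^ (g * f k) \<le> f' k"
    using computable_exp[OF f, of g] by blast
  have "\<exists>t. t \<le> f' k * (6 ^ g * length x ^ g + 6 ^ g) \<and>
      halted M' (det_run M' x k t) \<and> out_value (det_run M' x k t) = F x k" for x k
  proof -
    let ?l = "ceillog2 (length x) + f k + 1"
    let ?m = "space_exp M * (C * ?l + 2)"
    have c: "computes (input_sym x k) p [] (Q (2 ^ ?m)) [btree (F x k)]" "length (bits (F x k)) \<le> Q (2 ^ ?m)"
      using p(3)[OF bm, of x k "C * ?l"] space unfolding F by blast+
    from M'(3)[OF c(1)[unfolded btree_def]] obtain t where t: "t \<le> Q (2 ^ ?m) + 12 * length (bits (F x k)) + 2"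
      "halted M' (det_run M' x k t)" "out_value (det_run M' x k t) = F x k"
      unfolding sum_bits by blast
    have "t \<le> 2 ^ (e * (?m + 1))" using t(1) c(2) e[of ?m] by linarith
    also have "\<dots> \<le> 2 ^ (g * ?l)"
    proof (rule power_increasing)
      have "C * ?l + 2 \<le> (C + 2) * ?l" by (simp add: algebra_simps)
      then have "?m + 1 \<le> space_exp M * ((C + 2) * ?l) + ?l" by (intro add_mono mult_le_mono2) auto
      also have "\<dots> = (space_exp M * (C + 2) + 1) * ?l" by (simp add: algebra_simps)
      finally show "e * (?m + 1) \<le> g * ?l" unfolding g_def mult.assoc by (rule mult_le_mono2)
    qed simp
    \<comment> \<open>The exponent is a sum of a part in \<open>k\<close> and a part in the input
      length; the first factor goes into \<open>f'\<close>, the second into the polynomial.\<close>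
    also have "\<dots> = 2 ^ (g * f k) * 2 ^ (g * (ceillog2 (length x) + 1))"
      by (simp add: power_add[symmetric] algebra_simps)
    also have "\<dots> \<le> f' k * (6 ^ g * length x ^ g + 6 ^ g)"
      by (intro mult_le_mono f'(2) exp_ceillog2_le)
    finally show ?thesis using t by blast
  qed
  then show "F \<in> FFPT" unfolding FFPT_def using M'(1,2) f'(1) by blast
qed

end
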